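(* Let $X=(X_1,\dots,X_n)$ be a sample from a time series, with $S_k=\sum_{j=1}^kX_j$ and $S^*_{n-k}=\sum_{j=k+1}^nX_j$, and let $\mathcal T=[\underline\tau,\overline\tau]\subset(0,1)$. Assume $\mathbf{H_0[I]}$: there exist $d\in(-.5,1.5)$, $d\ne .5$, $\kappa>0$ and a normalization $A_n$ such that $$n^{-d-.5}\big(S_{\lfloor n\tau\rfloor}-\lfloor n\tau\rfloor A_n\big)\longrightarrow_{D[0,1]}\kappa B^{\rm I}_{d+.5}(\tau),\qquad n\to\infty,$$ where $B^{\rm I}_{d+.5}$ is a type I fractional Brownian motion. Then, as $n\to\infty$, $$W_n(X)\to_{\rm law}W(B^{\rm I}_{d+.5}),\qquad I_n(X)\to_{\rm law}I(B^{\rm I}_{d+.5}),\qquad R_n(X)\to_{\rm law}R(B^{\rm I}_{d+.5}).$$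
   Context: $D[0,1]$ is the space of real-valued cadlag functions on $[0,1]$ with the uniform topology and the $\sigma$-field generated by open balls; $\longrightarrow_{D[0,1]}$ is weak convergence in it; $\to_{\rm law}$ is convergence in law. Type I fractional Brownian motion: with $\{B(u),u\in\mathbb R\}$ a standard two-sided Brownian motion (zero mean, $E B^2(u)=|u|$), for $\tau\ge0$, $$B^{\rm I}_{d+.5}(\tau):=\frac1{\Gamma(d+1)}\int_{-\infty}^\tau\big((\tau-u)^d-(-u)_+^d\big)\,dB(u)\ \text{ if }-.5<d<.5,\qquad B^{\rm I}_{d+.5}(\tau):=\int_0^\tau B^{\rm I}_{d-.5}(u)\,du\ \text{ if }.5<d<1.5,$$ where $(-u)_+=(-u)\vee0$ and $(-u)_+^d$ is taken to be $0$ for $u\ge0$. Statistics: for $1\le k<n$, $$V_k(X):=\frac1{k^2}\sum_{j=1}^k\Big(S_j-\frac jkS_k\Big)^2-\Big(\frac1{k^{3/2}}\sum_{j=1}^k\big(S_j-\frac jkS_k\big)\Big)^2,$$ $$V^*_{n-k}(X):=\frac1{(n-k)^2}\sum_{j=k+1}^n\Big(S^*_{n-j+1}-\frac{n-j+1}{n-k}S^*_{n-k}\Big)^2-\Big(\frac1{(n-k)^{3/2}}\sum_{j=k+1}^n\big(S^*_{n-j+1}-\frac{n-j+1}{n-k}S^*_{n-k}\big)\Big)^2.$$ With $\mathcal L_n(\tau):=V^*_{n-\lfloor n\tau\rfloor}(X)/V_{\lfloor n\tau\rfloor}(X)$, $$W_n(X):=\sup_{\tau\in\mathcal T}\mathcal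 L_n(\tau),\quad I_n(X):=\int_{\mathcal T}\mathcal L_n(\tau)\,d\tau,\quad R_n(X):=\frac{\inf_{\tau\in\mathcal T}V^*_{n-\lfloor n\tau\rfloor}(X)}{\inf_{\tau\in\mathcal T}V_{\lfloor n\tau\rfloor}(X)}.$$ For a process $Z$ on $[0,1]$, $Z^*(u):=Z(1)-Z(1-u)$, $$Q_\tau(Z):=\frac1{\tau^2}\Big[\int_0^\tau\big(Z(u)-\frac u\tau Z(\tau)\big)^2du-\frac1\tau\Big(\int_0^\tau\big(Z(u)-\frac u\tau Z(\tau)\big)du\Big)^2\Big],$$ $$W(Z):=\sup_{\tau\in\mathcal T}\frac{Q_{1-\tau}(Z^* )}{Q_\tau(Z)},\quad I(Z):=\int_{\mathcal T}\frac{Q_{1-\tau}(Z^* )}{Q_\tau(Z)}\,d\tau,\quad R(Z):=\frac{\inf_{\tau\in\mathcal T}Q_{1-\tau}(Z^* )}{\inf_{\tau\in\mathcal T}Q_\tau(Z)}.$$ *)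

theory Defs
  imports "HOL-Probability.Probability"
begin

section \<open>The space \<open>D[0,1]\<close> and weak convergence in it\<close>

text \<open>At an endpoint of \<open>S\<close> (or wherever \<open>S\<close> has no points on one side) the corresponding
  one-sided filter is trivial and the one-sided condition is vacuous.\<close>

definition cadlag_on :: "real set \<Rightarrow> (real \<Rightarrow> real) \<Rightarrow> bool" where
  "cadlag_on S f \<longleftrightarrow>
     (\<forall>t\<in>S. (f \<longlongrightarrow> f t) (at t within S \<inter> {t<..}) \<and>
             (\<exists>l. (f \<longlongrightarrow> l) (at t within S \<inter> {..<t})))"

text \<open>Elements of \<open>D[0,1]\<close> are represented by functions that are \<open>undefined\<close> outside \<open>[0,1]\<close>.
  The function space metric of the library lives on the bounded functions; boundedness is automatic
  for cadlag functions on \<open>[0,1]\<close>, see \<open>mspace_D01\<close> below.\<close>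

definition D01 :: "(real \<Rightarrow> real) metric" where
  "D01 = submetric (funspace {0..1} euclidean_metric) {f. cadlag_on {0..1} f}"

lemma cadlag_on_imp_bounded:
  assumes "cadlag_on {a..b} f"
  shows "bounded (f ` {a..b})"
proof -
  have loc: "\<exists>U. open U \<and> t \<in> U \<and> bounded (f ` (U \<inter> {a..b}))" if t: "t \<in> {a..b}" for t
  proof -
    from assms t obtain l where
      r: "(f \<longlongrightarrow> f t) (at t within {a..b} \<inter> {t<..})" and
      l: "(f \<longlongrightarrow> l) (at t within {a..b} \<inter> {..<t})"
      unfolding cadlag_on_def by blast
    have "eventually (\<lambda>x. dist (f x) (f t) < 1) (at t within {a..b} \<inter> {t<..})"
      using r by (rule tendstoD) simp
    then obtain U1 where U1: "open U1" "t \<in> U1"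
      "\<And>x. x \<in> U1 \<Longrightarrow> x \<noteq> t \<Longrightarrow> x \<in> {a..b} \<inter> {t<..} \<Longrightarrow> dist (f x) (f t) < 1"
      unfolding eventually_at_topological by blast
    have "eventually (\<lambda>x. dist (f x) l < 1) (at t within {a..b} \<inter> {..<t})"
      using l by (rule tendstoD) simp
    then obtain U2 where U2: "open U2" "t \<in> U2"
      "\<And>x. x \<in> U2 \<Longrightarrow> x \<noteq> t \<Longrightarrow> x \<in> {a..b} \<inter> {..<t} \<Longrightarrow> dist (f x) l < 1"
      unfolding eventually_at_topological by blast
    have "f ` (U1 \<inter> U2 \<inter> {a..b}) \<subseteq> ball (f t) 1 \<union> ball l 1"
    proof
      fix y assume "y \<in> f ` (U1 \<inter> U2 \<inter> {a..b})"
      then obtain x where x: "y = f x" "x \<in> U1" "x \<in> U2" "x \<in> {a..b}" by blast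
      consider "x = t" | "x > t" | "x < t" by linarith
      then show "y \<in> ball (f t) 1 \<union> ball l 1"
        using U1(3)[of x] U2(3)[of x] x by cases (auto simp: dist_commute)
    qed
    then have "bounded (f ` (U1 \<inter> U2 \<inter> {a..b}))"
      by (meson bounded_Un bounded_ball bounded_subset)
    then show ?thesis
      using U1 U2 by (intro exI[of _ "U1 \<inter> U2"]) auto
  qed
  then obtain U where
    U: "\<And>t. t \<in> {a..b} \<Longrightarrow> open (U t) \<and> t \<in> U t \<and> bounded (f ` (U t \<inter> {a..b}))"
    by metis
  obtain C where C: "C \<subseteq> {a..b}" "finite C" "{a..b} \<subseteq> (\<Union>t\<in>C. U t)"
    by (rule compactE_image[of "{a..b}" "{a..b}" U]) (use U in auto)
  have "bounded (\<Union>t\<in>C. f ` (U t \<inter> {a..b}))"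
    using C U by (intro bounded_UN) auto
  moreover have "f ` {a..b} \<subseteq> (\<Union>t\<in>C. f ` (U t \<inter> {a..b}))"
    using C(3) by blast
  ultimately show ?thesis
    by (rule bounded_subset)
qed

lemma mspace_D01: "mspace D01 = {f \<in> extensional {0..1}. cadlag_on {0..1} f}"
proof -
  have "Metric_space.mbounded (UNIV :: real set) dist (f ` {0..1})" if "cadlag_on {0..1} f" for f
    using cadlag_on_imp_bounded[OF that] by simp
  then show ?thesis
    by (auto simp: D01_def Met_TC.fspace_def)
qed

lemma mdist_D01:
  assumes "f \<in> mspace D01" "g \<in> mspace D01"
  shows "mdist D01 f g = (SUP t\<in>{0..1}. dist (f t) (g t))"
  using assms by (auto simp: D01_def Met_TC.fdist_def)

definition D01_ball_sigma :: "(real \<Rightarrow> real) measure" where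
  "D01_ball_sigma = sigma (mspace D01) {mball_of D01 f r |f r. f \<in> mspace D01}"

text \<open>The ball \<open>\<sigma>\<close>-field is smaller than the Borel \<open>\<sigma>\<close>-field of the uniform topology, so the test
  functions of weak convergence are the bounded continuous functions that are measurable with
  respect to it.\<close>

definition converges_weakly_D01 ::
    "'a measure \<Rightarrow> (nat \<Rightarrow> 'a \<Rightarrow> real \<Rightarrow> real) \<Rightarrow> 'b measure \<Rightarrow> ('b \<Rightarrow> real \<Rightarrow> real) \<Rightarrow> bool" where
  "converges_weakly_D01 M Y N Z \<longleftrightarrow>
     (\<forall>n. Y n \<in> measurable M D01_ball_sigma) \<and> Z \<in> measurable N D01_ball_sigma \<and>
     (\<forall>f. continuous_map (mtopology_of D01) euclidean f \<and> bounded (f ` mspace D01) \<and>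
          f \<in> borel_measurable D01_ball_sigma \<longrightarrow>
          (\<lambda>n. \<integral>\<omega>. f (Y n \<omega>) \<partial>M) \<longlonglongrightarrow> ((\<integral>\<omega>. f (Z \<omega>) \<partial>N) :: real))"

definition converges_in_law ::
    "'a measure \<Rightarrow> (nat \<Rightarrow> 'a \<Rightarrow> real) \<Rightarrow> 'b measure \<Rightarrow> ('b \<Rightarrow> real) \<Rightarrow> bool" where
  "converges_in_law M Y N Z \<longleftrightarrow>
     (\<forall>n. Y n \<in> borel_measurable M) \<and> Z \<in> borel_measurable N \<and>
     weak_conv_m (\<lambda>n. distr M borel (Y n)) (distr N borel Z)"

section \<open>Type I fractional Brownian motion\<close>

definition two_sided_brownian_motion :: "'b measure \<Rightarrow> (real \<Rightarrow> 'b \<Rightarrow> real) \<Rightarrow> bool" where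
  "two_sided_brownian_motion N B \<longleftrightarrow>
     prob_space N \<and>
     (\<forall>u. B u \<in> borel_measurable N) \<and>
     (AE \<omega> in N. B 0 \<omega> = 0) \<and>
     (\<forall>s u. s < u \<longrightarrow>
        distributed N lborel (\<lambda>\<omega>. B u \<omega> - B s \<omega>) (normal_density 0 (sqrt (u - s)))) \<and>
     (\<forall>(t :: nat \<Rightarrow> real) m. strict_mono t \<longrightarrow>
        prob_space.indep_vars N (\<lambda>_. borel) (\<lambda>i \<omega>. B (t (Suc i)) \<omega> - B (t i) \<omega>) {..<m}) \<and>
     (AE \<omega> in N. continuous_on UNIV (\<lambda>u. B u \<omega>))"

text \<open>\<open>has_wiener_integral N B f Y\<close> says that \<open>Y\<close> is (a version of) \<open>\<integral> f dB\<close>: the elementary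
  integrals of some step functions that approximate \<open>f\<close> in \<open>L\<^sup>2(\<real>)\<close> converge to \<open>Y\<close> in \<open>L\<^sup>2(N)\<close>.
  By the Ito isometry the limit depends neither on the choice of the step functions nor,
  up to null sets, on anything but \<open>f\<close> and \<open>B\<close>.\<close>

definition step_fun :: "nat \<Rightarrow> (nat \<Rightarrow> real) \<Rightarrow> (nat \<Rightarrow> real) \<Rightarrow> real \<Rightarrow> real" where
  "step_fun m t c u = (\<Sum>i<m. c i * indicator {t i<..t (Suc i)} u)"

definition step_integral ::
    "(real \<Rightarrow> 'b \<Rightarrow> real) \<Rightarrow> nat \<Rightarrow> (nat \<Rightarrow> real) \<Rightarrow> (nat \<Rightarrow> real) \<Rightarrow> 'b \<Rightarrow> real" where
  "step_integral B m t c \<omega> = (\<Sum>i<m. c i * (B (t (Suc i)) \<omega> - B (t i) \<omega>))"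

definition has_wiener_integral ::
    "'b measure \<Rightarrow> (real \<Rightarrow> 'b \<Rightarrow> real) \<Rightarrow> (real \<Rightarrow> real) \<Rightarrow> ('b \<Rightarrow> real) \<Rightarrow> bool" where
  "has_wiener_integral N B f Y \<longleftrightarrow>
     f \<in> borel_measurable lborel \<and> integrable lborel (\<lambda>u. (f u)\<^sup>2) \<and> Y \<in> borel_measurable N \<and>
     (\<exists>(m :: nat \<Rightarrow> nat) t c. (\<forall>k. strict_mono (t k)) \<and>
        (\<lambda>k. \<integral>\<^sup>+u. ennreal ((step_fun (m k) (t k) (c k) u - f u)\<^sup>2) \<partial>lborel) \<longlonglongrightarrow> 0 \<and>
        (\<lambda>k. \<integral>\<^sup>+\<omega>. ennreal ((step_integral B (m k) (t k) (c k) \<omega> - Y \<omega>)\<^sup>2) \<partial>N) \<longlonglongrightarrow> 0)"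

definition fbm_I_kernel :: "real \<Rightarrow> real \<Rightarrow> real \<Rightarrow> real" where
  "fbm_I_kernel d \<tau> u =
     (if u < \<tau> then (\<tau> - u) powr d - (if u < 0 then (- u) powr d else 0) else 0)"

text \<open>The stochastic integral determines \<open>Z \<tau>\<close> only up to a null set for each \<open>\<tau>\<close>; as usual,
  a version with regular paths is meant. We ask for cadlag paths only, which by Kolmogorov's
  criterion are then almost surely continuous.\<close>

definition fbm_I_base :: "'b measure \<Rightarrow> real \<Rightarrow> (real \<Rightarrow> 'b \<Rightarrow> real) \<Rightarrow> bool" where
  "fbm_I_base N d Z \<longleftrightarrow>
     (\<exists>B. two_sided_brownian_motion N B \<and>
        (\<forall>\<tau>\<ge>0. Z \<tau> \<in> borel_measurable N \<and>
           (\<exists>Y. has_wiener_integral N B (fbm_I_kernel d \<tau>) Y \<and>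
                (AE \<omega> in N. Z \<tau> \<omega> = 1 / Gamma (d + 1) * Y \<omega>)))) \<and>
     (AE \<omega> in N. cadlag_on {0..} (\<lambda>\<tau>. Z \<tau> \<omega>))"

text \<open>\<open>fbm_I N d Z\<close>: on the probability space \<open>N\<close>, \<open>Z\<close> is a type I fractional Brownian motion
  with index \<open>d + 1/2\<close> (the parameter is \<open>d\<close>, not the index).\<close>

definition fbm_I :: "'b measure \<Rightarrow> real \<Rightarrow> (real \<Rightarrow> 'b \<Rightarrow> real) \<Rightarrow> bool" where
  "fbm_I N d Z \<longleftrightarrow>
     (- 1/2 < d \<and> d < 1/2 \<and> fbm_I_base N d Z) \<or>
     (1/2 < d \<and> d < 3/2 \<and>
      (\<exists>Z'. fbm_I_base N (d - 1) Z' \<and>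
         (AE \<omega> in N. \<forall>\<tau>\<ge>0. Z \<tau> \<omega> = (LINT u:{0..\<tau>}|lborel. Z' u \<omega>))))"

section \<open>Statistics of a sample\<close>

text \<open>Samples are indexed from \<open>1\<close>. \<open>S_star x n m\<close> is the sum of the last \<open>m\<close> of
  \<open>x 1, \<dots>, x n\<close>, and \<open>V_star x n k\<close> is \<open>V\<^sup>*\<close> with lower index \<open>n - k\<close>. A quotient of statistics
  with vanishing denominator has the value \<open>0\<close>.\<close>

definition S_sum :: "(nat \<Rightarrow> real) \<Rightarrow> nat \<Rightarrow> real" where
  "S_sum x k = (\<Sum>j=1..k. x j)"

definition S_star :: "(nat \<Rightarrow> real) \<Rightarrow> nat \<Rightarrow> nat \<Rightarrow> real" where
  "S_star x n m = (\<Sum>j=n-m+1..n. x j)"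

definition V_stat :: "(nat \<Rightarrow> real) \<Rightarrow> nat \<Rightarrow> real" where
  "V_stat x k =
     1 / (real k)\<^sup>2 * (\<Sum>j=1..k. (S_sum x j - real j / real k * S_sum x k)\<^sup>2)
     - (1 / real k powr (3/2) * (\<Sum>j=1..k. S_sum x j - real j / real k * S_sum x k))\<^sup>2"

definition V_star :: "(nat \<Rightarrow> real) \<Rightarrow> nat \<Rightarrow> nat \<Rightarrow> real" where
  "V_star x n k =
     1 / (real (n - k))\<^sup>2 *
       (\<Sum>j=k+1..n. (S_star x n (n-j+1) - real (n-j+1) / real (n-k) * S_star x n (n-k))\<^sup>2)
     - (1 / real (n - k) powr (3/2) *
       (\<Sum>j=k+1..n. S_star x n (n-j+1) - real (n-j+1) / real (n-k) * S_star x n (n-k)))\<^sup>2"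

abbreviation floor_nat :: "nat \<Rightarrow> real \<Rightarrow> nat" where
  "floor_nat n \<tau> \<equiv> nat \<lfloor>real n * \<tau>\<rfloor>"

definition L_stat :: "(nat \<Rightarrow> real) \<Rightarrow> nat \<Rightarrow> real \<Rightarrow> real" where
  "L_stat x n \<tau> = V_star x n (floor_nat n \<tau>) / V_stat x (floor_nat n \<tau>)"

definition W_stat :: "real set \<Rightarrow> nat \<Rightarrow> (nat \<Rightarrow> real) \<Rightarrow> real" where
  "W_stat T n x = (SUP \<tau>\<in>T. L_stat x n \<tau>)"

definition I_stat :: "real set \<Rightarrow> nat \<Rightarrow> (nat \<Rightarrow> real) \<Rightarrow> real" where
  "I_stat T n x = (LINT \<tau>:T|lborel. L_stat x n \<tau>)"

definition R_stat :: "real set \<Rightarrow> nat \<Rightarrow> (nat \<Rightarrow> real) \<Rightarrow> real" where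
  "R_stat T n x =
     (INF \<tau>\<in>T. V_star x n (floor_nat n \<tau>)) / (INF \<tau>\<in>T. V_stat x (floor_nat n \<tau>))"

section \<open>The limiting functionals\<close>

definition path_star :: "(real \<Rightarrow> real) \<Rightarrow> real \<Rightarrow> real" where
  "path_star z u = z 1 - z (1 - u)"

definition Q_fun :: "real \<Rightarrow> (real \<Rightarrow> real) \<Rightarrow> real" where
  "Q_fun \<tau> z =
     1 / \<tau>\<^sup>2 * ((LINT u:{0..\<tau>}|lborel. (z u - u / \<tau> * z \<tau>)\<^sup>2)
              - 1 / \<tau> * (LINT u:{0..\<tau>}|lborel. z u - u / \<tau> * z \<tau>)\<^sup>2)"

definition W_fun :: "real set \<Rightarrow> (real \<Rightarrow> real) \<Rightarrow> real" where
  "W_fun T z = (SUP \<tau>\<in>T. Q_fun (1 - \<tau>) (path_star z) / Q_fun \<tau> z)"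

definition I_fun :: "real set \<Rightarrow> (real \<Rightarrow> real) \<Rightarrow> real" where
  "I_fun T z = (LINT \<tau>:T|lborel. Q_fun (1 - \<tau>) (path_star z) / Q_fun \<tau> z)"

definition R_fun :: "real set \<Rightarrow> (real \<Rightarrow> real) \<Rightarrow> real" where
  "R_fun T z = (INF \<tau>\<in>T. Q_fun (1 - \<tau>) (path_star z)) / (INF \<tau>\<in>T. Q_fun \<tau> z)"

end

theory Submission
  imports Defs "HOL-Real_Asymp.Real_Asymp"
begin

text \<open>The statistics \<open>V\<close> and \<open>V\<^sup>*\<close> do not change when a constant is added to the sample, so up to a
  common factor they are functionals of the normalized path
  \<open>Y\<^sub>n(\<tau>) = n powr (-d-1/2) * (S\<^bsub>[n\<tau>]\<^esub> - [n\<tau>] A\<^sub>n)\<close>. They differ from \<open>Q\<^sub>\<tau>(Y\<^sub>n)\<close> and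
  \<open>Q\<^bsub>1-\<tau>\<^esub>(Y\<^sub>n\<^sup>*)\<close> by \<open>O(1/n)\<close>, uniformly in \<open>\<tau>\<close> and in paths of bounded norm. The functionals \<open>W\<close>, \<open>I\<close>
  and \<open>R\<close> are continuous in the uniform norm at every \<open>z\<close> with \<open>inf Q\<^sub>\<tau>(z) > 0\<close>, so multiplication by
  continuous cutoffs that vanish for small \<open>inf Q\<^sub>\<tau>(z)\<close> or large \<open>z\<close> gives a continuous mapping theorem
  as soon as \<open>inf Q\<^sub>\<tau>(Z) > 0\<close> almost surely. Measurability for the ball \<open>\<sigma>\<close>-field comes from right
  continuity in \<open>\<tau>\<close>, which reduces suprema and infima to countably many \<open>\<tau>\<close>.

  Since \<open>Q\<^sub>\<tau>(z)\<close> is a variance of the detrended path, \<open>inf Q\<^sub>\<tau>(z) = 0\<close> forces \<open>z\<close> to be affine on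
  \<open>[0,\<tau>\<^sub>1)\<close>. If \<open>d < 1/2\<close>, this is a null event because \<open>\<bar>Z(\<tau>)\<bar> \<le> C \<tau>\<close> has probability
  \<open>O(\<tau> powr (1/2-d))\<close>; if \<open>d > 1/2\<close>, it would make the derivative of \<open>Z\<close> constant, which is
  excluded in the same way.\<close>

section \<open>The space D[0,1]\<close>

text \<open>The three functionals jump, or take a default value, where a denominator vanishes, while
  a test function must be continuous and measurable for the ball \<open>\<sigma>\<close>-field at
  once. A cutoff meets both demands and does more. It is itself a test function, so a small loss of
  mass in the limit is also a small loss for large samples. Where it is positive it supplies the two
  bounds, norm above and denominator below, under which an error \<open>O(1/n)\<close> carries over
  to ratios.

  The rounding costs little because \<open>V\<close> and \<open>V\<^sup>*\<close> are built from
  bridges that vanish at both ends: their sums are exact integrals of step functions, and only the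
  slope \<open>j / k\<close> and the factor \<open>n / k\<close> differ from their limits.

  Since \<open>Q\<^sub>\<tau>(z)\<close> involves the value \<open>z \<tau>\<close>, its infimum
  over \<open>\<tau>\<close> need not be attained for a cadlag path; hence its vanishing is treated
  by compactness of the affine coefficients and not at a minimizing time. The small ball estimate
  rests on a normal density being at most the reciprocal of its standard deviation.\<close>

lemma cadlag_on_mono:
  assumes "cadlag_on T f" "S \<subseteq> T"
  shows "cadlag_on S f"
  unfolding cadlag_on_def
proof (intro ballI conjI)
  fix t assume "t \<in> S"
  then obtain l where "(f \<longlongrightarrow> f t) (at t within T \<inter> {t<..})" "(f \<longlongrightarrow> l) (at t within T \<inter> {..<t})"
    using assms unfolding cadlag_on_def by blast
  then show "(f \<longlongrightarrow> f t) (at t within S \<inter> {t<..})" "\<exists>l. (f \<longlongrightarrow> l) (at t within S \<inter> {..<t})"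
    using assms(2) by (auto intro!: exI[of _ l] elim!: tendsto_within_subset)
qed

lemma cadlag_on_cong:
  assumes "\<And>t. t \<in> S \<Longrightarrow> f t = g t"
  shows "cadlag_on S f \<longleftrightarrow> cadlag_on S g"
proof -
  have "(f \<longlongrightarrow> l) (at t within S \<inter> T) \<longleftrightarrow> (g \<longlongrightarrow> l) (at t within S \<inter> T)" for t l T
    by (rule tendsto_cong) (auto simp: eventually_at_filter assms)
  then show ?thesis
    unfolding cadlag_on_def using assms by (metis (no_types, lifting))
qed

lemma continuous_imp_cadlag_on:
  assumes "continuous_on S f"
  shows "cadlag_on S f"
  using assms unfolding cadlag_on_def continuous_on_def
  by (meson inf_le1 tendsto_within_subset)

text \<open>The points \<open>(floor (m * u) + 1) / m\<close> lie strictly to the right of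
  \<open>u\<close>, so right continuity gives the limit, and for fixed \<open>m\<close> they take
  countably many values, which is what measurability needs. At \<open>u = 1\<close> nothing lies to
  the right; there the clamp makes the sequence constant.\<close>

lemma cadlag_right_approx:
  fixes z :: "real \<Rightarrow> real"
  assumes z: "cadlag_on {0..1} z" and u: "u \<in> {0..1}"
  shows "(\<lambda>m. z (min 1 (max 0 ((of_int \<lfloor>real (Suc m) * u\<rfloor> + 1) / real (Suc m))))) \<longlonglongrightarrow> z u"
proof -
  define s where "s m = min 1 (max 0 ((of_int \<lfloor>real (Suc m) * u\<rfloor> + 1) / real (Suc m)))" for m
  have lo: "u < (of_int \<lfloor>real (Suc m) * u\<rfloor> + 1) / real (Suc m)" for m
    by (simp add: pos_less_divide_eq mult.commute del: of_nat_Suc)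
  have hi: "(of_int \<lfloor>real (Suc m) * u\<rfloor> + 1) / real (Suc m) \<le> u + 1 / real (Suc m)" for m
    by (simp add: divide_simps mult.commute del: of_nat_Suc)
  show ?thesis
  proof (cases "u = 1")
    case True
    have "s m = 1" for m using lo[of m] by (simp add: s_def True)
    then show ?thesis using True by (simp add: s_def[symmetric])
  next
    case False
    then have u1: "u < 1" "0 \<le> u" using u by auto
    have gt: "u < s m" "s m \<le> 1" for m
      using lo[of m] u1 by (auto simp: s_def)
    have le: "s m \<le> u + 1 / real (Suc m)" for m
    proof -
      have "0 \<le> (of_int \<lfloor>real (Suc m) * u\<rfloor> + 1) / real (Suc m)" using lo[of m] u1 by linarith
      then show ?thesis using hi[of m] unfolding s_def by (simp add: max_absorb2 min.coboundedI2 del: of_nat_Suc)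
    qed
    have "s \<longlonglongrightarrow> u"
    proof (rule tendsto_sandwich[of "\<lambda>_. u" _ _ "\<lambda>m. u + 1 / real (Suc m)"])
      show "(\<lambda>m. u + 1 / real (Suc m)) \<longlonglongrightarrow> u"
        using tendsto_add[OF tendsto_const[of u] LIMSEQ_inverse_real_of_nat] by (simp add: inverse_eq_divide)
    qed (use gt le in \<open>auto intro!: always_eventually less_imp_le simp del: of_nat_Suc\<close>)
    then have "filterlim s (at u within {0..1} \<inter> {u<..}) sequentially"
      unfolding filterlim_at using gt u1 by (auto intro!: always_eventually simp: less_imp_le)
       (meson le_less_trans less_le_trans less_imp_le order.trans gt)+
    moreover have "(z \<longlongrightarrow> z u) (at u within {0..1} \<inter> {u<..})"
      using z u unfolding cadlag_on_def by blast
    ultimately have "(\<lambda>m. z (s m)) \<longlonglongrightarrow> z u"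
      by (rule filterlim_compose[rotated])
    then show ?thesis by (simp add: s_def)
  qed
qed

text \<open>The process is a pointwise limit of versions frozen on time cells of length
  \<open>1 / (m + 1)\<close>. Each of these is glued from countably many time sections, all
  measurable by hypothesis.\<close>

lemma borel_measurable_cadlag_process:
  fixes z :: "'a \<Rightarrow> real \<Rightarrow> real"
  assumes meas: "\<And>t. t \<in> {0..1} \<Longrightarrow> (\<lambda>w. z w t) \<in> borel_measurable M"
    and cad: "\<And>w. w \<in> space M \<Longrightarrow> cadlag_on {0..1} (z w)"
  shows "(\<lambda>p. indicator {0..1} (fst p) * z (snd p) (fst p)) \<in> borel_measurable (borel \<Otimes>\<^sub>M M)"
proof (rule borel_measurable_LIMSEQ_real)
  define v where "v m k w = z w (min 1 (max 0 ((real_of_int k + 1) / real (Suc m))))" for m k w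
  define w where "w m p = indicator {0..1} (fst p) * v m \<lfloor>real (Suc m) * fst p\<rfloor> (snd p)"
    for m and p :: "real \<times> 'a"
  show "(\<lambda>m. w m p) \<longlonglongrightarrow> indicator {0..1} (fst p) * z (snd p) (fst p)"
    if "p \<in> space (borel \<Otimes>\<^sub>M M)" for p
  proof (cases "fst p \<in> {0..1}")
    case True
    have "snd p \<in> space M" using that by (auto simp: space_pair_measure)
    from cadlag_right_approx[OF cad[OF this] True] show ?thesis
      using True by (simp add: w_def v_def del: of_nat_Suc)
  qed (simp add: w_def)
  have v: "(\<lambda>p. v m k (snd p)) \<in> borel_measurable (borel \<Otimes>\<^sub>M M)" for m k
    unfolding v_def by (rule measurable_compose[OF measurable_snd meas]) auto
  have [measurable]: "(\<lambda>p. v m \<lfloor>real (Suc m) * fst p\<rfloor> (snd p)) \<in> borel_measurable (borel \<Otimes>\<^sub>M M)" for m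
    by (rule measurable_compose_countable[OF v]) measurable
  show "w m \<in> borel_measurable (borel \<Otimes>\<^sub>M M)" for m
    unfolding w_def by measurable
qed

text \<open>A single path is a process over a one-point space.\<close>

lemma borel_measurable_cadlag:
  fixes z :: "real \<Rightarrow> real"
  assumes "cadlag_on {0..1} z"
  shows "(\<lambda>u. indicator {0..1} u * z u) \<in> borel_measurable borel"
proof -
  have "(\<lambda>p. indicator {0..1} (fst p) * z (fst p)) \<in> borel_measurable (borel \<Otimes>\<^sub>M count_space {()})"
    using borel_measurable_cadlag_process[of "\<lambda>_. z" "count_space {()}"] assms by auto
  then have "(\<lambda>u. (\<lambda>p. indicator {0..1} (fst p) * z (fst p)) (u, ())) \<in> borel_measurable borel"
    by (rule measurable_compose[rotated]) measurable
  then show ?thesis by simp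
qed

section \<open>The ball sigma-field and point evaluations\<close>

lemma space_D01_ball_sigma [simp]: "space D01_ball_sigma = mspace D01"
  unfolding D01_ball_sigma_def by (rule space_measure_of) auto

lemma mball_D01_sets [measurable]:
  "f \<in> mspace D01 \<Longrightarrow> mball_of D01 f r \<in> sets D01_ball_sigma"
  unfolding D01_ball_sigma_def by (subst sets_measure_of) (auto intro!: sigma_sets.Basic)

lemma D01_cadlag: "z \<in> mspace D01 \<Longrightarrow> cadlag_on {0..1} z"
  by (simp add: mspace_D01)

lemma D01_bounded:
  assumes "z \<in> mspace D01"
  shows "\<exists>K\<ge>1. \<forall>t\<in>{0..1}. \<bar>z t\<bar> \<le> K"
proof -
  obtain K where "\<forall>t\<in>{0..1}. \<bar>z t\<bar> \<le> K"
    using cadlag_on_imp_bounded[OF D01_cadlag[OF assms]] unfolding bounded_iff by auto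
  then have "\<forall>t\<in>{0..1}. \<bar>z t\<bar> \<le> max 1 K" by fastforce
  then show ?thesis by (meson max.cobounded1)
qed

lemma D01_dist_bdd:
  assumes "f \<in> mspace D01" "g \<in> mspace D01"
  shows "bdd_above ((\<lambda>t. dist (f t) (g t)) ` {0..1})"
proof -
  obtain K L where "\<forall>t\<in>{0..1}. \<bar>f t\<bar> \<le> K" "\<forall>t\<in>{0..1}. \<bar>g t\<bar> \<le> L"
    using D01_bounded assms by metis
  then have "\<forall>t\<in>{0..1}. dist (f t) (g t) \<le> K + L"
    by (fastforce simp: dist_real_def)
  then show ?thesis by (intro bdd_aboveI2[where M="K+L"]) auto
qed

lemma D01_dist_le:
  assumes "f \<in> mspace D01" "g \<in> mspace D01" "t \<in> {0..1}"
  shows "\<bar>f t - g t\<bar> \<le> mdist D01 f g"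
  unfolding mdist_D01[OF assms(1,2)] dist_real_def[symmetric]
  by (rule cSUP_upper[OF assms(3) D01_dist_bdd[OF assms(1,2)]])

lemma D01_dist_least:
  assumes "f \<in> mspace D01" "g \<in> mspace D01" "\<And>t. t \<in> {0..1} \<Longrightarrow> \<bar>f t - g t\<bar> \<le> e"
  shows "mdist D01 f g \<le> e"
  unfolding mdist_D01[OF assms(1,2)] by (rule cSUP_least) (use assms(3) in \<open>auto simp: dist_real_def\<close>)

text \<open>An open half space \<open>z t > a\<close> is a countable union of balls whose centres are multiples of
  indicators of short intervals to the right of \<open>t\<close>.\<close>

lemma D01_eval_measurable [measurable]:
  assumes t: "t \<in> {0..1::real}"
  shows "(\<lambda>z. z t) \<in> borel_measurable D01_ball_sigma"
proof (rule borel_measurableI_greater)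
  fix a :: real
  \<comment> \<open>Height \<open>a + n\<close> against radius \<open>n\<close>: at \<open>t\<close>
    the ball forces \<open>z t > a\<close>, while off the window it only forces
    \<open>\<bar>z\<bar> < n\<close>, which a bounded path satisfies for large
    \<open>n\<close>.\<close>
  define c where "c n m = restrict (\<lambda>s. if t \<le> s \<and> s < t + 1 / real (Suc m) then a + real n else 0) {0..1}"
    for n m :: nat
  have c_cad: "cadlag_on {0..1} (c n m)" for n m
  proof -
    let ?f = "\<lambda>s::real. if t \<le> s \<and> s < t + 1 / real (Suc m) then a + real n else 0 :: real"
    let ?e = "t + 1 / real (Suc m)"
    have te: "t < ?e" by simp
    have "cadlag_on {0..1} ?f"
      unfolding cadlag_on_def
    proof (intro ballI conjI)
      fix s :: real assume "s \<in> {0..1}"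
      have "\<exists>b>s. \<forall>y>s. y < b \<longrightarrow> ?f y = ?f s"
      proof -
        consider "s < t" | "t \<le> s" "s < ?e" | "?e \<le> s" by linarith
        then show ?thesis
        proof cases
          case 1 then show ?thesis by (intro exI[of _ t]) auto
        next
          case 2 then show ?thesis by (intro exI[of _ ?e]) auto
        next
          case 3 then show ?thesis by (intro exI[of _ "s+1"]) auto
        qed
      qed
      then have "eventually (\<lambda>y. ?f y = ?f s) (at_right s)"
        unfolding eventually_at_right_field by blast
      then have "(?f \<longlongrightarrow> ?f s) (at_right s)" by (rule tendsto_eventually)
      then show "(?f \<longlongrightarrow> ?f s) (at s within {0..1} \<inter> {s<..})"
        by (rule tendsto_within_subset) auto
      have "\<exists>l. \<exists>b<s. \<forall>y>b. y < s \<longrightarrow> ?f y = l"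
      proof -
        consider "s \<le> t" | "t < s" "s \<le> ?e" | "?e < s" by linarith
        then show ?thesis
        proof cases
          case 1 then show ?thesis by (intro exI[of _ 0] exI[of _ "s - 1"]) auto
        next
          case 2 then show ?thesis by (intro exI[of _ "a + real n"] exI[of _ t]) auto
        next
          case 3 then show ?thesis by (intro exI[of _ 0] exI[of _ ?e]) auto
        qed
      qed
      then obtain l where "eventually (\<lambda>y. ?f y = l) (at_left s)"
        unfolding eventually_at_left_field by blast
      then have "(?f \<longlongrightarrow> l) (at_left s)" by (rule tendsto_eventually)
      then show "\<exists>l. (?f \<longlongrightarrow> l) (at s within {0..1} \<inter> {..<s})"
        by (intro exI[of _ l]) (erule tendsto_within_subset, auto)
    qed
    then show ?thesis
      using cadlag_on_cong[of "{0..1}" "c n m" ?f] by (simp add: c_def)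
  qed
  have c_in: "c n m \<in> mspace D01" for n m
    using c_cad by (auto simp: mspace_D01 c_def)
  have "{z \<in> space D01_ball_sigma. a < z t} = (\<Union>n m. mball_of D01 (c n m) (real n))"
  proof (intro set_eqI iffI)
    fix z assume "z \<in> (\<Union>n m. mball_of D01 (c n m) (real n))"
    then obtain n m where z: "z \<in> mspace D01" "mdist D01 (c n m) z < real n" by auto
    have "\<bar>c n m t - z t\<bar> < real n"
      using D01_dist_le[OF c_in z(1) t] z(2) by (rule le_less_trans)
    then show "z \<in> {z \<in> space D01_ball_sigma. a < z t}" using t z by (auto simp: c_def)
  next
    fix z assume z: "z \<in> {z \<in> space D01_ball_sigma. a < z t}"
    then have zm: "z \<in> mspace D01" and zt: "a < z t" by auto
    \<comment> \<open>This slack survives the supremum: the distance to the centre is at most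
      \<open>n - e\<close>, hence strictly below the radius.\<close>
    define e where "e = (z t - a) / 2"
    have e: "e > 0" using zt by (simp add: e_def)
    have "(z \<longlongrightarrow> z t) (at t within {0..1} \<inter> {t<..})"
      using D01_cadlag[OF zm] t unfolding cadlag_on_def by blast
    then have "eventually (\<lambda>x. dist (z x) (z t) < e) (at t within {0..1} \<inter> {t<..})"
      using e by (rule tendstoD)
    then obtain b where b: "b > 0" "\<And>x. x \<in> {0..1} \<Longrightarrow> x > t \<Longrightarrow> dist x t < b \<Longrightarrow> dist (z x) (z t) < e"
      unfolding eventually_at by auto
    obtain m where m: "1 / real (Suc m) < b" using reals_Archimedean[OF b(1)] by (auto simp: inverse_eq_divide)
    obtain K where K: "\<forall>t\<in>{0..1}. \<bar>z t\<bar> \<le> K" using D01_bounded[OF zm] by blast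
    obtain n where n: "real n \<ge> \<bar>a\<bar> + K + e" using real_arch_simple by blast
    have near: "z s \<ge> a + e" if "s \<in> {0..1}" "t \<le> s" "s < t + 1 / real (Suc m)" for s
    proof (cases "s = t")
      case True then show ?thesis using zt by (simp add: e_def field_simps)
    next
      case False
      then have "dist (z s) (z t) < e" using that m by (intro b(2)) (auto simp: dist_real_def)
      then show ?thesis by (simp add: dist_real_def e_def abs_if split: if_splits) (simp_all add: field_simps)
    qed
    have "\<bar>c n m s - z s\<bar> \<le> real n - e" if s: "s \<in> {0..1}" for s
    proof -
      have K': "\<bar>z s\<bar> \<le> K" using K s by blast
      show ?thesis
      proof (cases "t \<le> s \<and> s < t + 1 / real (Suc m)")
        case True
        then have "z s \<ge> a + e" using near s by blast
        moreover have "c n m s = a + real n" using True s by (simp add: c_def)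
        ultimately show ?thesis using K' n e by linarith
      next
        case False
        then have "c n m s = 0" using s unfolding c_def by auto
        then show ?thesis using K' n e by linarith
      qed
    qed
    from D01_dist_least[OF c_in zm this] have "mdist D01 (c n m) z < real n" using e by simp
    then show "z \<in> (\<Union>n m. mball_of D01 (c n m) (real n))"
      using c_in zm by auto
  qed
  also have "\<dots> \<in> sets D01_ball_sigma" using c_in by auto
  finally show "{z \<in> space D01_ball_sigma. a < z t} \<in> sets D01_ball_sigma" .
qed

lemma D01_joint_measurable:
  "(\<lambda>p. indicator {0..1} (fst p) * snd p (fst p)) \<in> borel_measurable (borel \<Otimes>\<^sub>M D01_ball_sigma)"
  by (rule borel_measurable_cadlag_process[of "\<lambda>z. z"]) (auto simp: D01_eval_measurable D01_cadlag)

section \<open>The functional Q\<close>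

lemma set_integrable_bounded_Icc:
  fixes h :: "real \<Rightarrow> real"
  assumes "h \<in> borel_measurable borel" "\<And>u. u \<in> {a..b} \<Longrightarrow> \<bar>h u\<bar> \<le> K"
  shows "set_integrable lborel {a..b} h"
  unfolding set_integrable_def
  by (rule integrableI_bounded_set_indicator[where B=K]) (use assms in \<open>auto intro!: AE_I2 simp: emeasure_lborel_Icc_eq\<close>)

lemma set_integral_abs_le_Icc:
  fixes h :: "real \<Rightarrow> real"
  assumes "h \<in> borel_measurable borel" "\<And>u. u \<in> {a..b} \<Longrightarrow> \<bar>h u\<bar> \<le> K" "a \<le> b"
  shows "\<bar>LINT u:{a..b}|lborel. h u\<bar> \<le> K * (b - a)"
proof -
  have i: "set_integrable lborel {a..b} h" by (rule set_integrable_bounded_Icc[OF assms(1,2)])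
  have c: "set_integrable lborel {a..b} (\<lambda>_. k)" for k :: real
    by (rule set_integrable_bounded_Icc[of _ _ _ "\<bar>k\<bar>"]) auto
  have k: "(LINT u:{a..b}|lborel. k) = k * (b - a)" for k :: real
    using assms(3) by (simp add: set_lebesgue_integral_def)
  have "(LINT u:{a..b}|lborel. h u) \<le> (LINT u:{a..b}|lborel. K)"
    by (rule set_integral_mono[OF i c]) (use assms(2) in \<open>auto simp: abs_le_iff\<close>)
  moreover have "(LINT u:{a..b}|lborel. - K) \<le> (LINT u:{a..b}|lborel. h u)"
    by (rule set_integral_mono[OF c i]) (use assms(2) in \<open>fastforce simp: abs_le_iff\<close>)
  ultimately show ?thesis unfolding k by (simp add: abs_le_iff)
qed

lemma set_integral_const_Icc:
  "a \<le> b \<Longrightarrow> (LINT u:{a..b}|lborel. k) = k * (b - a :: real)" for k :: real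
  by (simp add: set_lebesgue_integral_def)

lemma set_integral_diff_abs_le_Icc:
  fixes h h' :: "real \<Rightarrow> real"
  assumes "h \<in> borel_measurable borel" "h' \<in> borel_measurable borel"
    and "\<And>u. u \<in> {a..b} \<Longrightarrow> \<bar>h u\<bar> \<le> K" "\<And>u. u \<in> {a..b} \<Longrightarrow> \<bar>h' u\<bar> \<le> K"
    and "\<And>u. u \<in> {a..b} \<Longrightarrow> \<bar>h u - h' u\<bar> \<le> r" "a \<le> b"
  shows "\<bar>(LINT u:{a..b}|lborel. h u) - (LINT u:{a..b}|lborel. h' u)\<bar> \<le> r * (b - a)"
proof -
  have "(LINT u:{a..b}|lborel. h u) - (LINT u:{a..b}|lborel. h' u) = (LINT u:{a..b}|lborel. h u - h' u)"
    by (rule set_integral_diff(2)[symmetric]; rule set_integrable_bounded_Icc[where K=K]; use assms in auto)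
  then show ?thesis
    using set_integral_abs_le_Icc[of "\<lambda>u. h u - h' u" a b r] assms by auto
qed

lemma abs_square_le:
  fixes x B :: real
  assumes "\<bar>x\<bar> \<le> B"
  shows "\<bar>x\<^sup>2\<bar> \<le> B\<^sup>2"
  using power_mono[OF assms, of 2] by simp

text \<open>For \<open>c = 1 / (b - a)\<close> and \<open>I = {a..b}\<close> this is
  \<open>c\<close> times the variance of \<open>h\<close> under the uniform distribution on
  \<open>I\<close>. The factor \<open>c\<close> stays free because the statistics produce
  \<open>n / k\<close> where the limit has \<open>1 / \<tau>\<close>.\<close>

definition vfun :: "real \<Rightarrow> real set \<Rightarrow> (real \<Rightarrow> real) \<Rightarrow> real" where
  "vfun c I h = c\<^sup>2 * ((LINT u:I|lborel. (h u)\<^sup>2) - c * (LINT u:I|lborel. h u)\<^sup>2)"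

lemma abs_square_diff_le:
  fixes x y K d :: real
  assumes "\<bar>x\<bar> \<le> K" "\<bar>y\<bar> \<le> K" "\<bar>x - y\<bar> \<le> d"
  shows "\<bar>x\<^sup>2 - y\<^sup>2\<bar> \<le> 2 * K * d"
proof -
  have "\<bar>x\<^sup>2 - y\<^sup>2\<bar> = \<bar>x - y\<bar> * \<bar>x + y\<bar>"
    by (simp add: power2_eq_square abs_mult[symmetric] algebra_simps)
  also have "\<dots> \<le> d * (2 * K)"
    using assms by (intro mult_mono) auto
  finally show ?thesis by (simp add: mult_ac)
qed

text \<open>Write the functional as \<open>c^2 * A - c^3 * B^2\<close> with \<open>A\<close>,
  \<open>B\<close> the integrals of \<open>h^2\<close> and \<open>h\<close>, and change one
  ingredient at a time. The error is at most \<open>4 * L^3 * K^2 * r\<close> from the functions and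
  \<open>5 * L^3 * K^2 * \<eta>\<close> from the factors; \<open>L \<ge> 1\<close> and
  \<open>K \<ge> 1\<close> absorb all lower powers.\<close>

lemma vfun_lipschitz:
  fixes h h' :: "real \<Rightarrow> real"
  assumes m: "h \<in> borel_measurable borel" "h' \<in> borel_measurable borel"
    and K: "\<And>u. u \<in> {a..b} \<Longrightarrow> \<bar>h u\<bar> \<le> K" "\<And>u. u \<in> {a..b} \<Longrightarrow> \<bar>h' u\<bar> \<le> K"
    and d: "\<And>u. u \<in> {a..b} \<Longrightarrow> \<bar>h u - h' u\<bar> \<le> r" and ab: "a \<le> b" "b - a \<le> 1"
    and L: "\<bar>c\<bar> \<le> L" "\<bar>c'\<bar> \<le> L" "\<bar>c - c'\<bar> \<le> \<eta>" "1 \<le> L" and K1: "1 \<le> K"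
  shows "\<bar>vfun c {a..b} h - vfun c' {a..b} h'\<bar> \<le> 5 * L ^ 3 * K\<^sup>2 * (r + \<eta>)"
proof -
  define A where "A h = (LINT u:{a..b}|lborel. (h u)\<^sup>2)" for h :: "real \<Rightarrow> real"
  define B where "B h = (LINT u:{a..b}|lborel. h u)" for h :: "real \<Rightarrow> real"
  have d0: "0 \<le> r" using d[of a] ab by force
  have e0: "0 \<le> \<eta>" using L by linarith
  have shrink: "x \<le> k" if "x \<le> k * (b - a)" "0 \<le> k" for x k :: real
    using that ab mult_left_mono[of "b - a" 1 k] by linarith
  have sq: "(h u)\<^sup>2 \<le> K\<^sup>2" "(h' u)\<^sup>2 \<le> K\<^sup>2" if "u \<in> {a..b}" for u
    using abs_square_le[OF K(1)[OF that]] abs_square_le[OF K(2)[OF that]] by simp_all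
  have "\<bar>A h - A h'\<bar> \<le> 2 * K * r * (b - a)"
    unfolding A_def using m K d ab sq
    by (intro set_integral_diff_abs_le_Icc[where K="K\<^sup>2"]) (auto intro!: abs_square_diff_le)
  then have A1: "\<bar>A h - A h'\<bar> \<le> 2 * K * r" by (rule shrink) (use K1 d0 in auto)
  have "\<bar>A h'\<bar> \<le> K\<^sup>2 * (b - a)"
    unfolding A_def using m ab sq by (intro set_integral_abs_le_Icc) auto
  then have A2: "\<bar>A h'\<bar> \<le> K\<^sup>2" by (rule shrink) auto
  have "\<bar>B h\<bar> \<le> K * (b - a)" "\<bar>B h'\<bar> \<le> K * (b - a)"
    unfolding B_def using m ab K by (auto intro!: set_integral_abs_le_Icc)
  then have B1: "\<bar>B h\<bar> \<le> K" "\<bar>B h'\<bar> \<le> K" using K1 shrink[of _ K] by auto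
  have "\<bar>B h - B h'\<bar> \<le> r * (b - a)"
    unfolding B_def using m K d ab by (intro set_integral_diff_abs_le_Icc[where K=K]) auto
  then have B2: "\<bar>B h - B h'\<bar> \<le> r" by (rule shrink) (use d0 in auto)
  have B3: "\<bar>(B h)\<^sup>2 - (B h')\<^sup>2\<bar> \<le> 2 * K * r" by (rule abs_square_diff_le[OF B1 B2])
  have B4: "(B h')\<^sup>2 \<le> K\<^sup>2" using abs_square_le[OF B1(2)] by simp
  have c2: "\<bar>c\<^sup>2 - c'\<^sup>2\<bar> \<le> 2 * L * \<eta>" by (rule abs_square_diff_le[OF L(1-3)])
  have cL: "c\<^sup>2 \<le> L\<^sup>2" "c'\<^sup>2 \<le> L\<^sup>2" using abs_square_le[OF L(1)] abs_square_le[OF L(2)] by simp_all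
  have cL3: "\<bar>c ^ 3\<bar> \<le> L ^ 3" using L power_mono[of "\<bar>c\<bar>" L 3] by (simp add: power_abs)
  have c3: "\<bar>c ^ 3 - c' ^ 3\<bar> \<le> 3 * L\<^sup>2 * \<eta>"
  proof -
    have "c ^ 3 - c' ^ 3 = (c - c') * (c\<^sup>2 + c * c' + c'\<^sup>2)"
      by (simp add: power2_eq_square power3_eq_cube algebra_simps)
    moreover have "\<bar>c * c'\<bar> \<le> L * L" unfolding abs_mult using L by (intro mult_mono) auto
    then have "\<bar>c\<^sup>2 + c * c' + c'\<^sup>2\<bar> \<le> 3 * L\<^sup>2"
      using cL zero_le_power2[of c] zero_le_power2[of c'] unfolding power2_eq_square[of L] by linarith
    ultimately have "\<bar>c ^ 3 - c' ^ 3\<bar> \<le> \<eta> * (3 * L\<^sup>2)"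
      unfolding abs_mult using L e0 by (auto simp: abs_mult intro!: mult_mono)
    then show ?thesis by (simp add: mult_ac)
  qed
  have "vfun c {a..b} h - vfun c' {a..b} h'
      = c\<^sup>2 * (A h - A h') + (c\<^sup>2 - c'\<^sup>2) * A h' - c ^ 3 * ((B h)\<^sup>2 - (B h')\<^sup>2) - (c ^ 3 - c' ^ 3) * (B h')\<^sup>2"
    unfolding vfun_def A_def[symmetric] B_def[symmetric]
    by (simp add: power2_eq_square power3_eq_cube algebra_simps)
  moreover have "\<bar>c\<^sup>2 * (A h - A h')\<bar> \<le> L\<^sup>2 * (2 * K * r)"
    unfolding abs_mult using cL A1 by (intro mult_mono) auto
  moreover have "\<bar>(c\<^sup>2 - c'\<^sup>2) * A h'\<bar> \<le> (2 * L * \<eta>) * K\<^sup>2"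
    unfolding abs_mult using c2 A2 L e0 by (intro mult_mono) auto
  moreover have "\<bar>c ^ 3 * ((B h)\<^sup>2 - (B h')\<^sup>2)\<bar> \<le> L ^ 3 * (2 * K * r)"
    unfolding abs_mult[of "c ^ 3"] using cL3 B3 L by (intro mult_mono) auto
  moreover have "\<bar>(c ^ 3 - c' ^ 3) * (B h')\<^sup>2\<bar> \<le> (3 * L\<^sup>2 * \<eta>) * K\<^sup>2"
    unfolding abs_mult using c3 B4 L e0 by (intro mult_mono) auto
  ultimately have "\<bar>vfun c {a..b} h - vfun c' {a..b} h'\<bar>
      \<le> L\<^sup>2 * (2 * K * r) + (2 * L * \<eta>) * K\<^sup>2 + L ^ 3 * (2 * K * r) + (3 * L\<^sup>2 * \<eta>) * K\<^sup>2"
    by linarith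
  also have "\<dots> \<le> L ^ 3 * (2 * K\<^sup>2 * r) + (2 * L ^ 3 * \<eta>) * K\<^sup>2 + L ^ 3 * (2 * K\<^sup>2 * r) + (3 * L ^ 3 * \<eta>) * K\<^sup>2"
  proof -
    have p: "L\<^sup>2 \<le> L ^ 3" "L \<le> L ^ 3" "K \<le> K\<^sup>2"
      using L K1 power_increasing[of 2 3 L] power_increasing[of 1 3 L] power_increasing[of 1 2 K] by auto
    show ?thesis
      using p d0 e0 L K1 by (intro add_mono mult_mono) auto
  qed
  also have "\<dots> \<le> 5 * L ^ 3 * K\<^sup>2 * (r + \<eta>)"
    using d0 L by (simp add: algebra_simps)
  finally show ?thesis .
qed

text \<open>Centring at the mean turns a difference of integrals into an integral of a square. This
  form shows nonnegativity and lets an affine path be read off when the value is 0.\<close>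

lemma vfun_eq_variance:
  fixes h :: "real \<Rightarrow> real"
  assumes m: "h \<in> borel_measurable borel" and K: "\<And>u. u \<in> {a..b} \<Longrightarrow> \<bar>h u\<bar> \<le> K" and ab: "a < b"
  defines "\<mu> \<equiv> 1 / (b - a) * (LINT u:{a..b}|lborel. h u)"
  shows "vfun (1 / (b - a)) {a..b} h = (1 / (b - a))\<^sup>2 * (LINT u:{a..b}|lborel. (h u - \<mu>)\<^sup>2)"
proof -
  have K0: "0 \<le> K" using K[of a] ab by force
  have sq: "(h u)\<^sup>2 \<le> K\<^sup>2" if "u \<in> {a..b}" for u
    using abs_square_le[OF K[OF that]] by simp
  have i: "set_integrable lborel {a..b} h" by (rule set_integrable_bounded_Icc[OF m K])
  have i2: "set_integrable lborel {a..b} (\<lambda>u. (h u)\<^sup>2)"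
    by (rule set_integrable_bounded_Icc[where K="K\<^sup>2"]) (use m sq in auto)
  have c: "set_integrable lborel {a..b} (\<lambda>_. k)" for k :: real
    by (rule set_integrable_bounded_Icc[of _ _ _ "\<bar>k\<bar>"]) auto
  have "(LINT u:{a..b}|lborel. (h u - \<mu>)\<^sup>2) = (LINT u:{a..b}|lborel. ((h u)\<^sup>2 - (2 * \<mu>) * h u) + \<mu>\<^sup>2)"
    by (simp add: power2_eq_square algebra_simps)
  also have "\<dots> = (LINT u:{a..b}|lborel. (h u)\<^sup>2) - 2 * \<mu> * (LINT u:{a..b}|lborel. h u) + \<mu>\<^sup>2 * (b - a)"
    using i i2 c ab by (simp add: set_integral_add(2) set_integral_diff(2) set_integral_const_Icc set_integral_diff(1))
  also have "\<dots> = (LINT u:{a..b}|lborel. (h u)\<^sup>2) - 1 / (b - a) * (LINT u:{a..b}|lborel. h u)\<^sup>2"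
  proof -
    define l I where "l = b - a" and "I = (LINT u:{a..b}|lborel. h u)"
    have "l > 0" using ab by (simp add: l_def)
    then show ?thesis unfolding \<mu>_def l_def[symmetric] I_def[symmetric]
      by (simp add: power2_eq_square field_simps)
  qed
  finally show ?thesis by (simp add: vfun_def)
qed

lemma set_integral_square_nonneg: "0 \<le> (LINT u:I|M. (h u)\<^sup>2 :: real)"
  unfolding set_lebesgue_integral_def by (rule integral_nonneg_AE) (auto simp: indicator_def)

section \<open>Q as a variance and its dependence on the path\<close>

lemma Q_fun_eq_vfun: "Q_fun \<tau> z = vfun (1 / \<tau>) {0..\<tau>} (\<lambda>u. z u - u / \<tau> * z \<tau>)"
  by (simp add: Q_fun_def vfun_def power_divide)

lemma Q_fun_cong:
  assumes "\<And>u. u \<in> {0..\<tau>} \<Longrightarrow> z u = w u" "0 \<le> \<tau>"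
  shows "Q_fun \<tau> z = Q_fun \<tau> w"
proof -
  have t: "z \<tau> = w \<tau>" using assms by simp
  have "(LINT u:{0..\<tau>}|lborel. (z u - u / \<tau> * z \<tau>)\<^sup>2) = (LINT u:{0..\<tau>}|lborel. (w u - u / \<tau> * w \<tau>)\<^sup>2)"
    using assms t by (intro set_lebesgue_integral_cong) auto
  moreover have "(LINT u:{0..\<tau>}|lborel. z u - u / \<tau> * z \<tau>) = (LINT u:{0..\<tau>}|lborel. w u - u / \<tau> * w \<tau>)"
    using assms t by (intro set_lebesgue_integral_cong) auto
  ultimately show ?thesis unfolding Q_fun_def by simp
qed

lemma Q_fun_cmult: "Q_fun \<tau> (\<lambda>u. k * z u) = k\<^sup>2 * Q_fun \<tau> z"
proof -
  have e: "k * z u - u / \<tau> * (k * z \<tau>) = k * (z u - u / \<tau> * z \<tau>)" for u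
    by (simp add: algebra_simps)
  show ?thesis unfolding Q_fun_def e power_mult_distrib set_integral_mult_right
    by (simp add: algebra_simps)
qed

lemma path_star_cmult: "path_star (\<lambda>u. k * z u) = (\<lambda>u. k * path_star z u)"
  by (auto simp: path_star_def algebra_simps)

lemma detrended_bound:
  fixes w :: "real \<Rightarrow> real"
  assumes "\<bar>w u\<bar> \<le> K" "\<bar>w \<tau>\<bar> \<le> K" "0 < \<tau>" "u \<in> {0..\<tau>}"
  shows "\<bar>w u - u / \<tau> * w \<tau>\<bar> \<le> 2 * K"
proof -
  have "\<bar>u / \<tau> * w \<tau>\<bar> \<le> 1 * K"
    unfolding abs_mult using assms by (intro mult_mono) auto
  moreover define p where "p = u / \<tau> * w \<tau>"
  ultimately show ?thesis using assms(1) unfolding p_def[symmetric] by linarith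
qed

lemma Q_fun_eq_variance:
  assumes "w \<in> borel_measurable borel" "\<And>u. u \<in> {0..\<tau>} \<Longrightarrow> \<bar>w u\<bar> \<le> K" "0 < \<tau>"
  defines "\<mu> \<equiv> 1 / \<tau> * (LINT u:{0..\<tau>}|lborel. w u - u / \<tau> * w \<tau>)"
  shows "Q_fun \<tau> w = (1 / \<tau>)\<^sup>2 * (LINT u:{0..\<tau>}|lborel. (w u - u / \<tau> * w \<tau> - \<mu>)\<^sup>2)"
    and "\<bar>\<mu>\<bar> \<le> 2 * K"
proof -
  have b: "\<bar>w u - u / \<tau> * w \<tau>\<bar> \<le> 2 * K" if "u \<in> {0..\<tau>}" for u
    by (rule detrended_bound) (use that assms in auto)
  show "Q_fun \<tau> w = (1 / \<tau>)\<^sup>2 * (LINT u:{0..\<tau>}|lborel. (w u - u / \<tau> * w \<tau> - \<mu>)\<^sup>2)"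
    unfolding Q_fun_eq_vfun \<mu>_def using vfun_eq_variance[OF _ b, where a=0 and b=\<tau>, unfolded diff_zero] assms(1,3)
    by auto
  have "\<bar>LINT u:{0..\<tau>}|lborel. w u - u / \<tau> * w \<tau>\<bar> \<le> 2 * K * (\<tau> - 0)"
    by (rule set_integral_abs_le_Icc) (use assms b in auto)
  then show "\<bar>\<mu>\<bar> \<le> 2 * K" using assms(3) unfolding \<mu>_def by (simp add: abs_mult field_simps)
qed

lemma Q_fun_nonneg:
  assumes "w \<in> borel_measurable borel" "\<And>u. u \<in> {0..\<tau>} \<Longrightarrow> \<bar>w u\<bar> \<le> K" "0 < \<tau>"
  shows "0 \<le> Q_fun \<tau> w"
  by (subst Q_fun_eq_variance(1)[OF assms])
    (auto intro!: mult_nonneg_nonneg set_integral_square_nonneg)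

lemma Q_fun_lipschitz:
  assumes m: "w \<in> borel_measurable borel" "w' \<in> borel_measurable borel"
    and K: "\<And>u. u \<in> {0..\<tau>} \<Longrightarrow> \<bar>w u\<bar> \<le> K" "\<And>u. u \<in> {0..\<tau>} \<Longrightarrow> \<bar>w' u\<bar> \<le> K"
    and d: "\<And>u. u \<in> {0..\<tau>} \<Longrightarrow> \<bar>w u - w' u\<bar> \<le> r" and t: "0 < \<tau>" "\<tau> \<le> 1"
    and K1: "1 \<le> K"
  shows "\<bar>Q_fun \<tau> w - Q_fun \<tau> w'\<bar> \<le> 40 * (1 / \<tau>) ^ 3 * K\<^sup>2 * r"
proof -
  \<comment> \<open>Detrending doubles both the bound and the distance, so
    \<open>5 * (2 * K)^2 * (2 * r) = 40 * K^2 * r\<close>. The time is the same on both sides, hence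
    the second error is 0.\<close>
  have "\<bar>Q_fun \<tau> w - Q_fun \<tau> w'\<bar> \<le> 5 * (1 / \<tau>) ^ 3 * (2 * K)\<^sup>2 * (2 * r + 0)"
    unfolding Q_fun_eq_vfun
  proof (rule vfun_lipschitz)
    show "\<bar>w u - u / \<tau> * w \<tau>\<bar> \<le> 2 * K" "\<bar>w' u - u / \<tau> * w' \<tau>\<bar> \<le> 2 * K" if "u \<in> {0..\<tau>}" for u
      by (rule detrended_bound; use that K t in auto)+
    show "\<bar>w u - u / \<tau> * w \<tau> - (w' u - u / \<tau> * w' \<tau>)\<bar> \<le> 2 * r" if "u \<in> {0..\<tau>}" for u
    proof -
      have "\<bar>u / \<tau> * (w \<tau> - w' \<tau>)\<bar> \<le> 1 * r"
        unfolding abs_mult using that t d[of \<tau>] by (intro mult_mono) auto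
      moreover have "\<bar>w u - w' u\<bar> \<le> r" using d that by blast
      moreover define p q where "p = u / \<tau> * w \<tau>" and "q = u / \<tau> * w' \<tau>"
      ultimately show ?thesis unfolding right_diff_distrib p_def[symmetric] q_def[symmetric] by linarith
    qed
  qed (use m t K1 in auto)
  then show ?thesis by (simp add: power2_eq_square algebra_simps)
qed

section \<open>Dependence of Q on the time\<close>

lemma continuous_on_indefinite_set_integral:
  fixes f :: "real \<Rightarrow> real"
  assumes "f \<in> borel_measurable borel" "\<And>u. u \<in> {a..b} \<Longrightarrow> \<bar>f u\<bar> \<le> K"
  shows "continuous_on {a..b} (\<lambda>s. LINT u:{a..s}|lborel. f u)"
proof -
  have i: "set_integrable lborel {a..s} f" if "s \<in> {a..b}" for s
    by (rule set_integrable_bounded_Icc[where K=K]) (use assms that in auto)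
  have "continuous_on {a..b} (\<lambda>s. integral {a..s} f)"
  proof (cases "a \<le> b")
    case True
    then show ?thesis
      using i[of b] by (intro indefinite_integral_continuous_1 set_borel_integral_eq_integral(1)) auto
  qed simp
  then show ?thesis
    by (rule continuous_on_eq) (use set_borel_integral_eq_integral(2)[OF i] in auto)
qed

text \<open>The trend depends on \<open>s\<close>, so the integrand of \<open>Q_fun s w\<close>
  moves with its upper limit. Expanding the square leaves indefinite integrals of fixed functions,
  with \<open>s\<close> and \<open>w s\<close> outside.\<close>

lemma Q_fun_expand:
  assumes m: "w \<in> borel_measurable borel" and K: "\<And>u. u \<in> {0..1} \<Longrightarrow> \<bar>w u\<bar> \<le> K" and s: "s \<in> {0..1}"
  shows "Q_fun s w = 1 / s\<^sup>2 * ((LINT u:{0..s}|lborel. (w u)\<^sup>2) - 2 * (w s / s) * (LINT u:{0..s}|lborel. u * w u)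
      + (w s / s)\<^sup>2 * (LINT u:{0..s}|lborel. u\<^sup>2)
      - 1 / s * ((LINT u:{0..s}|lborel. w u) - (w s / s) * (LINT u:{0..s}|lborel. u))\<^sup>2)"
proof -
  let ?b = "w s / s"
  have u: "u \<in> {0..s} \<Longrightarrow> u \<in> {0..1}" for u using s by auto
  have K0: "0 \<le> K" using K[of 0] by auto
  have i0: "set_integrable lborel {0..s} w"
    by (rule set_integrable_bounded_Icc[where K=K]) (use m K u in auto)
  have i2: "set_integrable lborel {0..s} (\<lambda>u. (w u)\<^sup>2)"
    by (rule set_integrable_bounded_Icc[where K="K\<^sup>2"]) (use m in simp, rule abs_square_le, use K u in auto)
  have i1: "set_integrable lborel {0..s} (\<lambda>u. u * w u)"
  proof (rule set_integrable_bounded_Icc[where K=K])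
    fix u assume "u \<in> {0..s}"
    then have "u \<in> {0..1}" using u by blast
    then have "\<bar>u\<bar> * \<bar>w u\<bar> \<le> 1 * K" using K by (intro mult_mono) auto
    then show "\<bar>u * w u\<bar> \<le> K" by (simp add: abs_mult)
  qed (use m in simp)
  have j1: "set_integrable lborel {0..s} (\<lambda>u. u)"
    by (rule set_integrable_bounded_Icc[where K=1]) (use u in auto)
  have j2: "set_integrable lborel {0..s} (\<lambda>u. u\<^sup>2)"
    by (rule set_integrable_bounded_Icc[where K="1\<^sup>2"]) (simp, rule abs_square_le, use u in auto)
  have e: "w u - u / s * w s = w u - ?b * u" "(w u - u / s * w s)\<^sup>2 = (w u)\<^sup>2 - (2 * ?b) * (u * w u) + ?b\<^sup>2 * u\<^sup>2" for u
    by (simp_all add: power2_eq_square algebra_simps)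
  have "(LINT u:{0..s}|lborel. w u - u / s * w s) = (LINT u:{0..s}|lborel. w u) - ?b * (LINT u:{0..s}|lborel. u)"
    unfolding e(1) using i0 j1 by (simp add: set_integral_diff(2))
  moreover have "(LINT u:{0..s}|lborel. (w u - u / s * w s)\<^sup>2) = (LINT u:{0..s}|lborel. (w u)\<^sup>2)
      - 2 * ?b * (LINT u:{0..s}|lborel. u * w u) + ?b\<^sup>2 * (LINT u:{0..s}|lborel. u\<^sup>2)"
    unfolding e(2) using i2 i1 j2
    by (simp add: set_integral_diff set_integral_add(2) del: power_divide)
  ultimately show ?thesis unfolding Q_fun_def by simp
qed

text \<open>Regularity of the path is asked only along \<open>s\<close>. An arbitrary filter and an
  arbitrary \<open>s\<close> cover both uses: times decreasing to \<open>t\<close> for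
  \<open>z\<close>, and times increasing to \<open>1 - t\<close> for the reflected path.\<close>

lemma tendsto_Q_fun:
  assumes m: "w \<in> borel_measurable borel" and K: "\<And>u. u \<in> {0..1} \<Longrightarrow> \<bar>w u\<bar> \<le> K"
    and s: "(s \<longlongrightarrow> t) F" "eventually (\<lambda>x. s x \<in> {0..1}) F" and t: "0 < t" "t \<le> 1"
    and ws: "((\<lambda>x. w (s x)) \<longlongrightarrow> w t) F"
  shows "((\<lambda>x. Q_fun (s x) w) \<longlongrightarrow> Q_fun t w) F"
proof -
  have T: "((\<lambda>x. LINT u:{0..s x}|lborel. f u) \<longlongrightarrow> (LINT u:{0..t}|lborel. f u)) F"
    if "f \<in> borel_measurable borel" "\<And>u. u \<in> {0..1} \<Longrightarrow> \<bar>f u\<bar> \<le> L" for f :: "real \<Rightarrow> real" and L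
    by (rule continuous_on_tendsto_compose[OF continuous_on_indefinite_set_integral[OF that] s(1) _ s(2)])
      (use t in auto)
  have t0: "((\<lambda>x. LINT u:{0..s x}|lborel. w u) \<longlongrightarrow> (LINT u:{0..t}|lborel. w u)) F"
    by (rule T[OF m K])
  have t2: "((\<lambda>x. LINT u:{0..s x}|lborel. (w u)\<^sup>2) \<longlongrightarrow> (LINT u:{0..t}|lborel. (w u)\<^sup>2)) F"
    by (rule T[where L="K\<^sup>2"]) (use m in simp, rule abs_square_le, use K in auto)
  have t1: "((\<lambda>x. LINT u:{0..s x}|lborel. u * w u) \<longlongrightarrow> (LINT u:{0..t}|lborel. u * w u)) F"
  proof (rule T[where L=K])
    fix u :: real assume "u \<in> {0..1}"
    then have "\<bar>u\<bar> * \<bar>w u\<bar> \<le> 1 * K" using K by (intro mult_mono) auto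
    then show "\<bar>u * w u\<bar> \<le> K" by (simp add: abs_mult)
  qed (use m in simp)
  have u1: "((\<lambda>x. LINT u:{0..s x}|lborel. u) \<longlongrightarrow> (LINT u:{0..t}|lborel. u)) F"
    by (rule T[where L=1]) auto
  have u2: "((\<lambda>x. LINT u:{0..s x}|lborel. u\<^sup>2) \<longlongrightarrow> (LINT u:{0..t}|lborel. u\<^sup>2)) F"
    by (rule T[where L="1\<^sup>2"]) (simp, rule abs_square_le, auto)
  have "eventually (\<lambda>x. 1 / (s x)\<^sup>2 * ((LINT u:{0..s x}|lborel. (w u)\<^sup>2) - 2 * (w (s x) / s x) * (LINT u:{0..s x}|lborel. u * w u)
      + (w (s x) / s x)\<^sup>2 * (LINT u:{0..s x}|lborel. u\<^sup>2)
      - 1 / s x * ((LINT u:{0..s x}|lborel. w u) - (w (s x) / s x) * (LINT u:{0..s x}|lborel. u))\<^sup>2) = Q_fun (s x) w) F"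
    using s(2) by eventually_elim (rule Q_fun_expand[OF m K, symmetric])
  moreover have e: "Q_fun t w = 1 / t\<^sup>2 * ((LINT u:{0..t}|lborel. (w u)\<^sup>2) - 2 * (w t / t) * (LINT u:{0..t}|lborel. u * w u)
      + (w t / t)\<^sup>2 * (LINT u:{0..t}|lborel. u\<^sup>2)
      - 1 / t * ((LINT u:{0..t}|lborel. w u) - (w t / t) * (LINT u:{0..t}|lborel. u))\<^sup>2)"
    by (rule Q_fun_expand[OF m K]) (use t in auto)
  have "((\<lambda>x. 1 / (s x)\<^sup>2 * ((LINT u:{0..s x}|lborel. (w u)\<^sup>2) - 2 * (w (s x) / s x) * (LINT u:{0..s x}|lborel. u * w u)
      + (w (s x) / s x)\<^sup>2 * (LINT u:{0..s x}|lborel. u\<^sup>2)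
      - 1 / s x * ((LINT u:{0..s x}|lborel. w u) - (w (s x) / s x) * (LINT u:{0..s x}|lborel. u))\<^sup>2)) \<longlongrightarrow> Q_fun t w) F"
    unfolding e by (intro tendsto_intros s(1) ws t0 t1 t2 u1 u2) (use t in auto)
  ultimately show ?thesis
    by (blast intro: Lim_transform_eventually)
qed

text \<open>Written with \<open>if\<close>, the indicator of an interval with moving endpoint is a
  jointly measurable function of the endpoint and the integration variable, so the parameter
  integrals are measurable.\<close>

lemma borel_measurable_Q_fun:
  fixes g :: "real \<times> 'a \<Rightarrow> real"
  assumes [measurable]: "g \<in> borel_measurable (borel \<Otimes>\<^sub>M M)"
  shows "(\<lambda>p. Q_fun (fst p) (\<lambda>u. g (u, snd p))) \<in> borel_measurable (borel \<Otimes>\<^sub>M M)"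
proof -
  have ind: "indicator {0..s} u = (if 0 \<le> u \<and> u \<le> s then 1 else 0 :: real)" for u s :: real
    by (auto simp: indicator_def)
  show ?thesis
    unfolding Q_fun_def set_lebesgue_integral_def ind real_scaleR_def
    by measurable
qed

text \<open>Replaces the value \<open>undefined\<close> outside \<open>[0,1]\<close> by 0. The
  result is a Borel function on the whole line, as the estimates above require, and
  \<open>Q_fun\<close> at times in \<open>[0,1]\<close> does not see the change.\<close>

definition clip :: "(real \<Rightarrow> real) \<Rightarrow> real \<Rightarrow> real" where
  "clip z u = indicator {0..1} u * z u"

lemma clip_eq: "u \<in> {0..1} \<Longrightarrow> clip z u = z u"
  by (simp add: clip_def)

lemma Q_fun_clip: "\<tau> \<in> {0..1} \<Longrightarrow> Q_fun \<tau> (clip z) = Q_fun \<tau> z"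
  by (rule Q_fun_cong) (auto simp: clip_eq)

abbreviation (input) Q_star :: "real \<Rightarrow> (real \<Rightarrow> real) \<Rightarrow> real" where
  "Q_star \<tau> z \<equiv> Q_fun (1 - \<tau>) (path_star z)"

lemma Q_fun_star_cong:
  assumes "\<tau> \<in> {0..1}" "\<And>u. u \<in> {0..1} \<Longrightarrow> z u = w u"
  shows "Q_star \<tau> z = Q_star \<tau> w"
  by (rule Q_fun_cong) (use assms in \<open>auto simp: path_star_def\<close>)

lemma Q_fun_star_clip: "\<tau> \<in> {0..1} \<Longrightarrow> Q_star \<tau> (clip z) = Q_star \<tau> z"
  by (rule Q_fun_star_cong) (auto simp: clip_eq)

lemma clip_measurable [measurable]:
  assumes "cadlag_on {0..1} z"
  shows "clip z \<in> borel_measurable borel"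
  using borel_measurable_cadlag[OF assms] by (simp add: clip_def[abs_def])

lemma path_star_measurable [measurable]:
  assumes [measurable]: "w \<in> borel_measurable borel"
  shows "path_star w \<in> borel_measurable borel"
  unfolding path_star_def[abs_def] by measurable

lemma path_star_bound:
  assumes "\<And>u. u \<in> {0..1} \<Longrightarrow> \<bar>w u\<bar> \<le> K" "u \<in> {0..1}"
  shows "\<bar>path_star w u\<bar> \<le> 2 * K"
  using assms(1)[of 1] assms(1)[of "1 - u"] assms(2) by (auto simp: path_star_def abs_le_iff)

section \<open>Measurability, right continuity and Lipschitz bounds on D[0,1]\<close>

lemma Q_fun_D01_measurable [measurable]:
  "(\<lambda>p. Q_fun (fst p) (clip (snd p))) \<in> borel_measurable (borel \<Otimes>\<^sub>M D01_ball_sigma)"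
  using borel_measurable_Q_fun[OF D01_joint_measurable] by (simp add: clip_def[abs_def])

lemma Q_fun_star_D01_measurable [measurable]:
  "(\<lambda>p. Q_star (fst p) (clip (snd p))) \<in> borel_measurable (borel \<Otimes>\<^sub>M D01_ball_sigma)"
proof -
  have c: "(\<lambda>p. clip (snd p) (f (fst p))) \<in> borel_measurable (borel \<Otimes>\<^sub>M D01_ball_sigma)"
    if [measurable]: "f \<in> borel_measurable borel" for f :: "real \<Rightarrow> real"
  proof -
    have "(\<lambda>p. (f (fst p), snd p)) \<in> measurable (borel \<Otimes>\<^sub>M D01_ball_sigma) (borel \<Otimes>\<^sub>M D01_ball_sigma)"
      by measurable
    from measurable_compose[OF this D01_joint_measurable] show ?thesis by (simp add: clip_def)
  qed
  have "(\<lambda>p. clip (snd p) 1 - clip (snd p) (1 - fst p)) \<in> borel_measurable (borel \<Otimes>\<^sub>M D01_ball_sigma)"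
    by (intro borel_measurable_diff c[of "\<lambda>_. 1"] c[of "\<lambda>x. 1 - x"]) simp_all
  then have "(\<lambda>p. path_star (clip (snd p)) (fst p)) \<in> borel_measurable (borel \<Otimes>\<^sub>M D01_ball_sigma)"
    by (simp add: path_star_def)
  from borel_measurable_Q_fun[OF this]
  have "(\<lambda>p. Q_fun (fst p) (path_star (clip (snd p)))) \<in> borel_measurable (borel \<Otimes>\<^sub>M D01_ball_sigma)"
    by simp
  then have "(\<lambda>p. (\<lambda>p. Q_fun (fst p) (path_star (clip (snd p)))) (1 - fst p, snd p)) \<in> borel_measurable (borel \<Otimes>\<^sub>M D01_ball_sigma)"
    by (rule measurable_compose[rotated]) measurable
  then show ?thesis by simp
qed

lemma cadlag_at_right:
  assumes "cadlag_on {a..b} z" "a \<le> t" "t < b"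
  shows "(z \<longlongrightarrow> z t) (at_right t)"
proof -
  have "(z \<longlongrightarrow> z t) (at t within {a..b} \<inter> {t<..})"
    using assms unfolding cadlag_on_def by auto
  moreover have "at t within {a..b} \<inter> {t<..} = at t within {t<..}"
    by (rule at_within_nhd[of _ "{..<b}"]) (use assms in auto)
  ultimately show ?thesis by simp
qed

lemma Q_fun_right_cont:
  assumes z: "z \<in> mspace D01" and t: "0 < t" "t < 1"
  shows "((\<lambda>\<tau>. Q_fun \<tau> z) \<longlongrightarrow> Q_fun t z) (at_right t)"
    and "((\<lambda>\<tau>. Q_star \<tau> z) \<longlongrightarrow> Q_star t z) (at_right t)"
proof -
  obtain K where K: "\<forall>u\<in>{0..1}. \<bar>z u\<bar> \<le> K" using D01_bounded[OF z] by blast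
  have Kc: "\<bar>clip z u\<bar> \<le> K" if "u \<in> {0..1}" for u using K that by (simp add: clip_eq)
  have m: "clip z \<in> borel_measurable borel" using D01_cadlag[OF z] by measurable
  have rc: "(z \<longlongrightarrow> z t) (at_right t)"
    using cadlag_at_right[OF D01_cadlag[OF z]] t by auto
  have ev: "eventually (\<lambda>\<tau>. \<tau> \<in> {0..1}) (at_right t)"
    using t unfolding eventually_at_right_field by (intro exI[of _ 1]) auto
  have "eventually (\<lambda>\<tau>. z \<tau> = clip z \<tau>) (at_right t)"
    using ev by eventually_elim (simp add: clip_eq)
  with rc have "(clip z \<longlongrightarrow> z t) (at_right t)" by (rule Lim_transform_eventually)
  then have rc': "((\<lambda>\<tau>. clip z \<tau>) \<longlongrightarrow> clip z t) (at_right t)" using t by (simp add: clip_eq)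
  have "((\<lambda>\<tau>. Q_fun \<tau> (clip z)) \<longlongrightarrow> Q_fun t (clip z)) (at_right t)"
    by (rule tendsto_Q_fun[OF m Kc _ ev]) (use t rc' in auto)
  moreover have "eventually (\<lambda>\<tau>. Q_fun \<tau> (clip z) = Q_fun \<tau> z) (at_right t)"
    using ev by eventually_elim (rule Q_fun_clip)
  ultimately show "((\<lambda>\<tau>. Q_fun \<tau> z) \<longlongrightarrow> Q_fun t z) (at_right t)"
    using Q_fun_clip[of t z] t by (auto dest: Lim_transform_eventually)
  have "((\<lambda>\<tau>. Q_star \<tau> (clip z)) \<longlongrightarrow> Q_star t (clip z)) (at_right t)"
  proof (rule tendsto_Q_fun[OF _ path_star_bound[OF Kc]])
    \<comment> \<open>At the reflected time \<open>1 - \<tau>\<close> the reflected path equals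
      \<open>z 1 - z \<tau>\<close>, so the right limit of \<open>z\<close> is once more the one
      that matters.\<close>
    show "((\<lambda>\<tau>. path_star (clip z) (1 - \<tau>)) \<longlongrightarrow> path_star (clip z) (1 - t)) (at_right t)"
      unfolding path_star_def by (auto intro!: tendsto_intros rc')
    show "eventually (\<lambda>\<tau>. 1 - \<tau> \<in> {0..1}) (at_right t)" using ev by eventually_elim auto
  qed (use t m in \<open>auto intro!: tendsto_intros\<close>)
  moreover have "eventually (\<lambda>\<tau>. Q_star \<tau> (clip z) = Q_star \<tau> z) (at_right t)"
    using ev by eventually_elim (rule Q_fun_star_clip)
  ultimately show "((\<lambda>\<tau>. Q_star \<tau> z) \<longlongrightarrow> Q_star t z) (at_right t)"
    using Q_fun_star_clip[of t z] t by (auto dest: Lim_transform_eventually)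
qed

lemma Q_fun_D01_bounds:
  assumes z: "z \<in> mspace D01" and t: "0 < t" "t < 1"
  shows "0 \<le> Q_fun t z" "0 \<le> Q_star t z"
proof -
  obtain K where K: "\<forall>u\<in>{0..1}. \<bar>z u\<bar> \<le> K" using D01_bounded[OF z] by blast
  have Kc: "\<bar>clip z u\<bar> \<le> K" if "u \<in> {0..1}" for u using K that by (simp add: clip_eq)
  have m: "clip z \<in> borel_measurable borel" using D01_cadlag[OF z] by measurable
  have "0 \<le> Q_fun t (clip z)" by (rule Q_fun_nonneg[OF m Kc]) (use t in auto)
  then show "0 \<le> Q_fun t z" using t by (simp add: Q_fun_clip)
  have "0 \<le> Q_star t (clip z)"
    by (rule Q_fun_nonneg[OF _ path_star_bound[OF Kc]]) (use t m in auto)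
  then show "0 \<le> Q_star t z" using t by (simp add: Q_fun_star_clip)
qed

lemma Q_fun_D01_lipschitz:
  assumes z: "z \<in> mspace D01" and z': "z' \<in> mspace D01" and t: "0 < t" "t < 1"
    and K: "\<And>u. u \<in> {0..1} \<Longrightarrow> \<bar>z u\<bar> \<le> K" "\<And>u. u \<in> {0..1} \<Longrightarrow> \<bar>z' u\<bar> \<le> K" "1 \<le> K"
  shows "\<bar>Q_fun t z - Q_fun t z'\<bar> \<le> 40 * (1 / t) ^ 3 * K\<^sup>2 * mdist D01 z z'"
    and "\<bar>Q_star t z - Q_star t z'\<bar>
       \<le> 40 * (1 / (1 - t)) ^ 3 * (2 * K)\<^sup>2 * (2 * mdist D01 z z')"
proof -
  let ?d = "mdist D01 z z'"
  have d: "\<bar>clip z u - clip z' u\<bar> \<le> ?d" if "u \<in> {0..1}" for u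
    using D01_dist_le[OF z z' that] that by (simp add: clip_eq)
  have Kc: "\<bar>clip z u\<bar> \<le> K" "\<bar>clip z' u\<bar> \<le> K" if "u \<in> {0..1}" for u using K that by (simp_all add: clip_eq)
  have m: "clip z \<in> borel_measurable borel" "clip z' \<in> borel_measurable borel"
    using D01_cadlag[OF z] D01_cadlag[OF z'] by measurable
  have "\<bar>Q_fun t (clip z) - Q_fun t (clip z')\<bar> \<le> 40 * (1 / t) ^ 3 * K\<^sup>2 * ?d"
    by (rule Q_fun_lipschitz[OF m]) (use Kc d t K(3) in auto)
  then show "\<bar>Q_fun t z - Q_fun t z'\<bar> \<le> 40 * (1 / t) ^ 3 * K\<^sup>2 * ?d"
    using t by (simp add: Q_fun_clip)
  have "\<bar>Q_star t (clip z) - Q_star t (clip z')\<bar>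
       \<le> 40 * (1 / (1 - t)) ^ 3 * (2 * K)\<^sup>2 * (2 * ?d)"
  proof (rule Q_fun_lipschitz)
    fix u assume "u \<in> {0..1 - t}"
    then have u: "u \<in> {0..1}" using t by auto
    show "\<bar>path_star (clip z) u\<bar> \<le> 2 * K" by (rule path_star_bound[OF Kc(1) u])
    show "\<bar>path_star (clip z') u\<bar> \<le> 2 * K" by (rule path_star_bound[OF Kc(2) u])
    show "\<bar>path_star (clip z) u - path_star (clip z') u\<bar> \<le> 2 * ?d"
      using d[of 1] d[of "1 - u"] u unfolding path_star_def by (auto simp: abs_le_iff)
  qed (use m t K(3) in auto)
  then show "\<bar>Q_star t z - Q_star t z'\<bar>
       \<le> 40 * (1 / (1 - t)) ^ 3 * (2 * K)\<^sup>2 * (2 * ?d)"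
    using t by (simp add: Q_fun_star_clip)
qed

section \<open>Measurability of the limiting functionals\<close>

text \<open>On the reals \<open>Sup\<close> is a \<open>LEAST\<close> over the upper bounds, so
  equal sets of upper bounds give equal values even when there are none.\<close>

lemma Sup_real_eqI:
  assumes "\<And>y. (\<forall>x\<in>A. x \<le> y) \<longleftrightarrow> (\<forall>x\<in>B. x \<le> y)"
  shows "Sup A = (Sup B :: real)"
  unfolding Sup_real_def using assms by simp

text \<open>The right endpoint is added because no point of the interval approaches it from the
  right.\<close>

definition dense_points :: "real \<Rightarrow> real \<Rightarrow> real set" where
  "dense_points a b = {t \<in> {a..b}. t \<in> \<rat> \<or> t = b}"

lemma dense_points_subset: "dense_points a b \<subseteq> {a..b}"
  by (auto simp: dense_points_def)

lemma countable_dense_points [simp]: "countable (dense_points a b)"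
  by (rule countable_subset[of _ "insert b \<rat>"]) (auto simp: dense_points_def countable_rat)

lemma dense_points_nonempty: "a \<le> b \<Longrightarrow> dense_points a b \<noteq> {}"
  by (auto simp: dense_points_def)

text \<open>A set without upper bound is allowed: its supremum is a fixed junk value.\<close>

lemma SUP_dense_points:
  fixes f :: "real \<Rightarrow> real"
  assumes "a \<le> b"
    and rc: "\<And>t. a \<le> t \<Longrightarrow> t < b \<Longrightarrow> (\<forall>s\<in>{a..b}. f t \<le> f s) \<or> (f \<longlongrightarrow> f t) (at_right t)"
  shows "(SUP t\<in>{a..b}. f t) = (SUP t\<in>dense_points a b. f t)"
proof (rule Sup_real_eqI, safe)
  fix y t assume ub: "\<forall>x\<in>f ` dense_points a b. x \<le> y" and t: "t \<in> {a..b}"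
  show "f t \<le> y"
  proof (cases "t = b")
    case True then show ?thesis using ub assms(1) by (auto simp: dense_points_def)
  next
    case False
    then have tb: "a \<le> t" "t < b" using t by auto
    from rc[OF tb] show ?thesis
    proof
      \<comment> \<open>A minimal value is dominated by the value at \<open>b\<close>, which is one
        of the dense points. This alternative serves quotients whose denominator vanishes at
        \<open>t\<close>.\<close>
      assume "\<forall>s\<in>{a..b}. f t \<le> f s"
      then have "f t \<le> f b" using assms(1) by auto
      then show ?thesis using ub assms(1) by (fastforce simp: dense_points_def)
    next
      assume lim: "(f \<longlongrightarrow> f t) (at_right t)"
      show ?thesis
      proof (rule ccontr)
        assume "\<not> f t \<le> y"
        then have "eventually (\<lambda>x. y < f x) (at_right t)" using lim by (intro order_tendstoD) auto
        then obtain c where c: "c > t" "\<And>x. t < x \<Longrightarrow> x < c \<Longrightarrow> y < f x"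
          unfolding eventually_at_right_field by blast
        obtain q where q: "q \<in> \<rat>" "t < q" "q < min b c"
          using Rats_dense_in_real[of t "min b c"] c(1) tb by auto
        then have "q \<in> dense_points a b" using tb by (auto simp: dense_points_def)
        then show False using ub c(2)[of q] q by fastforce
      qed
    qed
  qed
qed (use dense_points_subset in auto)

lemma INF_dense_points:
  fixes f :: "real \<Rightarrow> real"
  assumes "a \<le> b"
    and rc: "\<And>t. a \<le> t \<Longrightarrow> t < b \<Longrightarrow> (f \<longlongrightarrow> f t) (at_right t)"
  shows "(INF t\<in>{a..b}. f t) = (INF t\<in>dense_points a b. f t)"
  using SUP_dense_points[OF assms(1), of "\<lambda>t. - f t"] rc
  unfolding Inf_real_def image_image by (auto intro!: tendsto_minus)

text \<open>The arguments with a bounded family form a measurable set \<open>B\<close>. On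
  \<open>B\<close> the usual result applies; off \<open>B\<close> the supremum is the constant
  \<open>LEAST z. False\<close>.\<close>

lemma borel_measurable_SUP_real:
  fixes f :: "'i \<Rightarrow> 'a \<Rightarrow> real"
  assumes D: "countable D" "D \<noteq> {}" and m: "\<And>i. i \<in> D \<Longrightarrow> f i \<in> borel_measurable M"
  shows "(\<lambda>w. SUP i\<in>D. f i w) \<in> borel_measurable M"
proof -
  define B where "B = {w \<in> space M. \<exists>n. \<forall>i\<in>D. f i w \<le> real n}"
  have "{w \<in> space M. f i w \<le> real n} \<in> sets M" if "i \<in> D" for i n
    using m[OF that] by measurable
  then have B[measurable]: "B \<in> sets M"
    unfolding B_def by (intro sets.sets_Collect_countable_Ex sets.sets_Collect_countable_All' D(1))
  have bdd: "w \<in> B \<longleftrightarrow> bdd_above ((\<lambda>i. f i w) ` D)" if "w \<in> space M" for w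
    using that unfolding B_def bdd_above_def by (auto) (meson order_trans real_arch_simple)
  have "(\<lambda>w. SUP i\<in>D. if w \<in> B then f i w else 0) \<in> borel_measurable M"
  proof (rule borel_measurable_cSUP[OF D(1)])
    show "(\<lambda>w. if w \<in> B then f i w else 0) \<in> borel_measurable M" if "i \<in> D" for i
      using m[OF that] by measurable
    show "bdd_above ((\<lambda>i. if w \<in> B then f i w else 0) ` D)" if "w \<in> space M" for w
      using bdd[OF that] by (cases "w \<in> B") auto
  qed
  then have "(\<lambda>w. if w \<in> B then SUP i\<in>D. (if w \<in> B then f i w else 0) else (LEAST z. False)) \<in> borel_measurable M"
    by measurable
  moreover have "(SUP i\<in>D. f i w) = (if w \<in> B then SUP i\<in>D. (if w \<in> B then f i w else 0) else (LEAST z. False))"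
    if "w \<in> space M" for w
  proof (cases "w \<in> B")
    case False
    then have "(\<lambda>y. \<forall>i\<in>D. f i w \<le> y) = (\<lambda>_. False)"
      using bdd[OF that] unfolding bdd_above_def fun_eq_iff by auto
    then show ?thesis using False by (simp add: Sup_real_def)
  qed simp
  ultimately show ?thesis
    by (subst measurable_cong) auto
qed

lemma borel_measurable_INF_real:
  fixes f :: "'i \<Rightarrow> 'a \<Rightarrow> real"
  assumes D: "countable D" "D \<noteq> {}" and m: "\<And>i. i \<in> D \<Longrightarrow> f i \<in> borel_measurable M"
  shows "(\<lambda>w. INF i\<in>D. f i w) \<in> borel_measurable M"
  unfolding Inf_real_def image_image
  by (intro borel_measurable_uminus borel_measurable_SUP_real D) (use m in auto)

abbreviation (input) D01_measurable :: "((real \<Rightarrow> real) \<Rightarrow> real) \<Rightarrow> bool" where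
  "D01_measurable f \<equiv> f \<in> borel_measurable D01_ball_sigma"

context
  fixes a b :: real
  assumes \<tau>: "0 < a" "a \<le> b" "b < 1"
begin

lemma Q_fun_section_measurable:
  assumes "t \<in> {a..b}"
  shows "D01_measurable (\<lambda>z. Q_fun t z)"
    and "D01_measurable (\<lambda>z. Q_star t z)"
proof -
  have t: "t \<in> {0..1}" using assms \<tau> by auto
  have "Pair t \<in> measurable D01_ball_sigma (borel \<Otimes>\<^sub>M D01_ball_sigma)" by measurable
  from measurable_compose[OF this Q_fun_D01_measurable] measurable_compose[OF this Q_fun_star_D01_measurable]
  show "D01_measurable (\<lambda>z. Q_fun t z)"
    and "D01_measurable (\<lambda>z. Q_star t z)"
    using t by (simp_all add: Q_fun_clip Q_fun_star_clip)
qed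

lemma INF_Q_measurable:
  "D01_measurable (\<lambda>z. INF t\<in>{a..b}. Q_fun t z)"
  "D01_measurable (\<lambda>z. INF t\<in>{a..b}. Q_star t z)"
proof -
  have sub: "t \<in> {a..b}" if "t \<in> dense_points a b" for t using that dense_points_subset by blast
  have "D01_measurable (\<lambda>z. INF t\<in>dense_points a b. Q_fun t z)"
    by (rule borel_measurable_INF_real) (use \<tau> in \<open>auto simp: dense_points_nonempty intro!: Q_fun_section_measurable sub\<close>)
  moreover have "(INF t\<in>{a..b}. Q_fun t z) = (INF t\<in>dense_points a b. Q_fun t z)" if "z \<in> mspace D01" for z
    by (rule INF_dense_points) (use \<tau> that in \<open>auto intro: Q_fun_right_cont\<close>)
  ultimately show "D01_measurable (\<lambda>z. INF t\<in>{a..b}. Q_fun t z)"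
    by (subst measurable_cong) auto
  have "D01_measurable (\<lambda>z. INF t\<in>dense_points a b. Q_star t z)"
    by (rule borel_measurable_INF_real) (use \<tau> in \<open>auto simp: dense_points_nonempty intro!: Q_fun_section_measurable sub\<close>)
  moreover have "(INF t\<in>{a..b}. Q_star t z) = (INF t\<in>dense_points a b. Q_star t z)" if "z \<in> mspace D01" for z
    by (rule INF_dense_points) (use \<tau> that in \<open>auto intro: Q_fun_right_cont\<close>)
  ultimately show "D01_measurable (\<lambda>z. INF t\<in>{a..b}. Q_star t z)"
    by (subst measurable_cong) auto
qed

lemma R_fun_measurable: "D01_measurable (R_fun {a..b})"
  unfolding R_fun_def[abs_def] by (intro borel_measurable_divide INF_Q_measurable)

lemma I_fun_measurable: "D01_measurable (I_fun {a..b})"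
proof -
  have ind: "indicator {a..b} u = (if a \<le> u \<and> u \<le> b then 1 else 0 :: real)" for u :: real
    by (auto simp: indicator_def)
  have "(\<lambda>p. indicator {a..b} (fst p) * (Q_star (fst p) (clip (snd p)) / Q_fun (fst p) (clip (snd p))))
    \<in> borel_measurable (borel \<Otimes>\<^sub>M D01_ball_sigma)"
    unfolding ind by measurable
  then have "(\<lambda>p. (\<lambda>p. indicator {a..b} (fst p) * (Q_star (fst p) (clip (snd p)) / Q_fun (fst p) (clip (snd p))))
     (snd p, fst p)) \<in> borel_measurable (D01_ball_sigma \<Otimes>\<^sub>M borel)"
    by (rule measurable_compose[rotated]) measurable
  then have "(\<lambda>z. \<integral>\<tau>. indicator {a..b} \<tau> * (Q_star \<tau> (clip z) / Q_fun \<tau> (clip z)) \<partial>lborel)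
    \<in> borel_measurable D01_ball_sigma"
    by (intro lborel.borel_measurable_lebesgue_integral) (simp add: split_beta' measurable_lborel2)
  also have "(\<lambda>z. \<integral>\<tau>. indicator {a..b} \<tau> * (Q_star \<tau> (clip z) / Q_fun \<tau> (clip z)) \<partial>lborel)
    = I_fun {a..b}"
    unfolding I_fun_def set_lebesgue_integral_def real_scaleR_def
    using \<tau> by (intro ext Bochner_Integration.integral_cong refl) (auto simp: indicator_def Q_fun_clip Q_fun_star_clip)
  finally show ?thesis .
qed

lemma W_fun_measurable: "D01_measurable (W_fun {a..b})"
proof -
  let ?r = "\<lambda>t z. Q_star t z / Q_fun t z"
  have sub: "t \<in> {a..b}" if "t \<in> dense_points a b" for t using that dense_points_subset by blast
  have "D01_measurable (\<lambda>z. SUP t\<in>dense_points a b. ?r t z)"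
    by (rule borel_measurable_SUP_real)
      (use \<tau> in \<open>auto simp: dense_points_nonempty intro!: borel_measurable_divide Q_fun_section_measurable sub\<close>)
  moreover have "W_fun {a..b} z = (SUP t\<in>dense_points a b. ?r t z)" if z: "z \<in> mspace D01" for z
    unfolding W_fun_def
  proof (rule SUP_dense_points[OF \<tau>(2)])
    fix t assume t: "a \<le> t" "t < b"
    show "(\<forall>s\<in>{a..b}. ?r t z \<le> ?r s z) \<or> ((\<lambda>t. ?r t z) \<longlongrightarrow> ?r t z) (at_right t)"
    proof (cases "Q_fun t z = 0")
      case True \<comment> \<open>\<open>x / 0 = 0\<close> is the minimum of the quotient, so right continuity is not needed at \<open>t\<close>\<close>
      then show ?thesis using Q_fun_D01_bounds[OF z] \<tau> by auto
    next
      case False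
      then show ?thesis using t \<tau> by (intro disjI2 tendsto_divide Q_fun_right_cont[OF z]) auto
    qed
  qed
  ultimately show ?thesis
    by (subst measurable_cong) auto
qed

end

section \<open>Continuity in law through cutoffs\<close>

lemma SUP_diff_abs_le:
  fixes f g :: "'i \<Rightarrow> real"
  assumes "T \<noteq> {}" "bdd_above (f ` T)" "bdd_above (g ` T)" "\<And>t. t \<in> T \<Longrightarrow> \<bar>f t - g t\<bar> \<le> e"
  shows "\<bar>(SUP t\<in>T. f t) - (SUP t\<in>T. g t)\<bar> \<le> e"
proof -
  have "(SUP t\<in>T. f t) \<le> (SUP t\<in>T. g t) + e"
  proof (rule cSUP_least[OF assms(1)])
    fix t assume t: "t \<in> T"
    show "f t \<le> (SUP t\<in>T. g t) + e"
      using cSUP_upper[OF t assms(3)] assms(4)[OF t] by linarith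
  qed
  moreover have "(SUP t\<in>T. g t) \<le> (SUP t\<in>T. f t) + e"
  proof (rule cSUP_least[OF assms(1)])
    fix t assume t: "t \<in> T"
    show "g t \<le> (SUP t\<in>T. f t) + e"
      using cSUP_upper[OF t assms(2)] assms(4)[OF t] by linarith
  qed
  ultimately show ?thesis by linarith
qed

lemma INF_diff_abs_le:
  fixes f g :: "'i \<Rightarrow> real"
  assumes "T \<noteq> {}" "bdd_below (f ` T)" "bdd_below (g ` T)" "\<And>t. t \<in> T \<Longrightarrow> \<bar>f t - g t\<bar> \<le> e"
  shows "\<bar>(INF t\<in>T. f t) - (INF t\<in>T. g t)\<bar> \<le> e"
proof -
  have "bdd_above ((\<lambda>t. - h t) ` T)" if b: "bdd_below (h ` T)" for h :: "'i \<Rightarrow> real"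
  proof -
    obtain m where "\<forall>x\<in>h ` T. m \<le> x" using b unfolding bdd_below_def by blast
    then show ?thesis by (intro bdd_aboveI2[where M="- m"]) auto
  qed
  then show ?thesis
    using SUP_diff_abs_le[of T "\<lambda>t. - f t" "\<lambda>t. - g t" e] assms
    unfolding Inf_real_def image_image by (auto simp: abs_minus_commute)
qed

lemma ratio_diff_abs_le:
  fixes p q p' q' :: real
  assumes "0 < l" "l \<le> q" "l \<le> q'" "\<bar>p'\<bar> \<le> P" "\<bar>p - p'\<bar> \<le> r" "\<bar>q - q'\<bar> \<le> r"
  shows "\<bar>p / q - p' / q'\<bar> \<le> r * (1 / l + P / l\<^sup>2)"
proof -
  have pos: "0 < q" "0 < q'" using assms by auto
  have d0: "0 \<le> r" using assms by linarith
  have "p / q - p' / q' = (p - p') / q + p' * (q' - q) / (q * q')"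
    using pos by (simp add: field_simps)
  moreover have "\<bar>(p - p') / q\<bar> \<le> r / l"
    unfolding abs_divide using assms pos d0 by (intro frac_le) auto
  moreover have "\<bar>p' * (q' - q) / (q * q')\<bar> \<le> P * r / (l * l)"
    unfolding abs_divide abs_mult using assms pos d0 by (intro frac_le mult_mono) (auto simp: abs_minus_commute)
  ultimately have "\<bar>p / q - p' / q'\<bar> \<le> r / l + P * r / (l * l)" by linarith
  then show ?thesis by (simp add: power2_eq_square algebra_simps)
qed

text \<open>All three statistics and all three limits have the form \<open>\<Phi> p q\<close> for one of three functionals
  \<open>\<Phi>\<close> of a pair of functions on \<open>T\<close>; this is the continuity shared by the three functionals.\<close>

definition ratio_continuous :: "real set \<Rightarrow> ((real \<Rightarrow> real) \<Rightarrow> (real \<Rightarrow> real) \<Rightarrow> real) \<Rightarrow> bool" where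
  "ratio_continuous T \<Phi> \<longleftrightarrow> (\<forall>p q p' q' l P r.
     0 < l \<and> (\<forall>t\<in>T. l \<le> q t \<and> l \<le> q' t \<and> \<bar>p t\<bar> \<le> P \<and> \<bar>p' t\<bar> \<le> P \<and>
       \<bar>p t - p' t\<bar> \<le> r \<and> \<bar>q t - q' t\<bar> \<le> r) \<and>
     (\<lambda>t. indicator T t * (p t / q t)) \<in> borel_measurable borel \<and>
     (\<lambda>t. indicator T t * (p' t / q' t)) \<in> borel_measurable borel
     \<longrightarrow> \<bar>\<Phi> p q - \<Phi> p' q'\<bar> \<le> r * (1 / l + P / l\<^sup>2))"

lemma ratio_continuousD:
  assumes "ratio_continuous T \<Phi>" "0 < l" "\<And>t. t \<in> T \<Longrightarrow> l \<le> q t" "\<And>t. t \<in> T \<Longrightarrow> l \<le> q' t"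
    "\<And>t. t \<in> T \<Longrightarrow> \<bar>p t\<bar> \<le> P" "\<And>t. t \<in> T \<Longrightarrow> \<bar>p' t\<bar> \<le> P"
    "\<And>t. t \<in> T \<Longrightarrow> \<bar>p t - p' t\<bar> \<le> r" "\<And>t. t \<in> T \<Longrightarrow> \<bar>q t - q' t\<bar> \<le> r"
    "(\<lambda>t. indicator T t * (p t / q t)) \<in> borel_measurable borel"
    "(\<lambda>t. indicator T t * (p' t / q' t)) \<in> borel_measurable borel"
  shows "\<bar>\<Phi> p q - \<Phi> p' q'\<bar> \<le> r * (1 / l + P / l\<^sup>2)"
  by (rule assms(1)[unfolded ratio_continuous_def, THEN spec, THEN spec, THEN spec, THEN spec, THEN spec,
        THEN spec, THEN spec, THEN mp], intro conjI ballI) (simp_all only: assms)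

lemma ratio_bdd:
  fixes p q :: "real \<Rightarrow> real"
  assumes "0 < l" "\<forall>t\<in>T. l \<le> q t \<and> \<bar>p t\<bar> \<le> P"
  shows "\<forall>t\<in>T. \<bar>p t / q t\<bar> \<le> P / l"
proof
  fix t assume "t \<in> T"
  then have "l \<le> q t" "\<bar>p t\<bar> \<le> P" using assms by auto
  then show "\<bar>p t / q t\<bar> \<le> P / l" unfolding abs_divide using assms(1) by (intro frac_le) auto
qed

lemma ratio_continuous_SUP:
  assumes "T \<noteq> {}"
  shows "ratio_continuous T (\<lambda>p q. SUP t\<in>T. p t / q t)"
  unfolding ratio_continuous_def
proof (intro allI impI, elim conjE)
  fix p q p' q' :: "real \<Rightarrow> real" and l P r :: real
  assume e: "0 < l" and H: "\<forall>t\<in>T. l \<le> q t \<and> l \<le> q' t \<and> \<bar>p t\<bar> \<le> P \<and> \<bar>p' t\<bar> \<le> P \<and>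
       \<bar>p t - p' t\<bar> \<le> r \<and> \<bar>q t - q' t\<bar> \<le> r"
  have "\<forall>t\<in>T. \<bar>p t / q t\<bar> \<le> P / l" "\<forall>t\<in>T. \<bar>p' t / q' t\<bar> \<le> P / l"
    using ratio_bdd[OF e, of T q p P] ratio_bdd[OF e, of T q' p' P] H by auto
  then have "\<forall>t\<in>T. p t / q t \<le> P / l" "\<forall>t\<in>T. p' t / q' t \<le> P / l"
    by (blast intro: order_trans[OF abs_ge_self])+
  then show "\<bar>(SUP t\<in>T. p t / q t) - (SUP t\<in>T. p' t / q' t)\<bar> \<le> r * (1 / l + P / l\<^sup>2)"
    using e H by (intro SUP_diff_abs_le assms ratio_diff_abs_le bdd_aboveI2[where M="P / l"]) auto
qed

lemma ratio_continuous_INF: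
  assumes "T \<noteq> {}"
  shows "ratio_continuous T (\<lambda>p q. (INF t\<in>T. p t) / (INF t\<in>T. q t))"
  unfolding ratio_continuous_def
proof (intro allI impI, elim conjE)
  fix p q p' q' :: "real \<Rightarrow> real" and l P r :: real
  assume e: "0 < l" and H: "\<forall>t\<in>T. l \<le> q t \<and> l \<le> q' t \<and> \<bar>p t\<bar> \<le> P \<and> \<bar>p' t\<bar> \<le> P \<and>
       \<bar>p t - p' t\<bar> \<le> r \<and> \<bar>q t - q' t\<bar> \<le> r"
  obtain t where t: "t \<in> T" using assms by blast
  have b: "bdd_below (p ` T)" "bdd_below (p' ` T)" "bdd_below (q ` T)" "bdd_below (q' ` T)"
    by (rule bdd_belowI2[where m="- P"], use H in fastforce, rule bdd_belowI2[where m="- P"], use H in fastforce,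
        rule bdd_belowI2[where m=l], use H in fastforce, rule bdd_belowI2[where m=l], use H in fastforce)
  show "\<bar>(INF t\<in>T. p t) / (INF t\<in>T. q t) - (INF t\<in>T. p' t) / (INF t\<in>T. q' t)\<bar> \<le> r * (1 / l + P / l\<^sup>2)"
  proof (rule ratio_diff_abs_le[OF e])
    have "- P \<le> (INF t\<in>T. p' t)" using H assms by (intro cINF_greatest) (auto simp: abs_le_iff)
    moreover have "(INF t\<in>T. p' t) \<le> P"
      using cINF_lower[OF b(2) t] H t by force
    ultimately show "\<bar>INF t\<in>T. p' t\<bar> \<le> P" by simp
  qed (use H b assms in \<open>auto intro!: cINF_greatest INF_diff_abs_le\<close>)
qed

lemma ratio_continuous_integral:
  assumes ab: "a \<le> b" "b - a \<le> 1"
  shows "ratio_continuous {a..b} (\<lambda>p q. LINT t:{a..b}|lborel. p t / q t)"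
  unfolding ratio_continuous_def
proof (intro allI impI, elim conjE)
  fix p q p' q' :: "real \<Rightarrow> real" and l P r :: real
  let ?i = "indicator {a..b} :: real \<Rightarrow> real"
  assume e: "0 < l" and H: "\<forall>t\<in>{a..b}. l \<le> q t \<and> l \<le> q' t \<and> \<bar>p t\<bar> \<le> P \<and> \<bar>p' t\<bar> \<le> P \<and>
       \<bar>p t - p' t\<bar> \<le> r \<and> \<bar>q t - q' t\<bar> \<le> r"
    and m: "(\<lambda>t. ?i t * (p t / q t)) \<in> borel_measurable borel"
     "(\<lambda>t. ?i t * (p' t / q' t)) \<in> borel_measurable borel"
  have r: "\<forall>t\<in>{a..b}. \<bar>p t / q t\<bar> \<le> P / l" "\<forall>t\<in>{a..b}. \<bar>p' t / q' t\<bar> \<le> P / l"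
    using ratio_bdd[OF e, of "{a..b}" q p P] ratio_bdd[OF e, of "{a..b}" q' p' P] H by auto
  have "a \<in> {a..b}" using ab by auto
  then have "\<bar>p a\<bar> \<le> P" "\<bar>p a - p' a\<bar> \<le> r" using H by blast+
  then have "0 \<le> P" "0 \<le> r" by linarith+
  then have K0: "0 \<le> r * (1 / l + P / l\<^sup>2)" using e by auto
  \<comment> \<open>Only the products with the indicator are known to be measurable, so the estimate
    is made for them; under the set integral the indicator then disappears.\<close>
  have "\<bar>(LINT t:{a..b}|lborel. ?i t * (p t / q t)) - (LINT t:{a..b}|lborel. ?i t * (p' t / q' t))\<bar>
      \<le> r * (1 / l + P / l\<^sup>2) * (b - a)"
  proof (rule set_integral_diff_abs_le_Icc[OF m, where K="P / l"])
    fix t assume t: "t \<in> {a..b}"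
    then have i: "?i t = 1" by simp
    show "\<bar>?i t * (p t / q t)\<bar> \<le> P / l" "\<bar>?i t * (p' t / q' t)\<bar> \<le> P / l"
      unfolding i mult_1 using r t by blast+
    show "\<bar>?i t * (p t / q t) - ?i t * (p' t / q' t)\<bar> \<le> r * (1 / l + P / l\<^sup>2)"
      unfolding i mult_1 by (rule ratio_diff_abs_le[OF e]) (use H t in auto)
  qed (rule ab)
  also have "\<dots> \<le> r * (1 / l + P / l\<^sup>2)" using mult_left_mono[OF ab(2) K0] by simp
  also have "(LINT t:{a..b}|lborel. ?i t * (p t / q t)) = (LINT t:{a..b}|lborel. p t / q t)"
    by (rule set_lebesgue_integral_cong) auto
  also have "(LINT t:{a..b}|lborel. ?i t * (p' t / q' t)) = (LINT t:{a..b}|lborel. p' t / q' t)"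
    by (rule set_lebesgue_integral_cong) auto
  finally show "\<bar>(LINT t:{a..b}|lborel. p t / q t) - (LINT t:{a..b}|lborel. p' t / q' t)\<bar> \<le> r * (1 / l + P / l\<^sup>2)" .
qed

section \<open>Continuity at a path and the mapping theorem with cutoffs\<close>

definition D01_cont_at :: "((real \<Rightarrow> real) \<Rightarrow> real) \<Rightarrow> (real \<Rightarrow> real) \<Rightarrow> bool" where
  "D01_cont_at F z \<longleftrightarrow> (\<forall>e>0. \<exists>\<delta>>0. \<forall>z'\<in>mspace D01. mdist D01 z z' < \<delta> \<longrightarrow> \<bar>F z - F z'\<bar> < e)"

lemma D01_continuous_mapI:
  assumes "\<And>z. z \<in> mspace D01 \<Longrightarrow> D01_cont_at F z"
  shows "continuous_map (mtopology_of D01) euclidean F"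
proof -
  have m: "Metric_space (mspace D01) (mdist D01)" "Metric_space (UNIV::real set) dist"
    by (auto simp: Met_TC.Metric_space_axioms)
  have "continuous_map (Metric_space.mtopology (mspace D01) (mdist D01)) Met_TC.mtopology F"
    unfolding Metric_space.metric_continuous_map[OF m] dist_real_def
  proof (intro conjI ballI allI impI)
    fix z and e :: real assume "z \<in> mspace D01" "0 < e"
    then obtain d where "d > 0" "\<forall>z'\<in>mspace D01. mdist D01 z z' < d \<longrightarrow> \<bar>F z - F z'\<bar> < e"
      using assms unfolding D01_cont_at_def by blast
    then show "\<exists>\<delta>>0. \<forall>x. x \<in> mspace D01 \<and> mdist D01 z x < \<delta> \<longrightarrow> \<bar>F z - F x\<bar> < e"
      by (intro exI[of _ d]) blast
  qed simp
  then show ?thesis by (simp add: mtopology_of_def)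
qed

lemma D01_cont_at_mult:
  assumes f: "D01_cont_at f z" and g: "D01_cont_at g z"
  shows "D01_cont_at (\<lambda>z. f z * g z) z"
  unfolding D01_cont_at_def
proof (intro allI impI)
  fix e :: real assume e: "e > 0"
  define B where "B = \<bar>f z\<bar> + \<bar>g z\<bar> + 1"
  have B: "B > 0" by (simp add: B_def)
  \<comment> \<open>The bound by 1 gives \<open>\<bar>g z'\<bar> \<le> \<bar>g z\<bar> + 1\<close>,
    so that the two error terms add up to at most \<open>e' * B \<le> e / 2\<close>.\<close>
  define e' where "e' = min 1 (e / (2 * B))"
  have e': "e' > 0" "e' \<le> 1" "e' * B \<le> e / 2" using e B by (auto simp: e'_def min_def field_simps)
  obtain d1 where d1: "d1 > 0" "\<forall>z'\<in>mspace D01. mdist D01 z z' < d1 \<longrightarrow> \<bar>f z - f z'\<bar> < e'"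
    using f e' unfolding D01_cont_at_def by blast
  obtain d2 where d2: "d2 > 0" "\<forall>z'\<in>mspace D01. mdist D01 z z' < d2 \<longrightarrow> \<bar>g z - g z'\<bar> < e'"
    using g e' unfolding D01_cont_at_def by blast
  show "\<exists>\<delta>>0. \<forall>z'\<in>mspace D01. mdist D01 z z' < \<delta> \<longrightarrow> \<bar>f z * g z - f z' * g z'\<bar> < e"
  proof (intro exI[of _ "min d1 d2"] conjI ballI impI)
    fix z' assume z': "z' \<in> mspace D01" "mdist D01 z z' < min d1 d2"
    then have a: "\<bar>f z - f z'\<bar> < e'" and b: "\<bar>g z - g z'\<bar> < e'" using d1 d2 by auto
    have "f z * g z - f z' * g z' = (f z - f z') * g z' + f z * (g z - g z')"
      by (simp add: algebra_simps)
    then have "\<bar>f z * g z - f z' * g z'\<bar> \<le> \<bar>f z - f z'\<bar> * \<bar>g z'\<bar> + \<bar>f z\<bar> * \<bar>g z - g z'\<bar>"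
      using abs_triangle_ineq[of "(f z - f z') * g z'" "f z * (g z - g z')"] by (simp only: abs_mult)
    also have "\<dots> \<le> e' * (\<bar>g z\<bar> + 1) + \<bar>f z\<bar> * e'"
      using a b e' by (intro add_mono mult_mono) auto
    also have "\<dots> = e' * B" by (simp add: B_def algebra_simps)
    also have "\<dots> < e" using e' e by linarith
    finally show "\<bar>f z * g z - f z' * g z'\<bar> < e" .
  qed (use d1 d2 in auto)
qed

lemma D01_cont_at_compose:
  assumes f: "D01_cont_at f z" and g: "isCont g (f z)"
  shows "D01_cont_at (\<lambda>z. g (f z)) z"
  unfolding D01_cont_at_def
proof (intro allI impI)
  fix e :: real assume "e > 0"
  then obtain s where s: "s > 0" "\<forall>y. dist y (f z) < s \<longrightarrow> dist (g y) (g (f z)) < e"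
    using g unfolding continuous_at_eps_delta by blast
  obtain d where "d > 0" "\<forall>z'\<in>mspace D01. mdist D01 z z' < d \<longrightarrow> \<bar>f z - f z'\<bar> < s"
    using f s unfolding D01_cont_at_def by blast
  then show "\<exists>\<delta>>0. \<forall>z'\<in>mspace D01. mdist D01 z z' < \<delta> \<longrightarrow> \<bar>g (f z) - g (f z')\<bar> < e"
    using s(2) by (intro exI[of _ d]) (auto simp: dist_real_def abs_minus_commute)
qed

text \<open>From \<open>v - c * u = (1 - c) * v + c * (v - u)\<close>: the first term costs the
  missing mass, the second at most \<open>e\<close>, because \<open>v\<close> and \<open>u\<close>
  are compared only where \<open>c\<close> is positive.\<close>

lemma (in prob_space) expectation_cutoff_le:
  fixes c u v :: "'a \<Rightarrow> real"
  assumes m [measurable]: "c \<in> borel_measurable M" "u \<in> borel_measurable M" "v \<in> borel_measurable M"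
    and c: "\<And>w. w \<in> space M \<Longrightarrow> 0 \<le> c w \<and> c w \<le> 1" and u: "\<And>w. 0 \<le> u w \<and> u w \<le> 1"
    and v: "\<And>w. 0 \<le> v w \<and> v w \<le> 1" and e: "0 \<le> e"
    and close: "\<And>w. w \<in> space M \<Longrightarrow> 0 < c w \<Longrightarrow> \<bar>v w - u w\<bar> \<le> e"
  shows "\<bar>expectation v - expectation (\<lambda>w. c w * u w)\<bar> \<le> 1 - expectation c + e"
proof -
  have int: "integrable M f" if "f \<in> borel_measurable M" "\<And>w. w \<in> space M \<Longrightarrow> 0 \<le> f w \<and> f w \<le> 1"
    for f :: "'a \<Rightarrow> real"
    by (rule integrable_const_bound[of _ 1]) (use that in auto)
  have i: "integrable M c" "integrable M v" "integrable M (\<lambda>w. c w * u w)"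
    using c u v by (auto intro!: int mult_le_one)
  have "\<bar>expectation v - expectation (\<lambda>w. c w * u w)\<bar> = \<bar>expectation (\<lambda>w. v w - c w * u w)\<bar>"
    using i by simp
  also have "\<dots> \<le> expectation (\<lambda>w. \<bar>v w - c w * u w\<bar>)" by (rule integral_abs_bound)
  also have "\<dots> \<le> expectation (\<lambda>w. 1 - c w + e)"
  proof (rule integral_mono)
    fix w assume w: "w \<in> space M"
    have eq: "v w - c w * u w = (1 - c w) * v w + c w * (v w - u w)" by (simp add: algebra_simps)
    have A: "\<bar>(1 - c w) * v w\<bar> \<le> (1 - c w) * 1"
      unfolding abs_mult using c[OF w] v by (intro mult_mono) auto
    have B: "\<bar>c w * (v w - u w)\<bar> \<le> 1 * e"
    proof (cases "0 < c w")
      case True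
      then show ?thesis unfolding abs_mult using c[OF w] close[OF w] e by (intro mult_mono) auto
    next
      case False
      then have "c w = 0" using c[OF w] by linarith
      then show ?thesis using e by simp
    qed
    show "\<bar>v w - c w * u w\<bar> \<le> 1 - c w + e"
      unfolding eq using order_trans[OF abs_triangle_ineq add_mono[OF A B]] by simp
  qed (use i in auto)
  also have "\<dots> = 1 - expectation c + e" using i by (simp add: prob_space)
  finally show ?thesis .
qed

text \<open>Where \<open>c\<close> vanishes, boundedness of \<open>g\<close> alone makes the product
  continuous. Continuity of \<open>g\<close> is thus asked only where \<open>c\<close> is
  positive.\<close>

lemma D01_cont_at_cutoff_mult:
  assumes c: "D01_cont_at c z" and cb: "\<And>z. z \<in> mspace D01 \<Longrightarrow> 0 \<le> c z" and z: "z \<in> mspace D01"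
    and g: "\<And>z. \<bar>g z\<bar> \<le> 1" "0 < c z \<Longrightarrow> D01_cont_at g z"
  shows "D01_cont_at (\<lambda>z. c z * g z) z"
proof (cases "0 < c z")
  case False
  then have 0: "c z = 0" using cb[OF z] by linarith
  have le: "\<bar>c z * g z - c z' * g z'\<bar> \<le> \<bar>c z - c z'\<bar>" for z'
    using mult_left_mono[OF g(1), of "\<bar>c z'\<bar>" z'] by (simp add: 0 abs_mult)
  show ?thesis
    using c unfolding D01_cont_at_def by (meson le le_less_trans)
qed (intro D01_cont_at_mult c g(2))

text \<open>The mapping theorem and the passage from \<open>F (Y n)\<close> to the statistic
  \<open>W n\<close> in one argument. Testing with continuous steps suffices for weak convergence on
  the line, and their uniform continuity is what turns closeness of \<open>W n\<close> and
  \<open>F (Y n)\<close> into closeness of expectations.\<close>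

lemma converges_in_law_by_cutoff:
  fixes cut :: "nat \<Rightarrow> (real \<Rightarrow> real) \<Rightarrow> real"
  assumes M: "prob_space M" and N: "prob_space N" and conv: "converges_weakly_D01 M Y N Z"
    and Wm [measurable]: "\<And>n. W n \<in> borel_measurable M" and Fm: "D01_measurable F"
    and cut_meas: "\<And>j. cut j \<in> borel_measurable D01_ball_sigma"
    and cut_bounds: "\<And>j z. z \<in> mspace D01 \<Longrightarrow> 0 \<le> cut j z \<and> cut j z \<le> 1"
    and cut_cont: "\<And>j z. z \<in> mspace D01 \<Longrightarrow> D01_cont_at (cut j) z"
    and Fc: "\<And>j z. z \<in> mspace D01 \<Longrightarrow> cut j z > 0 \<Longrightarrow> D01_cont_at F z"
    and lim: "AE w in N. (\<lambda>j. cut j (Z w)) \<longlonglongrightarrow> 1"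
    and near: "\<And>j e. e > 0 \<Longrightarrow> eventually (\<lambda>n. \<forall>w\<in>space M. cut j (Y n w) > 0 \<longrightarrow> \<bar>W n w - F (Y n w)\<bar> < e) sequentially"
  shows "converges_in_law M W N (\<lambda>w. F (Z w))"
proof -
  interpret M: prob_space M by fact
  interpret N: prob_space N by fact
  have Ym: "Y n \<in> measurable M D01_ball_sigma" for n using conv unfolding converges_weakly_D01_def by auto
  have Zm: "Z \<in> measurable N D01_ball_sigma" using conv unfolding converges_weakly_D01_def by auto
  have Yin: "Y n w \<in> mspace D01" if "w \<in> space M" for n w using measurable_space[OF Ym that] by simp
  have Zin: "Z w \<in> mspace D01" if "w \<in> space N" for w using measurable_space[OF Zm that] by simp
  note [measurable] = measurable_compose[OF Zm Fm] measurable_compose[OF Ym Fm]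
    measurable_compose[OF Zm cut_meas] measurable_compose[OF Ym cut_meas]
  have weak: "(\<lambda>n. \<integral>w. f (Y n w) \<partial>M) \<longlonglongrightarrow> (\<integral>w. f (Z w) \<partial>N)"
    if "\<And>z. z \<in> mspace D01 \<Longrightarrow> D01_cont_at f z" "\<And>z. z \<in> mspace D01 \<Longrightarrow> 0 \<le> f z \<and> f z \<le> 1" "D01_measurable f"
    for f :: "(real \<Rightarrow> real) \<Rightarrow> real"
  proof -
    have "bounded (f ` mspace D01)" unfolding bounded_iff using that(2) by (intro exI[of _ 1]) auto
    then show ?thesis
      using conv D01_continuous_mapI[OF that(1)] that(3) unfolding converges_weakly_D01_def by blast
  qed
  have "weak_conv_m (\<lambda>n. distr M borel (W n)) (distr N borel (\<lambda>w. F (Z w)))"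
  proof (rule integral_cts_step_conv_imp_weak_conv)
    show "real_distribution (distr M borel (W n))" for n
      by (rule M.real_distribution_distr) measurable
    show "real_distribution (distr N borel (\<lambda>w. F (Z w)))"
      by (rule N.real_distribution_distr) measurable
    fix x y :: real assume xy: "x < y"
    let ?\<phi> = "cts_step x y"
    have uc: "uniformly_continuous_on UNIV ?\<phi>" by (rule cts_step_uniformly_continuous[OF xy])
    then have cont: "isCont ?\<phi> t" for t
      using uniformly_continuous_imp_continuous[OF uc] by (simp add: continuous_on_eq_continuous_at)
    have [measurable]: "?\<phi> \<in> borel_measurable borel"
      by (rule borel_measurable_continuous_onI[OF uniformly_continuous_imp_continuous[OF uc]])
    have \<phi>b: "0 \<le> ?\<phi> t \<and> ?\<phi> t \<le> 1" for t using xy by (auto simp: cts_step_def)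
    have "(\<lambda>n. \<integral>w. ?\<phi> (W n w) \<partial>M) \<longlonglongrightarrow> (\<integral>w. ?\<phi> (F (Z w)) \<partial>N)"
    proof (rule LIMSEQ_I)
      fix r :: real assume r: "r > 0"
      \<comment> \<open>The total error stays below \<open>4 * e\<close>: less than
        \<open>2 * e\<close> on the sample side (missing mass and closeness), \<open>e\<close> from
        weak convergence and \<open>e\<close> from the missing mass in the limit.\<close>
      define e where "e = r / 6"
      have e: "e > 0" using r by (simp add: e_def)
      have "(\<lambda>j. \<integral>w. cut j (Z w) \<partial>N) \<longlonglongrightarrow> (\<integral>w. 1 \<partial>N)"
        by (rule integral_dominated_convergence[where w="\<lambda>_. 1"])
          (use lim cut_bounds[OF Zin] in \<open>auto intro!: AE_I2\<close>)
      then have "eventually (\<lambda>j. 1 - e < (\<integral>w. cut j (Z w) \<partial>N)) sequentially"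
        using e by (intro order_tendstoD) (auto simp: N.prob_space)
      then obtain j where j: "1 - e < (\<integral>w. cut j (Z w) \<partial>N)"
        by (auto simp: eventually_sequentially)
      let ?f = "\<lambda>z. cut j z * ?\<phi> (F z)"
      \<comment> \<open>The cutoff is tested too: this transfers the small missing mass from
        \<open>Z\<close> to \<open>Y n\<close> for large \<open>n\<close>.\<close>
      have L1: "(\<lambda>n. \<integral>w. cut j (Y n w) \<partial>M) \<longlonglongrightarrow> (\<integral>w. cut j (Z w) \<partial>N)"
        by (rule weak[OF cut_cont cut_bounds cut_meas])
      have L2: "(\<lambda>n. \<integral>w. ?f (Y n w) \<partial>M) \<longlonglongrightarrow> (\<integral>w. ?f (Z w) \<partial>N)"
      proof (rule weak)
        show "D01_cont_at ?f z" if z: "z \<in> mspace D01" for z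
          by (rule D01_cont_at_cutoff_mult[OF cut_cont _ z])
            (use z cut_bounds \<phi>b in \<open>auto intro!: D01_cont_at_compose[OF Fc cont]\<close>)
        show "D01_measurable ?f"
          by (intro borel_measurable_times cut_meas measurable_compose[OF Fm]) measurable
        show "0 \<le> ?f z \<and> ?f z \<le> 1" if "z \<in> mspace D01" for z
          using cut_bounds[OF that, of j] \<phi>b[of "F z"] by (auto intro!: mult_le_one)
      qed
      \<comment> \<open>A single \<open>s\<close> for all values, as nothing bounds
        \<open>F (Y n)\<close>.\<close>
      obtain s where s: "s > 0" "\<And>t t'. \<bar>t' - t\<bar> < s \<Longrightarrow> \<bar>?\<phi> t' - ?\<phi> t\<bar> < e"
        using uc e unfolding uniformly_continuous_on_def dist_real_def by blast
      have Zb: "\<bar>(\<integral>w. ?\<phi> (F (Z w)) \<partial>N) - (\<integral>w. ?f (Z w) \<partial>N)\<bar> \<le> 1 - (\<integral>w. cut j (Z w) \<partial>N) + 0"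
        by (rule N.expectation_cutoff_le) (use cut_bounds[OF Zin] \<phi>b in \<open>simp_all only: diff_self abs_zero order_refl\<close>, measurable)
      have Yb: "\<bar>(\<integral>w. ?\<phi> (W n w) \<partial>M) - (\<integral>w. ?f (Y n w) \<partial>M)\<bar> \<le> 1 - (\<integral>w. cut j (Y n w) \<partial>M) + e"
        if nr: "\<forall>w\<in>space M. cut j (Y n w) > 0 \<longrightarrow> \<bar>W n w - F (Y n w)\<bar> < s" for n
      proof (rule M.expectation_cutoff_le)
        show "\<bar>?\<phi> (W n w) - ?\<phi> (F (Y n w))\<bar> \<le> e" if "w \<in> space M" "0 < cut j (Y n w)" for w
          using s(2)[of "W n w" "F (Y n w)"] nr that by fastforce
      qed (use cut_bounds[OF Yin] \<phi>b e in \<open>simp_all only: less_imp_le\<close>, measurable)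
      have "eventually (\<lambda>n. 1 - e < (\<integral>w. cut j (Y n w) \<partial>M)) sequentially"
        by (rule order_tendstoD(1)[OF L1 j])
      moreover have "eventually (\<lambda>n. dist (\<integral>w. ?f (Y n w) \<partial>M) (\<integral>w. ?f (Z w) \<partial>N) < e) sequentially"
        by (rule tendstoD[OF L2 e])
      moreover note near[OF s(1), of j]
      ultimately have "eventually (\<lambda>n. norm ((\<integral>w. ?\<phi> (W n w) \<partial>M) - (\<integral>w. ?\<phi> (F (Z w)) \<partial>N)) < r) sequentially"
      proof eventually_elim
        case (elim n)
        show ?case using Yb[OF elim(3)] Zb j elim(1,2) e unfolding dist_real_def e_def real_norm_def by linarith
      qed
      then show "\<exists>no. \<forall>n\<ge>no. norm ((\<integral>w. ?\<phi> (W n w) \<partial>M) - (\<integral>w. ?\<phi> (F (Z w)) \<partial>N)) < r"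
        unfolding eventually_sequentially .
    qed
    then show "(\<lambda>n. integral\<^sup>L (distr M borel (W n)) ?\<phi>) \<longlonglongrightarrow> integral\<^sup>L (distr N borel (\<lambda>w. F (Z w))) ?\<phi>"
      by (simp add: integral_distr)
  qed
  then show ?thesis unfolding converges_in_law_def by auto
qed

section \<open>The statistics as functionals of the sample path\<close>

lemma borel_measurable_floor_step [measurable]:
  fixes g :: "nat \<Rightarrow> real"
  shows "(\<lambda>u::real. g (nat \<lfloor>c * u\<rfloor>)) \<in> borel_measurable borel"
proof -
  have "(\<lambda>u. nat \<lfloor>c * u\<rfloor>) \<in> measurable borel (count_space UNIV)" by measurable
  then show ?thesis by (rule measurable_compose) simp
qed

lemma real_nat_floor_bounds:
  assumes "0 \<le> x"
  shows "real (nat \<lfloor>x\<rfloor>) \<le> x" "x < real (nat \<lfloor>x\<rfloor>) + 1"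
  using assms by (simp_all add: of_nat_nat)

lemma abs_diff_le_add:
  fixes a b A B :: real
  assumes "\<bar>a\<bar> \<le> A" "\<bar>b\<bar> \<le> B" "A + B \<le> C"
  shows "\<bar>a - b\<bar> \<le> C"
  using assms by linarith

text \<open>The zeros of \<open>g\<close> remove the two incomplete cells at the ends, so the Riemann sum is exact.\<close>

lemma set_integral_floor_step:
  fixes g :: "nat \<Rightarrow> real"
  assumes n: "n \<ge> 1" and ab: "0 \<le> a" "a \<le> b"
    and g0: "g (floor_nat n a) = 0" "g (floor_nat n b) = 0"
  shows "(LINT u:{a..b}|lborel. g (floor_nat n u)) = 1 / real n * (\<Sum>j\<in>{floor_nat n a..<floor_nat n b}. g j)"
proof -
  let ?ka = "floor_nat n a" and ?kb = "floor_nat n b"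
  define J where "J j = {real j / real n..<(real j + 1) / real n}" for j
  have J: "u \<in> J j \<longleftrightarrow> j = floor_nat n u" if "0 \<le> u" for u j
  proof -
    have "u \<in> J j \<longleftrightarrow> real j \<le> real n * u \<and> real n * u < real j + 1"
      using n by (simp add: J_def divide_simps mult.commute)
    also have "\<dots> \<longleftrightarrow> \<lfloor>real n * u\<rfloor> = int j" by (simp add: floor_eq_iff)
    also have "\<dots> \<longleftrightarrow> j = floor_nat n u" using that by auto
    finally show ?thesis .
  qed
  \<comment> \<open>For negative \<open>u\<close> the function \<open>nat\<close> returns index 0
    although \<open>u\<close> lies in no cell, so this case is kept apart.\<close>
  have J': "u \<notin> J j" if "u < 0" for u j
  proof -
    have "0 \<le> real j / real n" by simp
    then show ?thesis using that unfolding J_def atLeastLessThan_iff by linarith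
  qed
  have sJ: "J j \<in> sets borel" for j by (simp add: J_def)
  have eJ: "emeasure lborel (J j) = ennreal (1 / real n)" for j
    using n by (simp add: J_def divide_right_mono diff_divide_distrib[symmetric])
  have mono: "floor_nat n u \<le> floor_nat n v" if "u \<le> v" for u v
    using that by (intro nat_mono floor_mono mult_left_mono) auto
  have "indicator {a..b} u *\<^sub>R g (floor_nat n u) = (\<Sum>j\<in>{?ka..<?kb}. g j * indicator (J j) u)" for u
  proof (cases "u < 0")
    case True
    then show ?thesis using ab J' by (auto simp: indicator_def)
  next
    case False
    then have "(\<Sum>j\<in>{?ka..<?kb}. g j * indicator (J j) u) = (\<Sum>j\<in>{?ka..<?kb}. if j = floor_nat n u then g j else 0)"
      by (intro sum.cong) (auto simp: indicator_def J)
    also have "\<dots> = (if floor_nat n u \<in> {?ka..<?kb} then g (floor_nat n u) else 0)"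
      by (simp add: sum.delta)
    also have "\<dots> = indicator {a..b} u *\<^sub>R g (floor_nat n u)"
    proof -
      consider "u < a" | "u \<in> {a..b}" | "b < u" by fastforce
      then show ?thesis
      proof cases
        case 1
        then have "floor_nat n u \<le> ?ka" by (intro mono) auto
        then have "floor_nat n u \<in> {?ka..<?kb} \<Longrightarrow> floor_nat n u = ?ka" by auto
        then show ?thesis using g0 1 by auto
      next
        case 2
        then have "?ka \<le> floor_nat n u" "floor_nat n u \<le> ?kb" by (auto intro: mono)
        then have "floor_nat n u \<notin> {?ka..<?kb} \<Longrightarrow> floor_nat n u = ?kb" by auto
        then show ?thesis using g0 2 by auto
      next
        case 3
        then have "?kb \<le> floor_nat n u" by (intro mono) auto
        then have "floor_nat n u \<notin> {?ka..<?kb}" by (meson atLeastLessThan_iff not_le)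
        then show ?thesis using 3 by (simp del: atLeastLessThan_iff)
      qed
    qed
    finally show ?thesis by simp
  qed
  then have "(LINT u:{a..b}|lborel. g (floor_nat n u)) = (\<integral>u. (\<Sum>j\<in>{?ka..<?kb}. g j * indicator (J j) u) \<partial>lborel)"
    unfolding set_lebesgue_integral_def by simp
  also have "\<dots> = (\<Sum>j\<in>{?ka..<?kb}. \<integral>u. g j * indicator (J j) u \<partial>lborel)"
    by (rule Bochner_Integration.integral_sum) (intro integrable_mult_right integrable_real_indicator, auto simp: eJ sJ)
  also have "\<dots> = (\<Sum>j\<in>{?ka..<?kb}. g j * (1 / real n))"
    by (intro sum.cong) (auto simp: measure_def eJ sJ)
  finally show ?thesis by (simp add: sum_distrib_left mult.commute)
qed

text \<open>The square term has \<open>(n/m)^2\<close> and one cell length \<open>1/n\<close>, the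
  squared mean term \<open>(n/m)^3\<close> and two cell lengths. Both leave one factor
  \<open>n\<close>, which is common to numerator and denominator of every statistic.\<close>

lemma vfun_floor_step:
  fixes g :: "nat \<Rightarrow> real"
  assumes n: "n \<ge> 1" and ab: "0 \<le> a" "a \<le> b"
    and g0: "g (floor_nat n a) = 0" "g (floor_nat n b) = 0" and m: "m > 0"
  shows "vfun (real n / m) {a..b} (\<lambda>u. g (floor_nat n u)) =
     real n * (1 / m\<^sup>2 * (\<Sum>j\<in>{floor_nat n a..<floor_nat n b}. (g j)\<^sup>2)
       - 1 / m ^ 3 * (\<Sum>j\<in>{floor_nat n a..<floor_nat n b}. g j)\<^sup>2)"
proof -
  have "(LINT u:{a..b}|lborel. (g (floor_nat n u))\<^sup>2) = 1 / real n * (\<Sum>j\<in>{floor_nat n a..<floor_nat n b}. (g j)\<^sup>2)"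
    using set_integral_floor_step[OF n ab, of "\<lambda>j. (g j)\<^sup>2"] g0 by simp
  then show ?thesis
    unfolding vfun_def set_integral_floor_step[OF n ab g0] using n m
    by (simp add: power2_eq_square power3_eq_cube field_simps)
qed

lemma inverse_powr_three_halves_square:
  fixes m x :: real
  assumes "m > 0"
  shows "(1 / m powr (3/2) * x)\<^sup>2 = 1 / m ^ 3 * x\<^sup>2"
proof -
  have "(m powr (3/2))\<^sup>2 = m powr (3/2 + 3/2)" unfolding power2_eq_square powr_add ..
  also have "\<dots> = m ^ 3" using assms powr_realpow[of m 3] by simp
  finally show ?thesis by (simp add: power_mult_distrib power_divide)
qed

lemma S_star_eq: "m \<le> n \<Longrightarrow> S_star x n m = S_sum x n - S_sum x (n - m)"
proof -
  assume m: "m \<le> n"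
  have "{1..n} = {1..n-m} \<union> {n-m+1..n}" using m by auto
  then have "S_sum x n = S_sum x (n - m) + S_star x n m"
    unfolding S_sum_def S_star_def by (simp add: sum.union_disjoint)
  then show ?thesis by simp
qed

text \<open>An exact identity: in the bridge \<open>S_j - (j/k) * S_k\<close> the drift
  \<open>j * A\<close> cancels, and the bridge vanishes at 0 and \<open>k\<close>.\<close>

lemma V_stat_eq_vfun:
  fixes x :: "nat \<Rightarrow> real" and s A :: real
  assumes n: "n \<ge> 1" and s: "s > 0" and t: "0 \<le> t" and k: "floor_nat n t = k" "k \<ge> 1"
  defines "y \<equiv> \<lambda>j. s * (S_sum x j - real j * A)"
  shows "real n * s\<^sup>2 * V_stat x k = vfun (real n / real k) {0..t} (\<lambda>u. y (floor_nat n u) - real (floor_nat n u) / real k * y k)"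
proof -
  define g where "g j = y j - real j / real k * y k" for j
  have k0: "real k > 0" using k by simp
  have y0: "y 0 = 0" by (simp add: y_def S_sum_def)
  have g0: "g 0 = 0" "g k = 0" using k0 by (auto simp: g_def y0)
  have e: "S_sum x j - real j / real k * S_sum x k = g j / s" for j
    using k0 s by (simp add: g_def y_def field_simps)
  \<comment> \<open>The statistic sums over \<open>1..k\<close>, the cells of the step function are
    numbered \<open>0..<k\<close>; the zeros at both ends make up for the shift.\<close>
  have sums: "(\<Sum>j=1..k. f (g j)) = (\<Sum>j\<in>{0..<k}. f (g j))" if "f 0 = 0" for f :: "real \<Rightarrow> real"
  proof -
    have "(\<Sum>j=1..k. f (g j)) = (\<Sum>j=0..k. f (g j))"
      using g0 that by (simp add: sum.atLeast_Suc_atMost)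
    also have "\<dots> = (\<Sum>j\<in>{0..<k}. f (g j))"
      using g0 that by (simp add: atLeast0AtMost atLeast0LessThan lessThan_Suc_atMost[symmetric])
    finally show ?thesis .
  qed
  have "s\<^sup>2 * V_stat x k = 1 / (real k)\<^sup>2 * (\<Sum>j\<in>{0..<k}. (g j)\<^sup>2) - 1 / real k ^ 3 * (\<Sum>j\<in>{0..<k}. g j)\<^sup>2"
    unfolding V_stat_def e inverse_powr_three_halves_square[OF k0]
    using sums[of "\<lambda>x. x\<^sup>2"] sums[of "\<lambda>x. x"] s
    by (simp add: power_divide sum_divide_distrib[symmetric] field_simps)
  then have "real n * s\<^sup>2 * V_stat x k = real n * (1 / (real k)\<^sup>2 * (\<Sum>j\<in>{0..<k}. (g j)\<^sup>2) - 1 / real k ^ 3 * (\<Sum>j\<in>{0..<k}. g j)\<^sup>2)"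
    by (simp add: mult.assoc)
  also have "\<dots> = vfun (real n / real k) {0..t} (\<lambda>u. g (floor_nat n u))"
    using vfun_floor_step[OF n _ t, of g "real k"] g0 k k0 by simp
  finally show ?thesis by (simp add: g_def)
qed

lemma V_star_eq_vfun:
  fixes x :: "nat \<Rightarrow> real" and s A :: real
  assumes n: "n \<ge> 1" and s: "s > 0" and t: "0 \<le> t" "t \<le> 1" and k: "floor_nat n t = k" "k < n"
  defines "y \<equiv> \<lambda>j. s * (S_sum x j - real j * A)"
  shows "real n * s\<^sup>2 * V_star x n k = vfun (real n / (real n - real k)) {t..1}
     (\<lambda>u. y n - y (floor_nat n u) - (real n - real (floor_nat n u)) / (real n - real k) * (y n - y k))"
proof -
  define g where "g j = y n - y j - (real n - real j) / (real n - real k) * (y n - y k)" for j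
  have k0: "real n - real k > 0" using k by simp
  have nk: "real (n - k) = real n - real k" using k by auto
  have g0: "g k = 0" "g n = 0" using k0 by (auto simp: g_def)
  \<comment> \<open>The last \<open>n - j + 1\<close> terms add up to \<open>S_n - S_(j-1)\<close>,
    hence the shift to \<open>j - 1\<close>, which turns \<open>k+1..n\<close> into the cells
    \<open>k..<n\<close>.\<close>
  have e: "S_star x n (n-j+1) - real (n-j+1) / real (n-k) * S_star x n (n-k) = g (j - 1) / s"
    if "j \<in> {k+1..n}" for j
  proof -
    have j: "n - j + 1 \<le> n" "n - (n - j + 1) = j - 1" "n - (n - k) = k" "real (n-j+1) = real n - real (j - 1)"
      using that k by auto
    show ?thesis
      unfolding S_star_eq[OF j(1)] S_star_eq[OF diff_le_self] j(2-4) nk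
      using k0 s by (simp add: g_def y_def field_simps)
  qed
  have sums: "(\<Sum>j=k+1..n. f (j - 1)) = (\<Sum>j\<in>{k..<n}. f j)" for f :: "nat \<Rightarrow> real"
    by (rule sum.reindex_bij_witness[of _ Suc "\<lambda>j. j - 1"]) auto
  have "(\<Sum>j=k+1..n. (S_star x n (n-j+1) - real (n-j+1) / real (n-k) * S_star x n (n-k))\<^sup>2) = (\<Sum>j=k+1..n. (g (j - 1) / s)\<^sup>2)"
    by (rule sum.cong[OF refl]) (simp only: e)
  also have "\<dots> = 1 / s\<^sup>2 * (\<Sum>j\<in>{k..<n}. (g j)\<^sup>2)"
    unfolding sums[of "\<lambda>j. (g j / s)\<^sup>2"] by (simp add: power_divide sum_divide_distrib)
  finally have E1: "(\<Sum>j=k+1..n. (S_star x n (n-j+1) - real (n-j+1) / real (n-k) * S_star x n (n-k))\<^sup>2)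
      = 1 / s\<^sup>2 * (\<Sum>j\<in>{k..<n}. (g j)\<^sup>2)" .
  have "(\<Sum>j=k+1..n. S_star x n (n-j+1) - real (n-j+1) / real (n-k) * S_star x n (n-k)) = (\<Sum>j=k+1..n. g (j - 1) / s)"
    by (rule sum.cong[OF refl]) (simp only: e)
  also have "\<dots> = 1 / s * (\<Sum>j\<in>{k..<n}. g j)"
    unfolding sums[of "\<lambda>j. g j / s"] by (simp add: sum_divide_distrib)
  finally have E2: "(\<Sum>j=k+1..n. S_star x n (n-j+1) - real (n-j+1) / real (n-k) * S_star x n (n-k))
      = 1 / s * (\<Sum>j\<in>{k..<n}. g j)" .
  have "s\<^sup>2 * V_star x n k = 1 / (real n - real k)\<^sup>2 * (\<Sum>j\<in>{k..<n}. (g j)\<^sup>2) - 1 / (real n - real k) ^ 3 * (\<Sum>j\<in>{k..<n}. g j)\<^sup>2"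
    unfolding V_star_def E1 E2 unfolding nk inverse_powr_three_halves_square[OF k0] using s
    by (simp add: power_divide right_diff_distrib)
  then have "real n * s\<^sup>2 * V_star x n k = real n * (1 / (real n - real k)\<^sup>2 * (\<Sum>j\<in>{k..<n}. (g j)\<^sup>2) - 1 / (real n - real k) ^ 3 * (\<Sum>j\<in>{k..<n}. g j)\<^sup>2)"
    by (simp add: mult.assoc)
  also have "\<dots> = vfun (real n / (real n - real k)) {t..1} (\<lambda>u. g (floor_nat n u))"
    using vfun_floor_step[OF n t, of g "real n - real k"] g0 k k0 by simp
  finally show ?thesis by (simp add: g_def)
qed

lemma set_integral_reflect:
  fixes f :: "real \<Rightarrow> real"
  shows "(LINT u:{0..1 - t}|lborel. f u) = (LINT v:{t..1}|lborel. f (1 - v))"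
proof -
  have "indicator {0..1 - t} (1 - v) = (indicator {t..1} v :: real)" for v by (auto simp: indicator_def)
  then show ?thesis
    unfolding set_lebesgue_integral_def
    by (subst lborel_integral_real_affine[of "-1" _ 1]) simp_all
qed

text \<open>Undoes the time reversal, so that the limit is an integral over \<open>{t..1}\<close>,
  the interval on which \<open>V_star\<close> is one.\<close>

lemma Q_fun_star_eq_vfun:
  "Q_star t z = vfun (1 / (1 - t)) {t..1} (\<lambda>v. z 1 - z v - (1 - v) / (1 - t) * (z 1 - z t))"
  unfolding Q_fun_eq_vfun vfun_def set_integral_reflect by (simp add: path_star_def)

text \<open>Numerator and denominator are rounded in the same direction, down for
  \<open>V_stat\<close> and up for \<open>V_star\<close>. Over the common denominator
  \<open>l * m\<close> the two errors \<open>p\<close> and \<open>q\<close> then have the same sign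
  and size at most \<open>l\<close>, so their difference is at most \<open>l\<close> as
  well.\<close>

lemma rounded_ratio_close:
  fixes a m l n x :: real
  assumes pos: "0 < m" "0 < l" "0 \<le> x" "x \<le> l"
    and r: "(a \<le> n * x \<and> n * x \<le> a + 1 \<and> m \<le> n * l \<and> n * l \<le> m + 1) \<or>
      (n * x \<le> a \<and> a \<le> n * x + 1 \<and> n * l \<le> m \<and> m \<le> n * l + 1)"
  shows "\<bar>a / m - x / l\<bar> \<le> 1 / m"
proof -
  define p q where "p = (a - n * x) * l" and "q = x * (m - n * l)"
  have bnd: "0 \<le> y * z \<and> y * z \<le> l" if "0 \<le> y" "y \<le> 1" "0 \<le> z" "z \<le> l" for y z :: real
    using mult_mono[OF that(2,4)] that by auto
  have "\<bar>p - q\<bar> \<le> l"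
    using r
  proof
    assume "a \<le> n * x \<and> n * x \<le> a + 1 \<and> m \<le> n * l \<and> n * l \<le> m + 1"
    then have "0 \<le> - p \<and> - p \<le> l" "0 \<le> - q \<and> - q \<le> l"
      using bnd[of "n * x - a" l] bnd[of "n * l - m" x] pos by (simp_all add: p_def q_def algebra_simps)
    then show ?thesis by linarith
  next
    assume "n * x \<le> a \<and> a \<le> n * x + 1 \<and> n * l \<le> m \<and> m \<le> n * l + 1"
    then have "0 \<le> p \<and> p \<le> l" "0 \<le> q \<and> q \<le> l"
      using bnd[of "a - n * x" l] bnd[of "m - n * l" x] pos by (simp_all add: p_def q_def algebra_simps)
    then show ?thesis by linarith
  qed
  then have "\<bar>p - q\<bar> / (l * m) \<le> l / (l * m)" using pos by (intro divide_right_mono) auto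
  moreover have "a / m - x / l = (p - q) / (l * m)"
    using pos unfolding p_def q_def by (simp add: field_simps)
  ultimately show ?thesis using pos by (simp add: abs_divide abs_mult)
qed

text \<open>Shared by both statistics. The bound \<open>4 * K\<close> is dictated by the reversed
  one, where \<open>y n - y j\<close> may reach \<open>2 * K\<close> and the trend another
  \<open>2 * K\<close>. Since \<open>n * l\<close> and \<open>m\<close> differ by at most 1, the
  factors \<open>n / m\<close> and \<open>1 / l\<close> differ by \<open>O(1/n)\<close>. The
  constant is \<open>5 * 4^2 * 3\<close>.\<close>

lemma vfun_rounded_close:
  fixes h h' :: "real \<Rightarrow> real"
  assumes m: "h \<in> borel_measurable borel" "h' \<in> borel_measurable borel"
    and h: "\<And>u. u \<in> {a..b} \<Longrightarrow> \<bar>h u\<bar> \<le> 4 * K" "\<And>u. u \<in> {a..b} \<Longrightarrow> \<bar>h' u\<bar> \<le> 4 * K"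
      "\<And>u. u \<in> {a..b} \<Longrightarrow> \<bar>h u - h' u\<bar> \<le> 1 / m * (2 * K)"
    and ab: "a \<le> b" "b - a \<le> 1" and K: "1 \<le> K" and L: "1 \<le> L" "n / m \<le> L" "1 / l \<le> L"
    and pos: "0 < n" "0 < m" "0 < l" and nl: "\<bar>n * l - m\<bar> \<le> 1"
  shows "\<bar>vfun (n / m) {a..b} h - vfun (1 / l) {a..b} h'\<bar> \<le> 240 * L ^ 5 * K ^ 3 / n"
proof -
  have inv_m: "1 / m \<le> L / n" using L(2) pos by (simp add: field_simps)
  have "\<bar>vfun (n / m) {a..b} h - vfun (1 / l) {a..b} h'\<bar> \<le> 5 * L ^ 3 * (4 * K)\<^sup>2 * (L / n * (2 * K) + L * (L / n))"
  proof (rule vfun_lipschitz[OF m h(1,2)])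
    show "\<bar>h u - h' u\<bar> \<le> L / n * (2 * K)" if "u \<in> {a..b}" for u
      using h(3)[OF that] mult_right_mono[OF inv_m, of "2 * K"] K by linarith
    have "n / m - 1 / l = (n * l - m) / (l * m)" using pos by (simp add: divide_simps)
    then have "\<bar>n / m - 1 / l\<bar> \<le> 1 / (l * m)"
      using pos nl by (simp add: abs_divide abs_mult divide_right_mono)
    also have "\<dots> = (1 / l) * (1 / m)" by simp
    also have "\<dots> \<le> L * (L / n)" using L inv_m pos by (intro mult_mono) auto
    finally show "\<bar>n / m - 1 / l\<bar> \<le> L * (L / n)" .
  qed (use L K ab pos in auto)
  also have "\<dots> = 80 * L ^ 4 * K\<^sup>2 * (2 * K + L) / n"
    by (simp add: power_mult_distrib field_simps power_numeral_reduce add_divide_distrib)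
  also have "\<dots> \<le> 80 * L ^ 4 * K\<^sup>2 * (3 * K * L) / n"
  proof -
    have "2 * K + L \<le> 3 * K * L" using mult_right_mono[of 1 K L] mult_left_mono[of 1 L K] K L(1) by linarith
    then show ?thesis using L(1) pos by (intro divide_right_mono mult_left_mono) auto
  qed
  also have "\<dots> = 240 * L ^ 5 * K ^ 3 / n" by (simp add: power_numeral_reduce)
  finally show ?thesis .
qed

lemma V_stat_close:
  fixes x :: "nat \<Rightarrow> real" and s A K L :: real
  assumes n: "n \<ge> 1" and s: "s > 0" and t: "0 < t" "t \<le> 1" and k: "floor_nat n t \<ge> 1"
    and K: "\<And>j. j \<le> n \<Longrightarrow> \<bar>s * (S_sum x j - real j * A)\<bar> \<le> K" "1 \<le> K"
    and L: "1 \<le> L" "real n / real (floor_nat n t) \<le> L" "1 / t \<le> L"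
  shows "\<bar>real n * s\<^sup>2 * V_stat x (floor_nat n t) - Q_fun t (\<lambda>u. s * (S_sum x (floor_nat n u) - real (floor_nat n u) * A))\<bar>
     \<le> 240 * L ^ 5 * K ^ 3 / real n"
proof -
  define y where "y j = s * (S_sum x j - real j * A)" for j
  define k where "k = floor_nat n t"
  have k1: "k \<ge> 1" using k by (simp only: k_def)
  have k0: "real k > 0" using k1 by simp
  have n0: "real n > 0" using n by simp
  have kt: "real k \<le> real n * t" "real n * t < real k + 1"
    using t n0 unfolding k_def by (intro real_nat_floor_bounds; simp)+
  have kn: "k \<le> n"
    using kt(1) mult_left_mono[of t 1 "real n"] t by linarith
  have "\<bar>vfun (real n / real k) {0..t} (\<lambda>u. y (floor_nat n u) - real (floor_nat n u) / real k * y k)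
      - vfun (1 / t) {0..t} (\<lambda>u. y (floor_nat n u) - u / t * y k)\<bar> \<le> 240 * L ^ 5 * K ^ 3 / real n"
  proof (rule vfun_rounded_close)
    fix u assume u: "u \<in> {0..t}"
    let ?j = "floor_nat n u"
    have jk: "?j \<le> k" unfolding k_def using u by (intro nat_mono floor_mono mult_left_mono) auto
    have j: "real ?j \<le> real n * u" "real n * u < real ?j + 1" using u by (auto intro!: real_nat_floor_bounds)
    have yj: "\<bar>y ?j\<bar> \<le> K" "\<bar>y k\<bar> \<le> K" using jk kn K(1) by (auto simp: y_def)
    have "\<bar>r * y k\<bar> \<le> 1 * K" if "0 \<le> r" "r \<le> 1" for r
      unfolding abs_mult using that yj by (intro mult_mono) auto
    then have le: "\<bar>y ?j - r * y k\<bar> \<le> 4 * K" if "0 \<le> r" "r \<le> 1" for r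
      by (rule abs_diff_le_add[OF yj(1)]) (use that K(2) in auto)
    show "\<bar>y ?j - real ?j / real k * y k\<bar> \<le> 4 * K" using jk k0 by (intro le) auto
    show "\<bar>y ?j - u / t * y k\<bar> \<le> 4 * K" using u t by (intro le) auto
    have b: "\<bar>real ?j / real k - u / t\<bar> \<le> 1 / real k"
      by (rule rounded_ratio_close[where n="real n"]) (use k0 t u j kt in auto)
    have "\<bar>(y ?j - real ?j / real k * y k) - (y ?j - u / t * y k)\<bar> = \<bar>real ?j / real k - u / t\<bar> * \<bar>y k\<bar>"
      unfolding abs_mult[symmetric] left_diff_distrib by (simp add: abs_minus_commute)
    also have "\<dots> \<le> 1 / real k * (2 * K)" using b yj by (intro mult_mono) auto
    finally show "\<bar>(y ?j - real ?j / real k * y k) - (y ?j - u / t * y k)\<bar> \<le> 1 / real k * (2 * K)" .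
  qed (use L K t n0 k0 kt in \<open>auto simp: k_def[symmetric]\<close>)
  moreover have "real n * s\<^sup>2 * V_stat x k = vfun (real n / real k) {0..t} (\<lambda>u. y (floor_nat n u) - real (floor_nat n u) / real k * y k)"
    unfolding y_def using n s t k1 by (intro V_stat_eq_vfun) (auto simp: k_def)
  moreover have "Q_fun t (\<lambda>u. s * (S_sum x (floor_nat n u) - real (floor_nat n u) * A)) = vfun (1 / t) {0..t} (\<lambda>u. y (floor_nat n u) - u / t * y k)"
    unfolding Q_fun_eq_vfun y_def k_def by simp
  ultimately show ?thesis unfolding k_def by simp
qed

text \<open>Rounding \<open>n * t\<close> down enlarges \<open>n - k\<close>, so
  \<open>1 / (1 - t)\<close> also bounds \<open>n / (n - k)\<close>. In the forward case the
  rounding goes the other way, and there \<open>n / k\<close> gets a bound of its own.\<close>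

lemma V_star_close:
  fixes x :: "nat \<Rightarrow> real" and s A K L :: real
  assumes n: "n \<ge> 1" and s: "s > 0" and t: "0 < t" "t < 1"
    and K: "\<And>j. j \<le> n \<Longrightarrow> \<bar>s * (S_sum x j - real j * A)\<bar> \<le> K" "1 \<le> K"
    and L: "1 \<le> L" "1 / (1 - t) \<le> L"
  shows "\<bar>real n * s\<^sup>2 * V_star x n (floor_nat n t)
      - Q_star t (\<lambda>u. s * (S_sum x (floor_nat n u) - real (floor_nat n u) * A))\<bar>
     \<le> 240 * L ^ 5 * K ^ 3 / real n"
proof -
  define y where "y j = s * (S_sum x j - real j * A)" for j
  define k where "k = floor_nat n t"
  have n0: "real n > 0" using n by simp
  have kt: "real k \<le> real n * t" "real n * t < real k + 1"
    using t n0 unfolding k_def by (intro real_nat_floor_bounds; simp)+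
  have kn: "k < n"
    using kt(1) mult_strict_left_mono[of t 1 "real n"] t n0 by linarith
  define m where "m = real n - real k"
  have m0: "m > 0" using kn by (simp add: m_def)
  have mt: "real n * (1 - t) \<le> m" "m \<le> real n * (1 - t) + 1" using kt by (auto simp: m_def algebra_simps)
  have t0: "0 < 1 - t" using t by simp
  have "real n / m \<le> real n / (real n * (1 - t))"
    using mt t0 n0 by (intro divide_left_mono mult_pos_pos m0) auto
  then have nm: "real n / m \<le> L" using L n0 by simp
  have "\<bar>vfun (real n / m) {t..1} (\<lambda>u. y n - y (floor_nat n u) - (real n - real (floor_nat n u)) / m * (y n - y k))
      - vfun (1 / (1 - t)) {t..1} (\<lambda>u. y n - y (floor_nat n u) - (1 - u) / (1 - t) * (y n - y k))\<bar>
      \<le> 240 * L ^ 5 * K ^ 3 / real n"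
  proof (rule vfun_rounded_close)
    fix u assume u: "u \<in> {t..1}"
    let ?j = "floor_nat n u"
    have kj: "k \<le> ?j" unfolding k_def using u by (intro nat_mono floor_mono mult_left_mono) auto
    have j: "real ?j \<le> real n * u" "real n * u < real ?j + 1" using u t by (auto intro!: real_nat_floor_bounds)
    have jn: "?j \<le> n"
      using j(1) mult_left_mono[of u 1 "real n"] u by auto
    have ynk: "\<bar>y n - y k\<bar> \<le> 2 * K" "\<bar>y n - y ?j\<bar> \<le> 2 * K"
      using K(1)[of n] K(1)[of k] K(1)[of ?j] kn jn by (auto simp: y_def)
    have "\<bar>r * (y n - y k)\<bar> \<le> 1 * (2 * K)" if "0 \<le> r" "r \<le> 1" for r
      unfolding abs_mult using that ynk by (intro mult_mono) auto
    then have le: "\<bar>y n - y ?j - r * (y n - y k)\<bar> \<le> 4 * K" if "0 \<le> r" "r \<le> 1" for r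
      by (rule abs_diff_le_add[OF ynk(2)]) (use that in auto)
    show "\<bar>y n - y ?j - (real n - real ?j) / m * (y n - y k)\<bar> \<le> 4 * K"
      using kj jn m0 by (intro le) (auto simp: m_def)
    show "\<bar>y n - y ?j - (1 - u) / (1 - t) * (y n - y k)\<bar> \<le> 4 * K"
      using u t by (intro le) auto
    have b: "\<bar>(real n - real ?j) / m - (1 - u) / (1 - t)\<bar> \<le> 1 / m"
      by (rule rounded_ratio_close[where n="real n"]) (use m0 t0 u j mt in \<open>auto simp: algebra_simps\<close>)
    have "\<bar>(y n - y ?j - (real n - real ?j) / m * (y n - y k)) - (y n - y ?j - (1 - u) / (1 - t) * (y n - y k))\<bar>
        = \<bar>(real n - real ?j) / m - (1 - u) / (1 - t)\<bar> * \<bar>y n - y k\<bar>"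
      unfolding abs_mult[symmetric] left_diff_distrib by (simp add: abs_minus_commute)
    also have "\<dots> \<le> 1 / m * (2 * K)" using b ynk m0 by (intro mult_mono) auto
    finally show "\<bar>(y n - y ?j - (real n - real ?j) / m * (y n - y k)) - (y n - y ?j - (1 - u) / (1 - t) * (y n - y k))\<bar> \<le> 1 / m * (2 * K)" .
  qed (use L K t n0 m0 mt nm in auto)
  moreover have "real n * s\<^sup>2 * V_star x n k = vfun (real n / m) {t..1} (\<lambda>u. y n - y (floor_nat n u) - (real n - real (floor_nat n u)) / m * (y n - y k))"
    unfolding y_def m_def using n s t kn by (intro V_star_eq_vfun) (auto simp: k_def)
  moreover have "Q_star t (\<lambda>u. s * (S_sum x (floor_nat n u) - real (floor_nat n u) * A))
     = vfun (1 / (1 - t)) {t..1} (\<lambda>u. y n - y (floor_nat n u) - (1 - u) / (1 - t) * (y n - y k))"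
    unfolding Q_fun_star_eq_vfun y_def k_def by simp
  ultimately show ?thesis unfolding k_def by simp
qed

section \<open>Small values of fractional Brownian motion\<close>

lemma step_fun_square:
  assumes t: "strict_mono t"
  shows "(step_fun m t c u)\<^sup>2 = (\<Sum>i<m. (c i)\<^sup>2 * indicator {t i<..t (Suc i)} u)"
proof -
  let ?I = "\<lambda>i. indicator {t i<..t (Suc i)} u :: real"
  have mono: "t i \<le> t j" if "i \<le> j" for i j
    using strict_mono_less_eq[OF t] that by blast
  have dis: "?I i * ?I j = (if i = j then ?I i else 0)" for i j
  proof (cases i j rule: linorder_cases)
    case less
    then have "t (Suc i) \<le> t j" by (intro mono) auto
    then show ?thesis using less by (auto simp: indicator_def)
  next
    case greater
    then have "t (Suc j) \<le> t i" by (intro mono) auto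
    then show ?thesis using greater by (auto simp: indicator_def)
  qed (auto simp: indicator_def)
  have "(step_fun m t c u)\<^sup>2 = (\<Sum>i<m. \<Sum>j<m. (c i * c j) * (?I i * ?I j))"
    unfolding step_fun_def power2_eq_square sum_product by (simp add: mult_ac)
  also have "\<dots> = (\<Sum>i<m. \<Sum>j<m. if i = j then (c i)\<^sup>2 * ?I i else 0)"
    unfolding dis by (intro sum.cong refl) (auto simp: power2_eq_square)
  also have "\<dots> = (\<Sum>i<m. (c i)\<^sup>2 * ?I i)" by (simp add: sum.delta)
  finally show ?thesis .
qed

lemma nn_integral_step_fun_square:
  assumes t: "strict_mono t"
  shows "(\<integral>\<^sup>+u. ennreal ((step_fun m t c u)\<^sup>2) \<partial>lborel) = ennreal (\<Sum>i<m. (c i)\<^sup>2 * (t (Suc i) - t i))"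
proof -
  have le: "t i \<le> t (Suc i)" for i using strict_mono_less_eq[OF t, of i "Suc i"] by simp
  have "(\<integral>\<^sup>+u. ennreal ((step_fun m t c u)\<^sup>2) \<partial>lborel)
      = (\<integral>\<^sup>+u. (\<Sum>i<m. ennreal ((c i)\<^sup>2) * indicator {t i<..t (Suc i)} u) \<partial>lborel)"
  proof (rule nn_integral_cong)
    fix u
    have "ennreal ((step_fun m t c u)\<^sup>2) = (\<Sum>i<m. ennreal ((c i)\<^sup>2 * indicator {t i<..t (Suc i)} u))"
      unfolding step_fun_square[OF t] by (rule sum_ennreal[symmetric]) simp
    also have "\<dots> = (\<Sum>i<m. ennreal ((c i)\<^sup>2) * indicator {t i<..t (Suc i)} u)"
      by (intro sum.cong refl) (simp add: indicator_def)
    finally show "ennreal ((step_fun m t c u)\<^sup>2) = (\<Sum>i<m. ennreal ((c i)\<^sup>2) * indicator {t i<..t (Suc i)} u)" .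
  qed
  also have "\<dots> = (\<Sum>i<m. \<integral>\<^sup>+u. ennreal ((c i)\<^sup>2) * indicator {t i<..t (Suc i)} u \<partial>lborel)"
    by (rule nn_integral_sum) measurable
  also have "\<dots> = (\<Sum>i<m. ennreal ((c i)\<^sup>2) * ennreal (t (Suc i) - t i))"
    using le by (intro sum.cong refl) (simp add: nn_integral_cmult_indicator)
  also have "\<dots> = ennreal (\<Sum>i<m. (c i)\<^sup>2 * (t (Suc i) - t i))"
    using le by (simp add: ennreal_mult[symmetric] sum_ennreal)
  finally show ?thesis .
qed

lemma step_integral_normal:
  fixes m :: nat and c :: "nat \<Rightarrow> real"
  assumes B: "two_sided_brownian_motion N B" and t: "strict_mono t"
  defines "v \<equiv> \<Sum>i<m. (c i)\<^sup>2 * (t (Suc i) - t i)"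
  assumes v: "v > 0"
  shows "distributed N lborel (step_integral B m t c) (normal_density 0 (sqrt v))"
proof -
  interpret prob_space N using B unfolding two_sided_brownian_motion_def by blast
  have lt: "t i < t (Suc i)" for i using strict_mono_less[OF t, of i "Suc i"] by simp
  \<comment> \<open>A summand with coefficient 0 has no density and must be dropped before normal
    laws are added; \<open>v > 0\<close> guarantees that a summand remains.\<close>
  define J where "J = {i \<in> {..<m}. c i \<noteq> 0}"
  have vJ: "v = (\<Sum>i\<in>J. (c i)\<^sup>2 * (t (Suc i) - t i))"
    unfolding v_def J_def by (rule sum.mono_neutral_cong_right) auto
  have J: "finite J" by (simp add: J_def)
  have J': "J \<noteq> {}"
  proof
    assume "J = {}"
    then show False using v vJ by simp
  qed
  have si: "step_integral B m t c = (\<lambda>w. \<Sum>i\<in>J. c i * (B (t (Suc i)) w - B (t i) w))"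
    unfolding step_integral_def J_def by (intro ext sum.mono_neutral_cong_right) auto
  have "indep_vars (\<lambda>_. borel) (\<lambda>i w. B (t (Suc i)) w - B (t i) w) {..<m}"
    using B t unfolding two_sided_brownian_motion_def by blast
  then have "indep_vars (\<lambda>_. borel) (\<lambda>i w. B (t (Suc i)) w - B (t i) w) J"
    by (rule indep_vars_subset) (auto simp: J_def)
  then have ind: "indep_vars (\<lambda>_. borel) (\<lambda>i w. c i * (B (t (Suc i)) w - B (t i) w)) J"
    by (rule indep_vars_compose2) simp
  have dist: "distributed N lborel (\<lambda>w. c i * (B (t (Suc i)) w - B (t i) w)) (normal_density 0 (\<bar>c i\<bar> * sqrt (t (Suc i) - t i)))"
    if "i \<in> J" for i
  proof -
    have "distributed N lborel (\<lambda>w. B (t (Suc i)) w - B (t i) w) (normal_density 0 (sqrt (t (Suc i) - t i)))"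
      using B lt unfolding two_sided_brownian_motion_def by blast
    from normal_density_affine[OF this, of "c i" 0] show ?thesis using that lt by (simp add: J_def)
  qed
  have "distributed N lborel (\<lambda>w. \<Sum>i\<in>J. c i * (B (t (Suc i)) w - B (t i) w))
      (normal_density (\<Sum>i\<in>J. 0) (sqrt (\<Sum>i\<in>J. (\<bar>c i\<bar> * sqrt (t (Suc i) - t i))\<^sup>2)))"
    by (rule sum_indep_normal[OF J J' ind _ dist]) (use lt in \<open>auto simp: J_def\<close>)
  moreover have "(\<Sum>i\<in>J. (\<bar>c i\<bar> * sqrt (t (Suc i) - t i))\<^sup>2) = v"
    unfolding vJ using lt by (intro sum.cong refl) (simp add: power_mult_distrib less_imp_le)
  ultimately show ?thesis unfolding si by simp
qed

section \<open>Normal laws and Wiener integrals: small balls and second moments\<close>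

lemma normal_density_le:
  assumes "\<sigma> > 0"
  shows "normal_density 0 \<sigma> x \<le> 1 / \<sigma>"
proof -
  have "\<sigma> \<le> sqrt (2 * pi * \<sigma>\<^sup>2)"
  proof (rule real_le_rsqrt)
    have "1 * \<sigma>\<^sup>2 \<le> 2 * pi * \<sigma>\<^sup>2" using pi_gt3 by (intro mult_right_mono) auto
    then show "\<sigma>\<^sup>2 \<le> 2 * pi * \<sigma>\<^sup>2" by simp
  qed
  then have "1 / sqrt (2 * pi * \<sigma>\<^sup>2) * exp (- (x - 0)\<^sup>2 / (2 * \<sigma>\<^sup>2)) \<le> 1 / \<sigma> * 1"
    using assms by (intro mult_mono divide_left_mono) (auto intro!: mult_pos_pos)
  then show ?thesis unfolding normal_density_def by simp
qed

lemma (in prob_space) normal_small_ball: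
  assumes X: "distributed M lborel X (normal_density 0 \<sigma>)" and \<sigma>: "\<sigma> > 0" and r: "r \<ge> 0"
  shows "emeasure M {w \<in> space M. \<bar>X w\<bar> \<le> r} \<le> ennreal (2 * r / \<sigma>)"
proof -
  have "{w \<in> space M. \<bar>X w\<bar> \<le> r} = X -` {-r..r} \<inter> space M" by auto
  then have "emeasure M {w \<in> space M. \<bar>X w\<bar> \<le> r} = (\<integral>\<^sup>+x. ennreal (normal_density 0 \<sigma> x) * indicator {-r..r} x \<partial>lborel)"
    using distributed_emeasure[OF X, of "{-r..r}"] by simp
  also have "\<dots> \<le> (\<integral>\<^sup>+x. ennreal (1 / \<sigma>) * indicator {-r..r} x \<partial>lborel)"
    by (intro nn_integral_mono mult_right_mono ennreal_leI normal_density_le \<sigma>) simp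
  also have "\<dots> = ennreal (1 / \<sigma>) * ennreal (2 * r)"
    using r by (simp add: nn_integral_cmult_indicator)
  also have "\<dots> = ennreal (2 * r / \<sigma>)" using r \<sigma> by (simp add: ennreal_mult[symmetric])
  finally show ?thesis .
qed

lemma (in prob_space) normal_second_moment:
  assumes X: "distributed M lborel X (normal_density 0 \<sigma>)" and \<sigma>: "\<sigma> > 0"
  shows "(\<integral>\<^sup>+w. ennreal ((X w)\<^sup>2) \<partial>M) = ennreal (\<sigma>\<^sup>2)"
proof -
  have "(\<integral>\<^sup>+w. ennreal ((X w)\<^sup>2) \<partial>M) = (\<integral>\<^sup>+x. ennreal (normal_density 0 \<sigma> x) * ennreal (x\<^sup>2) \<partial>lborel)"
    using distributed_nn_integral[OF X, of "\<lambda>x. ennreal (x\<^sup>2)"] by simp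
  also have "\<dots> = (\<integral>\<^sup>+x. ennreal (normal_density 0 \<sigma> x * x\<^sup>2) \<partial>lborel)"
    by (simp add: ennreal_mult)
  also have "\<dots> = ennreal (\<integral>x. normal_density 0 \<sigma> x * x\<^sup>2 \<partial>lborel)"
    using integrable_normal_moment[OF \<sigma>, of 0 2] by (intro nn_integral_eq_integral) auto
  also have "(\<integral>x. normal_density 0 \<sigma> x * x\<^sup>2 \<partial>lborel) = \<sigma>\<^sup>2"
    using integral_normal_moment_even[OF \<sigma>, of 0 1] \<sigma> by (simp add: fact_2)
  finally show ?thesis .
qed

text \<open>The Ito isometry on step functions, read off from the normal law. With variance 0 there
  is no density, but then all coefficients vanish.\<close>

lemma step_integral_second_moment:
  assumes B: "two_sided_brownian_motion N B" and t: "strict_mono t"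
  shows "(\<integral>\<^sup>+w. ennreal ((step_integral B m t c w)\<^sup>2) \<partial>N) = (\<integral>\<^sup>+u. ennreal ((step_fun m t c u)\<^sup>2) \<partial>lborel)"
proof -
  interpret prob_space N using B unfolding two_sided_brownian_motion_def by blast
  have lt: "t i < t (Suc i)" for i using strict_mono_less[OF t, of i "Suc i"] by simp
  define v where "v = (\<Sum>i<m. (c i)\<^sup>2 * (t (Suc i) - t i))"
  have v0: "v \<ge> 0" unfolding v_def using lt by (intro sum_nonneg mult_nonneg_nonneg) (auto simp: less_imp_le)
  show ?thesis
  proof (cases "v = 0")
    case True
    then have "\<forall>i\<in>{..<m}. (c i)\<^sup>2 * (t (Suc i) - t i) = 0"
      unfolding v_def using lt by (subst (asm) sum_nonneg_eq_0_iff) (auto simp: less_imp_le)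
    then have "c i = 0" if "i < m" for i using that lt[of i] by fastforce
    then have "step_integral B m t c = (\<lambda>_. 0)" by (auto simp: step_integral_def)
    then show ?thesis unfolding nn_integral_step_fun_square[OF t] v_def[symmetric] True by simp
  next
    case False
    then have v: "v > 0" using v0 by simp
    show ?thesis
      using normal_second_moment[OF step_integral_normal[OF B t v[unfolded v_def]]] v
      unfolding nn_integral_step_fun_square[OF t] v_def[symmetric] by simp
  qed
qed

lemma ennreal_square_le:
  fixes a b :: real
  shows "ennreal (a\<^sup>2) \<le> 2 * ennreal ((b - a)\<^sup>2) + 2 * ennreal (b\<^sup>2)"
proof -
  have "2 * ((b - a)\<^sup>2 + b\<^sup>2) - a\<^sup>2 = (a - 2 * b)\<^sup>2" by (simp add: power2_eq_square algebra_simps)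
  then have "a\<^sup>2 \<le> 2 * (b - a)\<^sup>2 + 2 * b\<^sup>2" using zero_le_power2[of "a - 2 * b"] by (simp add: algebra_simps)
  then have "ennreal (a\<^sup>2) \<le> ennreal (2 * (b - a)\<^sup>2 + 2 * b\<^sup>2)" by (rule ennreal_leI)
  then show ?thesis by (simp add: ennreal_mult)
qed

lemma step_fun_measurable [measurable]: "step_fun m t c \<in> borel_measurable borel"
  unfolding step_fun_def[abs_def] by measurable

lemma step_integral_measurable:
  assumes B: "two_sided_brownian_motion N B"
  shows "step_integral B m t c \<in> borel_measurable N"
proof -
  have [measurable]: "B u \<in> borel_measurable N" for u using B unfolding two_sided_brownian_motion_def by blast
  show ?thesis unfolding step_integral_def[abs_def] by measurable
qed

text \<open>One good approximant \<open>I\<close> of \<open>Y\<close> is enough. Its law is normal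
  with standard deviation at least \<open>s / 2\<close>, so \<open>\<bar>I\<bar> \<le> 2 * r\<close>
  has probability at most \<open>8 * r / s\<close>; the Markov inequality for
  \<open>\<bar>I - Y\<bar> \<ge> r\<close> adds \<open>r / s\<close>.\<close>

lemma wiener_integral_small_ball:
  assumes B: "two_sided_brownian_motion N B" and Y: "has_wiener_integral N B f Y"
    and s: "s > 0" and r: "r > 0" and f: "ennreal (s\<^sup>2) \<le> (\<integral>\<^sup>+u. ennreal ((f u)\<^sup>2) \<partial>lborel)"
  shows "emeasure N {w \<in> space N. \<bar>Y w\<bar> \<le> r} \<le> ennreal (9 * r / s)"
proof -
  interpret prob_space N using B unfolding two_sided_brownian_motion_def by blast
  obtain m t c where t: "\<And>k. strict_mono (t k)"
    and l1: "(\<lambda>k. \<integral>\<^sup>+u. ennreal ((step_fun (m k) (t k) (c k) u - f u)\<^sup>2) \<partial>lborel) \<longlonglongrightarrow> 0"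
    and l2: "(\<lambda>k. \<integral>\<^sup>+w. ennreal ((step_integral B (m k) (t k) (c k) w - Y w)\<^sup>2) \<partial>N) \<longlonglongrightarrow> 0"
    using Y unfolding has_wiener_integral_def by blast
  let ?I = "\<lambda>k. step_integral B (m k) (t k) (c k)" and ?G = "\<lambda>k. step_fun (m k) (t k) (c k)"
  have fm[measurable]: "f \<in> borel_measurable borel" and Ym[measurable]: "Y \<in> borel_measurable N"
    using Y unfolding has_wiener_integral_def by auto
  \<comment> \<open>Chosen so that the Markov bound \<open>\<delta> / r^2\<close> equals
    \<open>r / s\<close>.\<close>
  define \<delta> where "\<delta> = r ^ 3 / s"
  have \<delta>: "\<delta> > 0" using r s by (simp add: \<delta>_def)
  \<comment> \<open>By \<open>f^2 \<le> 2 * (G - f)^2 + 2 * G^2\<close>, an error below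
    \<open>s^2 / 4\<close> leaves the step function a squared norm of at least
    \<open>s^2 / 4\<close>.\<close>
  have "eventually (\<lambda>k. (\<integral>\<^sup>+u. ennreal ((?G k u - f u)\<^sup>2) \<partial>lborel) < ennreal (s\<^sup>2 / 4)) sequentially"
    using s by (intro order_tendstoD(2)[OF l1]) simp
  moreover have "eventually (\<lambda>k. (\<integral>\<^sup>+w. ennreal ((?I k w - Y w)\<^sup>2) \<partial>N) < ennreal \<delta>) sequentially"
    using \<delta> by (intro order_tendstoD(2)[OF l2]) simp
  ultimately have "eventually (\<lambda>k. (\<integral>\<^sup>+u. ennreal ((?G k u - f u)\<^sup>2) \<partial>lborel) < ennreal (s\<^sup>2 / 4) \<and>
      (\<integral>\<^sup>+w. ennreal ((?I k w - Y w)\<^sup>2) \<partial>N) < ennreal \<delta>) sequentially"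
    by (rule eventually_conj)
  then obtain k where k: "(\<integral>\<^sup>+u. ennreal ((?G k u - f u)\<^sup>2) \<partial>lborel) < ennreal (s\<^sup>2 / 4)"
      "(\<integral>\<^sup>+w. ennreal ((?I k w - Y w)\<^sup>2) \<partial>N) < ennreal \<delta>"
    using eventually_happens[of _ sequentially] by auto
  define G where "G = step_fun (m k) (t k) (c k)"
  define I where "I = step_integral B (m k) (t k) (c k)"
  have [measurable]: "G \<in> borel_measurable borel" unfolding G_def by measurable
  have [measurable]: "I \<in> borel_measurable N" unfolding I_def by (rule step_integral_measurable[OF B])
  define v where "v = (\<Sum>i<m k. (c k i)\<^sup>2 * (t k (Suc i) - t k i))"
  have lt: "t k i < t k (Suc i)" for i using strict_mono_less[OF t, of k i "Suc i"] by simp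
  have v0: "v \<ge> 0" unfolding v_def using lt by (intro sum_nonneg mult_nonneg_nonneg) (auto simp: less_imp_le)
  have "ennreal (s\<^sup>2) \<le> (\<integral>\<^sup>+u. ennreal ((f u)\<^sup>2) \<partial>lborel)" by (rule f)
  also have "\<dots> \<le> (\<integral>\<^sup>+u. 2 * ennreal ((G u - f u)\<^sup>2) + 2 * ennreal ((G u)\<^sup>2) \<partial>lborel)"
    by (intro nn_integral_mono ennreal_square_le)
  also have "\<dots> = 2 * (\<integral>\<^sup>+u. ennreal ((G u - f u)\<^sup>2) \<partial>lborel) + 2 * (\<integral>\<^sup>+u. ennreal ((G u)\<^sup>2) \<partial>lborel)"
    by (simp add: nn_integral_add nn_integral_cmult)
  also have "\<dots> \<le> 2 * ennreal (s\<^sup>2 / 4) + 2 * ennreal v"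
    using k(1) unfolding G_def nn_integral_step_fun_square[OF t] v_def by (intro add_mono mult_left_mono) auto
  also have "\<dots> = ennreal (s\<^sup>2 / 2 + 2 * v)"
    using v0 by (simp add: ennreal_mult[symmetric] ennreal_plus[symmetric] del: ennreal_plus flip: ennreal_numeral)
  finally have "s\<^sup>2 \<le> s\<^sup>2 / 2 + 2 * v" using v0 by (subst (asm) ennreal_le_iff) auto
  then have v4: "(s / 2)\<^sup>2 \<le> v" by (simp add: power_divide)
  then have v: "v > 0" using s by (intro less_le_trans[OF _ v4]) simp
  have sv: "s / 2 \<le> sqrt v" using v4 by (rule real_le_rsqrt)
  have "emeasure N {w \<in> space N. \<bar>Y w\<bar> \<le> r}
      \<le> emeasure N ({w \<in> space N. \<bar>I w\<bar> \<le> 2 * r} \<union> {w \<in> space N. r \<le> \<bar>I w - Y w\<bar>})"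
    by (intro emeasure_mono) auto
  also have "\<dots> \<le> emeasure N {w \<in> space N. \<bar>I w\<bar> \<le> 2 * r} + emeasure N {w \<in> space N. r \<le> \<bar>I w - Y w\<bar>}"
    by (rule emeasure_subadditive) measurable
  also have "emeasure N {w \<in> space N. \<bar>I w\<bar> \<le> 2 * r} \<le> ennreal (2 * (2 * r) / sqrt v)"
    unfolding I_def by (rule normal_small_ball[OF step_integral_normal[OF B t v[unfolded v_def], folded v_def]]) (use r v in auto)
  also have "\<dots> \<le> ennreal (8 * r / s)"
  proof (rule ennreal_leI)
    have "2 * (2 * r) / sqrt v \<le> 2 * (2 * r) / (s / 2)"
      using sv r s v by (intro divide_left_mono) (auto intro!: mult_pos_pos)
    then show "2 * (2 * r) / sqrt v \<le> 8 * r / s" by simp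
  qed
  also have "emeasure N {w \<in> space N. r \<le> \<bar>I w - Y w\<bar>} \<le> ennreal (r / s)"
  proof -
    have e: "{w \<in> space N. r \<le> \<bar>I w - Y w\<bar>} = {w \<in> space N. 1 \<le> ennreal (1 / r\<^sup>2) * ennreal ((I w - Y w)\<^sup>2)}"
    proof (intro Collect_cong conj_cong refl)
      fix w
      have "r \<le> \<bar>I w - Y w\<bar> \<longleftrightarrow> r\<^sup>2 \<le> (I w - Y w)\<^sup>2"
        using r abs_le_square_iff[of r "I w - Y w"] by simp
      also have "\<dots> \<longleftrightarrow> 1 \<le> (1 / r\<^sup>2) * (I w - Y w)\<^sup>2" using r by (simp add: divide_simps)
      also have "\<dots> \<longleftrightarrow> 1 \<le> ennreal (1 / r\<^sup>2) * ennreal ((I w - Y w)\<^sup>2)"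
        unfolding ennreal_mult'[symmetric, of "1 / r\<^sup>2", simplified] using ennreal_le_iff[of "(1 / r\<^sup>2) * (I w - Y w)\<^sup>2" 1]
        by (simp add: ennreal_mult[symmetric])
      finally show "r \<le> \<bar>I w - Y w\<bar> \<longleftrightarrow> 1 \<le> ennreal (1 / r\<^sup>2) * ennreal ((I w - Y w)\<^sup>2)" .
    qed
    have "emeasure N {w \<in> space N. 1 \<le> ennreal (1 / r\<^sup>2) * ennreal ((I w - Y w)\<^sup>2)}
      \<le> ennreal (1 / r\<^sup>2) * (\<integral>\<^sup>+w. ennreal ((I w - Y w)\<^sup>2) * indicator (space N) w \<partial>N)"
      by (rule nn_integral_Markov_inequality) measurable
    also have "(\<integral>\<^sup>+w. ennreal ((I w - Y w)\<^sup>2) * indicator (space N) w \<partial>N) = (\<integral>\<^sup>+w. ennreal ((I w - Y w)\<^sup>2) \<partial>N)"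
      by (intro nn_integral_cong) auto
    also have "ennreal (1 / r\<^sup>2) * \<dots> \<le> ennreal (1 / r\<^sup>2) * ennreal \<delta>"
      using k(2) unfolding I_def by (intro mult_left_mono) auto
    also have "\<dots> = ennreal (r / s)" using r s \<delta> by (simp add: ennreal_mult[symmetric] \<delta>_def power2_eq_square power3_eq_cube)
    finally show ?thesis unfolding e .
  qed
  finally have "emeasure N {w \<in> space N. \<bar>Y w\<bar> \<le> r} \<le> ennreal (8 * r / s) + ennreal (r / s)"
    by (simp add: add_mono)
  also have "\<dots> = ennreal (9 * r / s)" using r s by (simp add: ennreal_plus[symmetric] add_divide_distrib[symmetric] del: ennreal_plus)
  finally show ?thesis .
qed

text \<open>Applied to the kernel at time 0, this gives \<open>Z 0 = 0\<close> almost surely and so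
  removes the constant term of an affine path. It holds because, by the isometry, the second moment
  of \<open>Y\<close> is dominated by errors that tend to 0.\<close>

lemma wiener_integral_zero:
  assumes B: "two_sided_brownian_motion N B" and Y: "has_wiener_integral N B (\<lambda>_. 0) Y"
  shows "AE w in N. Y w = 0"
proof -
  obtain m t c where t: "\<And>k. strict_mono (t k)"
    and l1: "(\<lambda>k. \<integral>\<^sup>+u. ennreal ((step_fun (m k) (t k) (c k) u - 0)\<^sup>2) \<partial>lborel) \<longlonglongrightarrow> 0"
    and l2: "(\<lambda>k. \<integral>\<^sup>+w. ennreal ((step_integral B (m k) (t k) (c k) w - Y w)\<^sup>2) \<partial>N) \<longlonglongrightarrow> 0"
    using Y unfolding has_wiener_integral_def by blast
  let ?I = "\<lambda>k. step_integral B (m k) (t k) (c k)" and ?G = "\<lambda>k. step_fun (m k) (t k) (c k)"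
  have Ym[measurable]: "Y \<in> borel_measurable N"
    using Y unfolding has_wiener_integral_def by auto
  have [measurable]: "?I k \<in> borel_measurable N" for k
    by (rule step_integral_measurable[OF B])
  have le: "(\<integral>\<^sup>+w. ennreal ((Y w)\<^sup>2) \<partial>N) \<le> 2 * (\<integral>\<^sup>+w. ennreal ((?I k w - Y w)\<^sup>2) \<partial>N)
     + 2 * (\<integral>\<^sup>+u. ennreal ((?G k u - 0)\<^sup>2) \<partial>lborel)" for k
  proof -
    have "(\<integral>\<^sup>+w. ennreal ((Y w)\<^sup>2) \<partial>N) \<le> (\<integral>\<^sup>+w. 2 * ennreal ((?I k w - Y w)\<^sup>2)
       + 2 * ennreal ((?I k w)\<^sup>2) \<partial>N)"
      by (intro nn_integral_mono ennreal_square_le)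
    also have "\<dots> = 2 * (\<integral>\<^sup>+w. ennreal ((?I k w - Y w)\<^sup>2) \<partial>N)
       + 2 * (\<integral>\<^sup>+w. ennreal ((?I k w)\<^sup>2) \<partial>N)"
      by (simp add: nn_integral_add nn_integral_cmult)
    finally show ?thesis using step_integral_second_moment[OF B t] by simp
  qed
  have "(\<lambda>k. 2 * (\<integral>\<^sup>+w. ennreal ((?I k w - Y w)\<^sup>2) \<partial>N)
     + 2 * (\<integral>\<^sup>+u. ennreal ((?G k u - 0)\<^sup>2) \<partial>lborel)) \<longlonglongrightarrow> 2 * 0 + 2 * 0"
    by (intro tendsto_add tendsto_mult_ennreal tendsto_const l1 l2) auto
  then have "(\<integral>\<^sup>+w. ennreal ((Y w)\<^sup>2) \<partial>N) \<le> 2 * 0 + 2 * 0"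
    by (rule Lim_bounded2) (use le in blast)
  then have "(\<integral>\<^sup>+w. ennreal ((Y w)\<^sup>2) \<partial>N) = 0" by simp
  then have "AE w in N. ennreal ((Y w)\<^sup>2) = 0" by (subst (asm) nn_integral_0_iff_AE) auto
  then show ?thesis by eventually_elim (simp add: ennreal_eq_0_iff)
qed

text \<open>The part \<open>0 \<le> u \<le> t / 2\<close> of the kernel suffices. There
  \<open>(t - u) / t\<close> lies in \<open>[1/2, 1]\<close>, so its \<open>d\<close>-th power is at
  least 1/2 for every \<open>d \<le> 1\<close>, negative \<open>d\<close> included. The squared norm
  is thus at least \<open>t powr (2 * d + 1) / 8\<close>, rounded down to the perfect square with
  16.\<close>

lemma fbm_I_kernel_norm:
  assumes d: "d \<le> 1" and t: "t > 0"
  shows "ennreal ((t powr (d + 1/2) / 4)\<^sup>2) \<le> (\<integral>\<^sup>+u. ennreal ((fbm_I_kernel d t u)\<^sup>2) \<partial>lborel)"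
proof -
  have b: "(t powr d / 2)\<^sup>2 \<le> (fbm_I_kernel d t u)\<^sup>2" if u: "u \<in> {0..t / 2}" for u
  proof -
    define x where "x = (t - u) / t"
    have x: "1 / 2 \<le> x" "x \<le> 1" using u t by (auto simp: x_def field_simps)
    have "1 / 2 \<le> x powr 1" using x by simp
    also have "\<dots> \<le> x powr d" using d x by (intro powr_mono') auto
    finally have "t powr d * (1 / 2) \<le> t powr d * x powr d" by (intro mult_left_mono) auto
    also have "\<dots> = (t * x) powr d" using x t by (simp add: powr_mult)
    also have "\<dots> = fbm_I_kernel d t u" using u t by (auto simp: fbm_I_kernel_def x_def)
    finally show ?thesis by (intro power_mono) auto
  qed
  have "(t powr (d + 1/2) / 4)\<^sup>2 \<le> (t powr d / 2)\<^sup>2 * (t / 2)"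
  proof -
    have "(t powr (1/2))\<^sup>2 = t" using t by (simp add: powr_half_sqrt)
    then have "(t powr (d + 1/2) / 4)\<^sup>2 = (t powr d)\<^sup>2 * t / 16"
      unfolding powr_add by (simp add: power_mult_distrib power_divide)
    also have "\<dots> \<le> (t powr d)\<^sup>2 * t / 8" using t by (intro divide_left_mono) auto
    finally show ?thesis by (simp add: power_divide)
  qed
  then have "ennreal ((t powr (d + 1/2) / 4)\<^sup>2) \<le> ennreal ((t powr d / 2)\<^sup>2 * (t / 2))" by (rule ennreal_leI)
  also have "\<dots> = (\<integral>\<^sup>+u. ennreal ((t powr d / 2)\<^sup>2) * indicator {0..t / 2} u \<partial>lborel)"
    using t by (simp add: nn_integral_cmult_indicator ennreal_mult[symmetric])
  also have "\<dots> \<le> (\<integral>\<^sup>+u. ennreal ((fbm_I_kernel d t u)\<^sup>2) \<partial>lborel)"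
    using b by (intro nn_integral_mono) (auto simp: indicator_def intro!: ennreal_leI)
  finally show ?thesis .
qed

lemma fbm_I_kernel_0: "fbm_I_kernel d 0 = (\<lambda>_. 0)"
  by (auto simp: fbm_I_kernel_def)

text \<open>Near \<open>0\<close> the standard deviation \<open>t powr (d + 1/2)\<close> of \<open>Z t\<close> is much larger than \<open>t\<close>.\<close>

lemma fbm_I_base_not_affine:
  assumes Z: "fbm_I_base N d Z" and d: "- 1/2 < d" "d < 1/2" and \<delta>: "\<delta> > 0"
  shows "AE w in N. \<not> (\<exists>a b. \<forall>t\<in>{0..<\<delta>}. Z t w = a * t + b)"
proof -
  obtain B where B: "two_sided_brownian_motion N B"
    and ZB: "\<And>t. t \<ge> 0 \<Longrightarrow> Z t \<in> borel_measurable N"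
      "\<And>t. t \<ge> 0 \<Longrightarrow> \<exists>Y. has_wiener_integral N B (fbm_I_kernel d t) Y \<and> (AE w in N. Z t w = 1 / Gamma (d + 1) * Y w)"
    using Z unfolding fbm_I_base_def by blast
  interpret prob_space N using B unfolding two_sided_brownian_motion_def by blast
  define g where "g = Gamma (d + 1)"
  have g: "g > 0" unfolding g_def using d by (intro Gamma_real_pos) auto
  have Z0: "AE w in N. Z 0 w = 0"
  proof -
    obtain Y where Y: "has_wiener_integral N B (fbm_I_kernel d 0) Y" "AE w in N. Z 0 w = 1 / Gamma (d + 1) * Y w"
      using ZB(2)[of 0] by auto
    have "AE w in N. Y w = 0" using wiener_integral_zero[OF B] Y(1) unfolding fbm_I_kernel_0 by blast
    with Y(2) show ?thesis by eventually_elim simp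
  qed
  \<comment> \<open>The shift by 2 keeps every \<open>h m\<close> strictly below
    \<open>\<delta>\<close>, where the affine form is available.\<close>
  define h where "h m = \<delta> / real (m + 2)" for m :: nat
  have h: "0 < h m" "h m < \<delta>" for m
  proof -
    have p: "0 < real (m + 2)" by simp
    show "0 < h m" unfolding h_def using \<delta> p by (rule divide_pos_pos)
    show "h m < \<delta>" unfolding h_def pos_divide_less_eq[OF p] using mult_strict_left_mono[OF _ \<delta>, of 1 "real (m + 2)"] by simp
  qed
  have h0: "h \<longlonglongrightarrow> 0"
    unfolding h_def by real_asymp
  \<comment> \<open>This is \<open>9 * r / s\<close> with \<open>s = t powr (d + 1/2) / 4\<close>.
    The power of \<open>t\<close> that remains is positive because \<open>d < 1/2\<close>.\<close>
  have small: "emeasure N {w \<in> space N. \<bar>Z t w\<bar> \<le> C * t} \<le> ennreal (36 * (g * C) * t powr (1/2 - d))"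
    if t: "t > 0" and C: "C > 0" for t C
  proof -
    obtain Y where Y: "has_wiener_integral N B (fbm_I_kernel d t) Y" "AE w in N. Z t w = 1 / g * Y w"
      using ZB(2)[of t] t unfolding g_def by auto
    have Ym[measurable]: "Y \<in> borel_measurable N" using Y unfolding has_wiener_integral_def by auto
    have "emeasure N {w \<in> space N. \<bar>Z t w\<bar> \<le> C * t} \<le> emeasure N {w \<in> space N. \<bar>Y w\<bar> \<le> g * (C * t)}"
    proof (rule emeasure_mono_AE)
      show "AE w in N. w \<in> {w \<in> space N. \<bar>Z t w\<bar> \<le> C * t} \<longrightarrow> w \<in> {w \<in> space N. \<bar>Y w\<bar> \<le> g * (C * t)}"
        using Y(2)
      proof eventually_elim
        case (elim w)
        then have "\<bar>Y w\<bar> = g * \<bar>Z t w\<bar>" using g by (simp add: abs_mult)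
        then show ?case using g by auto
      qed
    qed measurable
    also have "\<dots> \<le> ennreal (9 * (g * (C * t)) / (t powr (d + 1/2) / 4))"
      by (rule wiener_integral_small_ball[OF B Y(1) _ _ fbm_I_kernel_norm]) (use t C g d in auto)
    also have "9 * (g * (C * t)) / (t powr (d + 1/2) / 4) = 36 * (g * C) * (t powr 1 / t powr (d + 1/2))"
      using t by simp
    also have "t powr 1 / t powr (d + 1/2) = t powr (1/2 - d)"
      unfolding powr_diff[symmetric] by (simp add: algebra_simps)
    finally show ?thesis .
  qed
  \<comment> \<open>The event lies in each of the events at time \<open>h m\<close>, whose
    probabilities tend to 0.\<close>
  have "AE w in N. \<not> (\<forall>m. \<bar>Z (h m) w\<bar> \<le> real (Suc C) * h m)" for C
  proof -
    let ?E = "{w \<in> space N. \<forall>m. \<bar>Z (h m) w\<bar> \<le> real (Suc C) * h m}"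
    have [measurable]: "Z (h m) \<in> borel_measurable N" for m using ZB(1) h by (simp add: less_imp_le)
    have E: "?E \<in> sets N" by measurable
    have "(\<lambda>m. h m powr (1/2 - d)) \<longlonglongrightarrow> 0"
    proof -
      have "((\<lambda>m. h m powr (1/2 - d)) \<longlongrightarrow> 0 powr (1/2 - d)) sequentially"
        by (rule tendsto_powr'[OF h0 tendsto_const]) (use d h in \<open>auto simp: less_imp_le\<close>)
      then show ?thesis by simp
    qed
    then have "(\<lambda>m. 36 * (g * real (Suc C)) * h m powr (1/2 - d)) \<longlonglongrightarrow> 36 * (g * real (Suc C)) * 0"
      by (rule tendsto_mult_left)
    then have "(\<lambda>m. ennreal (36 * (g * real (Suc C)) * h m powr (1/2 - d))) \<longlonglongrightarrow> ennreal (36 * (g * real (Suc C)) * 0)"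
      by (rule tendsto_ennrealI)
    then have "emeasure N ?E \<le> ennreal (36 * (g * real (Suc C)) * 0)"
    proof (rule Lim_bounded2, intro allI impI)
      fix m
      have "emeasure N ?E \<le> emeasure N {w \<in> space N. \<bar>Z (h m) w\<bar> \<le> real (Suc C) * h m}"
        by (intro emeasure_mono) auto
      also have "\<dots> \<le> ennreal (36 * (g * real (Suc C)) * h m powr (1/2 - d))"
        by (rule small) (use h in auto)
      finally show "emeasure N ?E \<le> ennreal (36 * (g * real (Suc C)) * h m powr (1/2 - d))" .
    qed
    then have "?E \<in> null_sets N" using E by (simp add: null_sets_def)
    then show ?thesis by (rule AE_I'[of ?E]) auto
  qed
  \<comment> \<open>Countably many integer bounds cover all real slopes, so the exceptional set is
    still null.\<close>
  then have "AE w in N. \<forall>C. \<not> (\<forall>m. \<bar>Z (h m) w\<bar> \<le> real (Suc C) * h m)"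
    by (subst AE_all_countable) blast
  with Z0 show ?thesis
  proof eventually_elim
    case (elim w)
    show ?case
    proof
      assume "\<exists>a b. \<forall>t\<in>{0..<\<delta>}. Z t w = a * t + b"
      then obtain a b where ab: "\<And>t. t \<in> {0..<\<delta>} \<Longrightarrow> Z t w = a * t + b" by blast
      have "b = 0" using ab[of 0] elim(1) \<delta> by simp
      obtain C where C: "\<bar>a\<bar> \<le> real C" using real_arch_simple by blast
      have "\<bar>Z (h m) w\<bar> \<le> real (Suc C) * h m" for m
      proof -
        have "\<bar>Z (h m) w\<bar> = \<bar>a\<bar> * h m" using ab[of "h m"] h[of m] \<open>b = 0\<close> by (simp add: abs_mult)
        also have "\<dots> \<le> real (Suc C) * h m" using C h[of m] by (intro mult_right_mono) auto
        finally show ?thesis .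
      qed
      then show False using elim(2) by blast
    qed
  qed
qed

section \<open>Vanishing of Q\<close>

text \<open>By right continuity a nonzero value would keep the square above a positive constant on
  an interval to the right of \<open>t\<close>, and \<open>t < b\<close> leaves room for such an
  interval inside the domain.\<close>

lemma integral_square_eq_0_imp_eq_0:
  fixes h :: "real \<Rightarrow> real"
  assumes m: "h \<in> borel_measurable borel" and K: "\<And>u. u \<in> {a..b} \<Longrightarrow> \<bar>h u\<bar> \<le> K"
    and 0: "(LINT u:{a..b}|lborel. (h u)\<^sup>2) \<le> 0"
    and t: "a \<le> t" "t < b" and rc: "(h \<longlongrightarrow> h t) (at_right t)"
  shows "h t = 0"
proof (rule ccontr)
  assume nz: "h t \<noteq> 0"
  define e where "e = (h t)\<^sup>2 / 2"
  have e: "e > 0" "e < (h t)\<^sup>2" using nz by (auto simp: e_def)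
  have "((\<lambda>x. (h x)\<^sup>2) \<longlongrightarrow> (h t)\<^sup>2) (at_right t)" by (intro tendsto_intros rc)
  then have "eventually (\<lambda>x. e < (h x)\<^sup>2) (at_right t)" using e by (intro order_tendstoD)
  then obtain c where c: "c > t" "\<And>x. t < x \<Longrightarrow> x < c \<Longrightarrow> e < (h x)\<^sup>2"
    unfolding eventually_at_right_field by blast
  obtain q where q: "t < q" "q < min c b" using dense[of t "min c b"] c(1) t by auto
  obtain p where p: "t < p" "p < q" using dense[OF q(1)] by auto
  have i: "set_integrable lborel {a..b} (\<lambda>u. (h u)\<^sup>2)"
    by (rule set_integrable_bounded_Icc[where K="K\<^sup>2"]) (use m in simp, rule abs_square_le, use K in auto)
  have j: "set_integrable lborel {p..q} (\<lambda>u. e)"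
    by (rule set_integrable_bounded_Icc[where K=e]) (use e in auto)
  have "(LINT u:{p..q}|lborel. e) \<le> (LINT u:{a..b}|lborel. (h u)\<^sup>2)"
    unfolding set_lebesgue_integral_def
  proof (rule integral_mono)
    show "indicator {p..q} u *\<^sub>R e \<le> indicator {a..b} u *\<^sub>R (h u)\<^sup>2" for u
      using c(2)[of u] p q t by (auto simp: indicator_def less_imp_le)
  qed (use i j in \<open>auto simp: set_integrable_def\<close>)
  moreover have "(LINT u:{p..q}|lborel. e) = e * (q - p)" using p by (simp add: set_integral_const_Icc)
  moreover have "e * (q - p) > 0" using e p by simp
  ultimately show False using 0 by linarith
qed

text \<open>Times with small \<open>Q_fun\<close> give affine functions that are close to
  \<open>z\<close> in mean square on the common interval \<open>{0..\<tau>1}\<close>. Their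
  coefficients are bounded, so a subsequence converges, and the limiting affine function has
  distance 0 from \<open>z\<close>; right continuity upgrades this to equality at each
  point.\<close>

lemma INF_Q_eq_0_imp_affine:
  assumes \<tau>: "0 < \<tau>1" "\<tau>1 \<le> \<tau>2" "\<tau>2 < 1" and z: "z \<in> mspace D01"
    and INF: "(INF t\<in>{\<tau>1..\<tau>2}. Q_fun t z) \<le> 0"
  shows "\<exists>a b. \<forall>u\<in>{0..<\<tau>1}. z u = a * u + b"
proof -
  define w where "w = clip z"
  have wz: "w u = z u" if "u \<in> {0..1}" for u using that by (simp add: w_def clip_eq)
  obtain K where "K \<ge> 1" and "\<forall>u\<in>{0..1}. \<bar>z u\<bar> \<le> K" using D01_bounded[OF z] by blast
  then have K: "\<bar>w u\<bar> \<le> K" if "u \<in> {0..1}" for u using that by (simp add: wz)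
  have m[measurable]: "w \<in> borel_measurable borel" unfolding w_def using D01_cadlag[OF z] by measurable
  define J where "J a b = (LINT u:{0..\<tau>1}|lborel. (w u - a * u - b)\<^sup>2)" for a b
  have bnd: "\<bar>w u - a * u - b\<bar> \<le> K + \<bar>a\<bar> + \<bar>b\<bar>" if "u \<in> {0..1}" for u a b
  proof -
    have "\<bar>a * u\<bar> \<le> \<bar>a\<bar> * 1" unfolding abs_mult using that by (intro mult_left_mono) auto
    then show ?thesis using K[OF that] by linarith
  qed
  have int: "set_integrable lborel {0..s} (\<lambda>u. (w u - a * u - b)\<^sup>2)" if "s \<le> 1" for s a b
    by (rule set_integrable_bounded_Icc[where K="(K + \<bar>a\<bar> + \<bar>b\<bar>)\<^sup>2"]) (simp, rule abs_square_le, rule bnd, use that in auto)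
  \<comment> \<open>The slope is \<open>w t / t\<close> with \<open>t \<ge> \<tau>1\<close>, and the
    constant is the mean of the detrended path, which is bounded by \<open>2 * K\<close>.\<close>
  have "\<exists>p\<in>{- (K / \<tau>1)..K / \<tau>1} \<times> {- (2 * K)..2 * K}. J (fst p) (snd p) \<le> 1 / real (Suc i)" for i
  proof -
    have "\<not> (\<forall>t\<in>{\<tau>1..\<tau>2}. 1 / real (Suc i) \<le> Q_fun t z)"
    proof
      assume "\<forall>t\<in>{\<tau>1..\<tau>2}. 1 / real (Suc i) \<le> Q_fun t z"
      then have "1 / real (Suc i) \<le> (INF t\<in>{\<tau>1..\<tau>2}. Q_fun t z)" using \<tau> by (intro cINF_greatest) auto
      moreover have "0 < 1 / real (Suc i)" by simp
      ultimately show False using INF by linarith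
    qed
    then obtain t where t: "t \<in> {\<tau>1..\<tau>2}" and Qt: "Q_fun t z < 1 / real (Suc i)" by fastforce
    have t01: "0 < t" "t < 1" using t \<tau> by auto
    define \<mu> where "\<mu> = 1 / t * (LINT u:{0..t}|lborel. w u - u / t * w t)"
    have Kt: "\<bar>w u\<bar> \<le> K" if "u \<in> {0..t}" for u using that t01 by (intro K) auto
    have V: "Q_fun t w = (1 / t)\<^sup>2 * (LINT u:{0..t}|lborel. (w u - u / t * w t - \<mu>)\<^sup>2)" and \<mu>: "\<bar>\<mu>\<bar> \<le> 2 * K"
      unfolding \<mu>_def using Q_fun_eq_variance[OF m Kt t01(1)] by auto
    have e: "w u - u / t * w t - \<mu> = w u - (w t / t) * u - \<mu>" for u by simp
    have "\<bar>w t / t\<bar> \<le> K / \<tau>1"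
      unfolding abs_divide using t \<tau> K[of t] by (intro frac_le) auto
    moreover have "J (w t / t) \<mu> \<le> (LINT u:{0..t}|lborel. (w u - (w t / t) * u - \<mu>)\<^sup>2)"
      unfolding J_def set_lebesgue_integral_def
    proof (rule integral_mono)
      show "indicator {0..\<tau>1} u *\<^sub>R (w u - (w t / t) * u - \<mu>)\<^sup>2 \<le> indicator {0..t} u *\<^sub>R (w u - (w t / t) * u - \<mu>)\<^sup>2" for u
        using t by (auto simp: indicator_def)
    qed (use int[of \<tau>1 "w t / t" \<mu>] int[of t "w t / t" \<mu>] t \<tau> in \<open>simp_all add: set_integrable_def\<close>)
    moreover have "(LINT u:{0..t}|lborel. (w u - (w t / t) * u - \<mu>)\<^sup>2) = t\<^sup>2 * Q_fun t w"
      unfolding V e using t01 by (simp add: power_divide)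
    moreover have "t\<^sup>2 * Q_fun t w \<le> 1 * Q_fun t w"
      using t01 Q_fun_D01_bounds(1)[OF z t01] Q_fun_clip[of t z] by (intro mult_right_mono) (auto simp: w_def power_le_one)
    moreover have "Q_fun t w = Q_fun t z" unfolding w_def using t01 by (intro Q_fun_clip) auto
    ultimately have "J (w t / t) \<mu> \<le> 1 / real (Suc i)" "\<bar>w t / t\<bar> \<le> K / \<tau>1" using Qt by linarith+
    then have "w t / t \<in> {- (K / \<tau>1)..K / \<tau>1}" "\<mu> \<in> {- (2 * K)..2 * K}" "J (w t / t) \<mu> \<le> 1 / real (Suc i)"
      using \<mu> unfolding atLeastAtMost_iff by linarith+
    then show ?thesis by (intro bexI[of _ "(w t / t, \<mu>)"]) simp_all
  qed
  then obtain f where f: "\<And>i. f i \<in> {- (K / \<tau>1)..K / \<tau>1} \<times> {- (2 * K)..2 * K}"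
    "\<And>i. J (fst (f i)) (snd (f i)) \<le> 1 / real (Suc i)" by metis
  have "compact ({- (K / \<tau>1)..K / \<tau>1} \<times> {- (2 * K)..2 * K})" by (intro compact_Times) auto
  then obtain l r where r: "strict_mono (r :: nat \<Rightarrow> nat)" "(f \<circ> r) \<longlonglongrightarrow> l"
    unfolding compact_def using f(1) by blast
  define a where "a = fst l"
  define b where "b = snd l"
  let ?a = "\<lambda>i. fst (f (r i))" and ?b = "\<lambda>i. snd (f (r i))"
  have la: "?a \<longlonglongrightarrow> a" and lb: "?b \<longlonglongrightarrow> b"
    using tendsto_fst[OF r(2)] tendsto_snd[OF r(2)] by (auto simp: a_def b_def o_def)
  \<comment> \<open>Passing to the limiting coefficients changes the integrand before squaring by at
    most \<open>\<bar>?a i - a\<bar> + \<bar>?b i - b\<bar>\<close>, since \<open>u \<le> 1\<close>;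
    the square is split by \<open>(x + y)^2 \<le> 2 * x^2 + 2 * y^2\<close>.\<close>
  have le: "J a b \<le> 2 * (1 / real (Suc i)) + 2 * (\<bar>?a i - a\<bar> + \<bar>?b i - b\<bar>)\<^sup>2" for i
  proof -
    let ?e = "\<bar>?a i - a\<bar> + \<bar>?b i - b\<bar>"
    have c: "set_integrable lborel {0..\<tau>1} (\<lambda>_. 2 * ?e\<^sup>2)"
      by (rule set_integrable_bounded_Icc[where K="2 * ?e\<^sup>2"]) auto
    have i: "set_integrable lborel {0..\<tau>1} (\<lambda>u. 2 * (w u - ?a i * u - ?b i)\<^sup>2)"
      using int[of \<tau>1 "?a i" "?b i"] \<tau> by auto
    have "J a b \<le> (LINT u:{0..\<tau>1}|lborel. 2 * (w u - ?a i * u - ?b i)\<^sup>2 + 2 * ?e\<^sup>2)"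
      unfolding J_def
    proof (rule set_integral_mono)
      show "set_integrable lborel {0..\<tau>1} (\<lambda>u. (w u - a * u - b)\<^sup>2)" using int \<tau> by auto
      show "set_integrable lborel {0..\<tau>1} (\<lambda>u. 2 * (w u - ?a i * u - ?b i)\<^sup>2 + 2 * ?e\<^sup>2)"
        using i c by (rule set_integral_add)
      fix u assume u: "u \<in> {0..\<tau>1}"
      have "\<bar>(?a i - a) * u\<bar> \<le> \<bar>?a i - a\<bar> * 1" unfolding abs_mult using u \<tau> by (intro mult_left_mono) auto
      then have "\<bar>(?a i - a) * u + (?b i - b)\<bar> \<le> ?e"
        by (intro order_trans[OF abs_triangle_ineq] add_mono) simp_all
      then have s: "((?a i - a) * u + (?b i - b))\<^sup>2 \<le> ?e\<^sup>2" using abs_square_le[of "(?a i - a) * u + (?b i - b)" ?e] by simp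
      have sq: "(x + y)\<^sup>2 \<le> 2 * x\<^sup>2 + 2 * y\<^sup>2" for x y :: real
        using zero_le_power2[of "x - y"] by (simp add: power2_eq_square algebra_simps)
      have eqn: "w u - a * u - b = (w u - ?a i * u - ?b i) + ((?a i - a) * u + (?b i - b))" by (simp add: algebra_simps)
      show "(w u - a * u - b)\<^sup>2 \<le> 2 * (w u - ?a i * u - ?b i)\<^sup>2 + 2 * ?e\<^sup>2"
        unfolding eqn by (rule order_trans[OF sq]) (use s in simp)
    qed
    also have "\<dots> = 2 * J (?a i) (?b i) + 2 * ?e\<^sup>2 * \<tau>1"
      unfolding J_def using i c \<tau> by (simp add: set_integral_add(2) set_integral_const_Icc)
    also have "\<dots> \<le> 2 * (1 / real (Suc i)) + 2 * ?e\<^sup>2 * 1"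
    proof (intro add_mono mult_left_mono)
      have "J (?a i) (?b i) \<le> 1 / real (Suc (r i))" by (rule f(2))
      also have "\<dots> \<le> 1 / real (Suc i)" using seq_suble[OF r(1), of i] by (intro divide_left_mono) auto
      finally show "J (?a i) (?b i) \<le> 1 / real (Suc i)" .
    qed (use \<tau> in auto)
    finally show ?thesis by simp
  qed
  have "(\<lambda>i. 2 * (1 / real (Suc i)) + 2 * (\<bar>?a i - a\<bar> + \<bar>?b i - b\<bar>)\<^sup>2) \<longlonglongrightarrow> 2 * 0 + 2 * (\<bar>a - a\<bar> + \<bar>b - b\<bar>)\<^sup>2"
    by (intro tendsto_intros la lb) (use LIMSEQ_inverse_real_of_nat in \<open>simp add: inverse_eq_divide\<close>)
  then have "J a b \<le> 2 * 0 + 2 * (\<bar>a - a\<bar> + \<bar>b - b\<bar>)\<^sup>2"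
    by (rule Lim_bounded2) (use le in blast)
  then have J0: "J a b \<le> 0" by simp
  have "z u = a * u + b" if u: "u \<in> {0..<\<tau>1}" for u
  proof -
    have u1: "0 \<le> u" "u < 1" using u \<tau> by auto
    have rc: "(z \<longlongrightarrow> z u) (at_right u)" by (rule cadlag_at_right[OF D01_cadlag[OF z] u1])
    have "eventually (\<lambda>x. z x = w x) (at_right u)"
      unfolding eventually_at_right_field using u1 by (intro exI[of _ 1]) (auto simp: wz)
    with rc have "(w \<longlongrightarrow> z u) (at_right u)" by (rule Lim_transform_eventually)
    then have rw: "(w \<longlongrightarrow> w u) (at_right u)" using u1 by (simp add: wz)
    have "w u - a * u - b = 0"
    proof (rule integral_square_eq_0_imp_eq_0[of "\<lambda>x. w x - a * x - b" 0 \<tau>1 "K + \<bar>a\<bar> + \<bar>b\<bar>" u])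
      show "((\<lambda>x. w x - a * x - b) \<longlongrightarrow> w u - a * u - b) (at_right u)" by (intro tendsto_intros rw)
    qed (use J0 u \<tau> bnd in \<open>auto simp: J_def\<close>)
    then show ?thesis using wz[of u] u1 by simp
  qed
  then show ?thesis by blast
qed

text \<open>At the left end of \<open>{x..y}\<close> the derivative is one-sided, so right
  continuity of \<open>f\<close> suffices to differentiate its integral there, and the derivative of
  an affine function is its slope.\<close>

lemma affine_integral_imp_constant:
  assumes f: "cadlag_on {0..1} f" and b: "b \<le> 1"
    and F: "\<And>t. t \<in> {0..<b} \<Longrightarrow> (LINT u:{0..t}|lborel. f u) = a * t + c" and x: "x \<in> {0..<b}"
  shows "f x = (a :: real)"
proof -
  define y where "y = (x + b) / 2"
  have y: "x < y" "y < b" "0 \<le> x" "y \<le> 1" using x b by (auto simp: y_def)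
  obtain K where K: "\<And>u. u \<in> {0..1} \<Longrightarrow> \<bar>f u\<bar> \<le> K"
    using cadlag_on_imp_bounded[OF f] unfolding bounded_iff real_norm_def by blast
  have m: "clip f \<in> borel_measurable borel" using f by measurable
  have si: "set_integrable lborel {p..q} f" if "0 \<le> p" "q \<le> 1" for p q
  proof -
    have "set_integrable lborel {p..q} (clip f)"
      by (rule set_integrable_bounded_Icc[OF m, where K=K]) (use K that in \<open>auto simp: clip_eq\<close>)
    then show ?thesis
      by (rule set_integrable_cong[THEN iffD1, rotated -1]) (use that in \<open>auto simp: clip_eq\<close>)
  qed
  have eq: "integral {x..t} f = a * (t - x)" if t: "t \<in> {x..y}" for t
  proof -
    have "integral {0..x} f + integral {x..t} f = integral {0..t} f"
      by (rule Henstock_Kurzweil_Integration.integral_combine) (use t y si[of 0 t] in \<open>auto intro!: set_borel_integral_eq_integral(1)\<close>)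
    moreover have "integral {0..x} f = a * x + c" "integral {0..t} f = a * t + c"
      using F[of x] F[of t] x t y set_borel_integral_eq_integral(2)[OF si, of 0 x] set_borel_integral_eq_integral(2)[OF si, of 0 t] by auto
    ultimately show ?thesis by (simp add: algebra_simps)
  qed
  \<comment> \<open>The removed \<open>{}\<close> is the empty exceptional set in the
    differentiation theorem for the integral.\<close>
  have rc: "continuous (at x within ({x..y} - {})) f"
  proof -
    have "(f \<longlongrightarrow> f x) (at_right x)" by (rule cadlag_at_right[OF f]) (use y in auto)
    then have "(f \<longlongrightarrow> f x) (at x within {x..y})"
      using y by (simp add: at_within_Icc_at_right)
    then show ?thesis by (simp add: continuous_within)
  qed
  have "((\<lambda>u. integral {x..u} f) has_vector_derivative f x) (at x within ({x..y} - {}))"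
    by (rule integral_has_vector_derivative_continuous_at[OF _ _ _ rc])
      (use y si[of x y] in \<open>auto intro!: set_borel_integral_eq_integral(1)\<close>)
  then have "((\<lambda>u. integral {x..u} f) has_vector_derivative f x) (at x within {x..y})" by simp
  then have "((\<lambda>u. a * (u - x)) has_vector_derivative f x) (at x within {x..y})"
    by (rule has_vector_derivative_transform[rotated 2]) (use y eq in auto)
  moreover have "((\<lambda>u. a * (u - x)) has_vector_derivative a) (at x within {x..y})"
    by (auto intro!: derivative_eq_intros simp: has_real_derivative_iff_has_vector_derivative[symmetric])
  ultimately show "f x = a"
    using y by (intro vector_derivative_unique_within_closed_interval[of x y x "\<lambda>u. a * (u - x)"]) auto
qed

section \<open>Convergence of the statistics\<close>

text \<open>Serves twice: to remove the factor \<open>n * s^2\<close> from the statistics and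
  \<open>\<kappa>^2\<close> from the limit. The lower bounds are there for the infima, because the
  infimum of an unbounded family is a default value, which does not scale.\<close>

definition scale_invariant :: "real set \<Rightarrow> ((real \<Rightarrow> real) \<Rightarrow> (real \<Rightarrow> real) \<Rightarrow> real) \<Rightarrow> bool" where
  "scale_invariant T \<Phi> \<longleftrightarrow> (\<forall>c p q p' q'. 0 < c \<and> bdd_below (p ` T) \<and> bdd_below (q ` T) \<and>
     (\<forall>t\<in>T. p' t = c * p t \<and> q' t = c * q t) \<longrightarrow> \<Phi> p' q' = \<Phi> p q)"

lemma scale_invariantD:
  assumes "scale_invariant T \<Phi>" "0 < c" "bdd_below (p ` T)" "bdd_below (q ` T)"
    "\<And>t. t \<in> T \<Longrightarrow> p' t = c * p t" "\<And>t. t \<in> T \<Longrightarrow> q' t = c * q t"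
  shows "\<Phi> p' q' = \<Phi> p q"
  by (rule assms(1)[unfolded scale_invariant_def, rule_format]) (use assms(2-) in blast)

lemma scale_invariant_SUP: "scale_invariant T (\<lambda>p q. SUP t\<in>T. p t / q t)"
  unfolding scale_invariant_def by (intro allI impI arg_cong[of _ _ Sup] image_cong refl) auto

lemma scale_invariant_integral:
  "T \<in> sets lborel \<Longrightarrow> scale_invariant T (\<lambda>p q. LINT t:T|lborel. p t / q t)"
  unfolding scale_invariant_def by (intro allI impI set_lebesgue_integral_cong) auto

lemma INF_cmult_real:
  fixes f :: "'i \<Rightarrow> real"
  assumes c: "c > 0" and T: "T \<noteq> {}" and b: "bdd_below (f ` T)"
  shows "(INF t\<in>T. c * f t) = c * (INF t\<in>T. f t)"
proof (rule antisym)
  obtain m where m: "\<And>t. t \<in> T \<Longrightarrow> m \<le> f t" using b unfolding bdd_below_def by auto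
  have b': "bdd_below ((\<lambda>t. c * f t) ` T)"
    using m c by (intro bdd_belowI2[where m="c * m"] mult_left_mono) auto
  have "(INF t\<in>T. c * f t) / c \<le> (INF t\<in>T. f t)"
    using cINF_lower[OF b'] c by (intro cINF_greatest T) (auto simp: pos_divide_le_eq mult.commute)
  then show "(INF t\<in>T. c * f t) \<le> c * (INF t\<in>T. f t)" using c by (simp add: pos_divide_le_eq mult.commute)
  show "c * (INF t\<in>T. f t) \<le> (INF t\<in>T. c * f t)"
    using cINF_lower[OF b] c by (intro cINF_greatest T mult_left_mono) auto
qed

lemma scale_invariant_INF:
  assumes "T \<noteq> {}"
  shows "scale_invariant T (\<lambda>p q. (INF t\<in>T. p t) / (INF t\<in>T. q t))"
  unfolding scale_invariant_def
proof (intro allI impI, elim conjE)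
  fix c :: real and p q p' q' :: "real \<Rightarrow> real"
  assume c: "0 < c" and b: "bdd_below (p ` T)" "bdd_below (q ` T)"
    and e: "\<forall>t\<in>T. p' t = c * p t \<and> q' t = c * q t"
  have "(INF t\<in>T. p' t) = (INF t\<in>T. c * p t)" "(INF t\<in>T. q' t) = (INF t\<in>T. c * q t)"
    using e by (auto intro!: INF_cong)
  then show "(INF t\<in>T. p' t) / (INF t\<in>T. q' t) = (INF t\<in>T. p t) / (INF t\<in>T. q t)"
    using c by (simp add: INF_cmult_real[OF c assms b(1)] INF_cmult_real[OF c assms b(2)])
qed

section \<open>The uniform norm and the cutoffs\<close>

definition D01_zero :: "real \<Rightarrow> real" where
  "D01_zero = restrict (\<lambda>_. 0) {0..1}"

text \<open>Expressed as a distance, so that the sets \<open>D01_norm z < y\<close> are balls and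
  hence measurable.\<close>

definition D01_norm :: "(real \<Rightarrow> real) \<Rightarrow> real" where
  "D01_norm z = mdist D01 D01_zero z"

lemma D01_zero_in [simp]: "D01_zero \<in> mspace D01"
proof -
  have "cadlag_on {0..1} D01_zero"
    by (rule continuous_imp_cadlag_on, rule continuous_on_eq[of _ "\<lambda>_. 0"]) (auto simp: D01_zero_def)
  then show ?thesis by (simp add: mspace_D01 D01_zero_def)
qed

lemma D01_zero_apply: "t \<in> {0..1} \<Longrightarrow> D01_zero t = 0"
  by (simp add: D01_zero_def)

lemma D01_norm_upper: "z \<in> mspace D01 \<Longrightarrow> t \<in> {0..1} \<Longrightarrow> \<bar>z t\<bar> \<le> D01_norm z"
  using D01_dist_le[of D01_zero z t] by (simp add: D01_norm_def D01_zero_apply)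

lemma D01_norm_least: "z \<in> mspace D01 \<Longrightarrow> (\<And>t. t \<in> {0..1} \<Longrightarrow> \<bar>z t\<bar> \<le> K) \<Longrightarrow> D01_norm z \<le> K"
  unfolding D01_norm_def by (rule D01_dist_least) (auto simp: D01_zero_apply)

lemma D01_norm_diff_le:
  assumes "z \<in> mspace D01" "z' \<in> mspace D01"
  shows "D01_norm z' \<le> D01_norm z + mdist D01 z z'"
proof (rule D01_norm_least[OF assms(2)])
  fix t :: real assume t: "t \<in> {0..1}"
  show "\<bar>z' t\<bar> \<le> D01_norm z + mdist D01 z z'"
    using D01_norm_upper[OF assms(1) t] D01_dist_le[OF assms t] by linarith
qed

lemma D01_cont_at_norm: "z \<in> mspace D01 \<Longrightarrow> D01_cont_at D01_norm z"
  unfolding D01_cont_at_def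
proof (intro allI impI exI conjI ballI)
  fix e :: real and z' assume "z \<in> mspace D01" "z' \<in> mspace D01" "mdist D01 z z' < e"
  then show "\<bar>D01_norm z - D01_norm z'\<bar> < e"
    using D01_norm_diff_le[of z z'] D01_norm_diff_le[of z' z] mdist_commute[of D01 z z'] by linarith
qed

lemma D01_norm_measurable: "D01_measurable D01_norm"
proof (rule borel_measurableI_less)
  fix y
  have "{z \<in> space D01_ball_sigma. D01_norm z < y} = mball_of D01 D01_zero y"
    by (auto simp: D01_norm_def)
  then show "{z \<in> space D01_ball_sigma. D01_norm z < y} \<in> sets D01_ball_sigma"
    by (simp add: mball_D01_sets)
qed

definition clamp01 :: "real \<Rightarrow> real" where
  "clamp01 x = max 0 (min 1 x)"

lemma clamp01_bounds: "0 \<le> clamp01 x" "clamp01 x \<le> 1"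
  by (auto simp: clamp01_def)

lemma D01_cont_at_clamp01:
  assumes "D01_cont_at f z"
  shows "D01_cont_at (\<lambda>z. clamp01 (a * f z + b)) z"
  by (rule D01_cont_at_compose[OF assms, of "\<lambda>x. clamp01 (a * x + b)"])
    (unfold clamp01_def, intro continuous_intros)

text \<open>For \<open>j \<ge> 1\<close> the first factor is 0 up to \<open>1 / j\<close> and 1 from
  \<open>2 / j\<close> on; the second is 1 up to norm \<open>j\<close> and 0 from
  \<open>j + 1\<close> on. The forms \<open>+ - 1\<close> and \<open>- 1 *\<close> fit the pattern
  \<open>a * f z + b\<close> of the continuity lemma for \<open>clamp01\<close>.\<close>

definition cutoff :: "real \<Rightarrow> real \<Rightarrow> nat \<Rightarrow> (real \<Rightarrow> real) \<Rightarrow> real" where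
  "cutoff \<tau>1 \<tau>2 j z = clamp01 (real j * (INF t\<in>{\<tau>1..\<tau>2}. Q_fun t z) + - 1) *
     clamp01 (- 1 * D01_norm z + (real j + 1))"

lemma cutoff_pos:
  assumes "cutoff \<tau>1 \<tau>2 j z > 0"
  shows "j \<ge> 1" "1 / real j < (INF t\<in>{\<tau>1..\<tau>2}. Q_fun t z)" "D01_norm z < real j + 1"
proof -
  have p: "0 < clamp01 (real j * (INF t\<in>{\<tau>1..\<tau>2}. Q_fun t z) + - 1)" "0 < clamp01 (- 1 * D01_norm z + (real j + 1))"
    using assms clamp01_bounds(1) unfolding cutoff_def zero_less_mult_iff by (auto simp: not_less[symmetric])
  then have q: "1 < real j * (INF t\<in>{\<tau>1..\<tau>2}. Q_fun t z)" "D01_norm z < real j + 1"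
    by (auto simp: clamp01_def max_def min_def split: if_splits)
  then show "D01_norm z < real j + 1" by simp
  show j: "j \<ge> 1" using q(1) by (cases j) auto
  then show "1 / real j < (INF t\<in>{\<tau>1..\<tau>2}. Q_fun t z)" using q(1) by (simp add: pos_divide_less_eq mult.commute)
qed

abbreviation (input) sample_path :: "real \<Rightarrow> nat \<Rightarrow> real \<Rightarrow> (nat \<Rightarrow> real) \<Rightarrow> real \<Rightarrow> real" where
  "sample_path d n a x \<equiv> restrict (\<lambda>\<tau>. real n powr (- d - 1/2) *
     (S_sum x (floor_nat n \<tau>) - real (floor_nat n \<tau>) * a)) {0..1}"

context
  fixes \<tau>1 \<tau>2 :: real
  assumes \<tau>: "0 < \<tau>1" "\<tau>1 \<le> \<tau>2" "\<tau>2 < 1"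
begin

private abbreviation (input) "T \<equiv> {\<tau>1..\<tau>2}"

private abbreviation (input) "Q_inf z \<equiv> INF t\<in>T. Q_fun t z"

section \<open>Estimates that are uniform over the time interval\<close>

definition "edge_const = 1 / min \<tau>1 (1 - \<tau>2)"

lemma edge_const:
  assumes "t \<in> T"
  shows "1 / t \<le> edge_const" "1 / (1 - t) \<le> edge_const" "0 < t" "t < 1"
  using assms \<tau> unfolding edge_const_def by (auto intro!: divide_left_mono mult_pos_pos)

lemma edge_const_ge_1: "1 \<le> edge_const"
  using \<tau> unfolding edge_const_def by (auto simp: pos_le_divide_eq min_def)

text \<open>\<open>320 = 40 * 2^2 * 2\<close>: reflection doubles the norm and the distance. The
  forward constant 40 is enlarged to share one bound.\<close>

lemma Q_fun_close:
  assumes z: "z \<in> mspace D01" "z' \<in> mspace D01" and K: "D01_norm z \<le> K" "D01_norm z' \<le> K" "1 \<le> K" and t: "t \<in> T"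
  shows "\<bar>Q_fun t z - Q_fun t z'\<bar> \<le> 320 * edge_const ^ 3 * K\<^sup>2 * mdist D01 z z'"
    "\<bar>Q_star t z - Q_star t z'\<bar> \<le> 320 * edge_const ^ 3 * K\<^sup>2 * mdist D01 z z'"
proof -
  note e = edge_const[OF t]
  have b: "\<bar>z u\<bar> \<le> K" "\<bar>z' u\<bar> \<le> K" if "u \<in> {0..1}" for u
    using D01_norm_upper[OF z(1) that] D01_norm_upper[OF z(2) that] K by auto
  have d0: "0 \<le> mdist D01 z z'" by simp
  have p: "(1 / t) ^ 3 \<le> edge_const ^ 3" "(1 / (1 - t)) ^ 3 \<le> edge_const ^ 3"
    using e by (intro power_mono; simp)+
  have "\<bar>Q_fun t z - Q_fun t z'\<bar> \<le> 40 * (1 / t) ^ 3 * K\<^sup>2 * mdist D01 z z'"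
    by (rule Q_fun_D01_lipschitz(1)[OF z e(3,4) b K(3)])
  also have "\<dots> \<le> 320 * edge_const ^ 3 * K\<^sup>2 * mdist D01 z z'"
    using p d0 e(3) edge_const_ge_1 by (intro mult_right_mono mult_mono) auto
  finally show "\<bar>Q_fun t z - Q_fun t z'\<bar> \<le> 320 * edge_const ^ 3 * K\<^sup>2 * mdist D01 z z'" .
  have "\<bar>Q_star t z - Q_star t z'\<bar> \<le> 40 * (1 / (1 - t)) ^ 3 * (2 * K)\<^sup>2 * (2 * mdist D01 z z')"
    by (rule Q_fun_D01_lipschitz(2)[OF z e(3,4) b K(3)])
  also have "\<dots> = 320 * (1 / (1 - t)) ^ 3 * K\<^sup>2 * mdist D01 z z'" by (simp add: power_mult_distrib)
  also have "\<dots> \<le> 320 * edge_const ^ 3 * K\<^sup>2 * mdist D01 z z'"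
    using p d0 by (intro mult_right_mono mult_left_mono) auto
  finally show "\<bar>Q_star t z - Q_star t z'\<bar> \<le> 320 * edge_const ^ 3 * K\<^sup>2 * mdist D01 z z'" .
qed

text \<open>Comparison with the zero path, whose distance from \<open>z\<close> is the norm.\<close>

lemma Q_fun_star_bound:
  assumes z: "z \<in> mspace D01" and K: "D01_norm z \<le> K" "1 \<le> K" and t: "t \<in> T"
  shows "\<bar>Q_star t z\<bar> \<le> 320 * edge_const ^ 3 * K ^ 3"
proof -
  have t01: "t \<in> {0..1}" using t \<tau> by auto
  have "Q_star t D01_zero = Q_star t (\<lambda>_. 0)"
    by (rule Q_fun_star_cong[OF t01]) (simp add: D01_zero_apply)
  also have "\<dots> = 0" by (simp add: Q_fun_def path_star_def)
  finally have 0: "Q_star t D01_zero = 0" .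
  have "D01_norm D01_zero \<le> K" by (rule D01_norm_least) (use K in \<open>auto simp: D01_zero_apply\<close>)
  from Q_fun_close(2)[OF z D01_zero_in K(1) this K(2) t]
  have "\<bar>Q_star t z\<bar> \<le> 320 * edge_const ^ 3 * K\<^sup>2 * D01_norm z"
    unfolding 0 by (simp add: D01_norm_def mdist_commute)
  also have "\<dots> \<le> 320 * edge_const ^ 3 * K\<^sup>2 * K"
    using K edge_const_ge_1 by (intro mult_left_mono) auto
  finally show ?thesis by (simp add: power2_eq_square power3_eq_cube mult.assoc)
qed

lemma INF_Q_lower:
  assumes "z \<in> mspace D01" "t \<in> T"
  shows "(Q_inf z) \<le> Q_fun t z"
  by (rule cINF_lower[OF bdd_belowI2[where m=0] assms(2)]) (use Q_fun_D01_bounds(1)[OF assms(1)] \<tau> in auto)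

lemma D01_cont_at_INF_Q:
  assumes z: "z \<in> mspace D01"
  shows "D01_cont_at (\<lambda>z. Q_inf z) z"
  unfolding D01_cont_at_def
proof (intro allI impI)
  fix e :: real assume e: "e > 0"
  \<comment> \<open>Neighbours at distance below 1 have norm at most \<open>K\<close>, so one
    Lipschitz constant holds for all of them.\<close>
  define K where "K = D01_norm z + 1"
  have K: "1 \<le> K" using D01_norm_upper[OF z, of 0] by (simp add: K_def)
  define C where "C = 320 * edge_const ^ 3 * K\<^sup>2"
  have C: "C > 0" using K edge_const_ge_1 by (auto simp: C_def intro!: mult_pos_pos)
  show "\<exists>\<delta>>0. \<forall>z'\<in>mspace D01. mdist D01 z z' < \<delta> \<longrightarrow>
      \<bar>Q_inf z - Q_inf z'\<bar> < e"
  proof (intro exI[of _ "min 1 (e / C)"] conjI ballI impI)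
    fix z' assume z': "z' \<in> mspace D01" "mdist D01 z z' < min 1 (e / C)"
    have n: "D01_norm z \<le> K" "D01_norm z' \<le> K" using D01_norm_diff_le[OF z z'(1)] z'(2) by (auto simp: K_def)
    have "\<bar>Q_inf z - Q_inf z'\<bar> \<le> C * mdist D01 z z'"
    proof (rule INF_diff_abs_le)
      show "\<bar>Q_fun t z - Q_fun t z'\<bar> \<le> C * mdist D01 z z'" if "t \<in> T" for t
        unfolding C_def by (rule Q_fun_close(1)[OF z z'(1) n K that])
    qed (use \<tau> Q_fun_D01_bounds(1)[OF z] Q_fun_D01_bounds(1)[OF z'(1)] in \<open>auto intro!: bdd_belowI2[where m=0]\<close>)
    also have "\<dots> < e" using z'(2) C by (simp add: pos_less_divide_eq mult.commute)
    finally show "\<bar>Q_inf z - Q_inf z'\<bar> < e" .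
  qed (use e C in auto)
qed

lemma cutoff_measurable: "D01_measurable (cutoff \<tau>1 \<tau>2 j)"
proof -
  have [measurable]: "clamp01 \<in> borel_measurable borel" unfolding clamp01_def[abs_def] by measurable
  note INF_Q_measurable(1)[OF \<tau>, measurable] D01_norm_measurable[measurable]
  show ?thesis unfolding cutoff_def[abs_def] by measurable
qed

lemma cutoff_bounds: "0 \<le> cutoff \<tau>1 \<tau>2 j z \<and> cutoff \<tau>1 \<tau>2 j z \<le> 1"
  unfolding cutoff_def using clamp01_bounds by (auto intro!: mult_nonneg_nonneg mult_le_one)

lemma D01_cont_at_cutoff: "z \<in> mspace D01 \<Longrightarrow> D01_cont_at (cutoff \<tau>1 \<tau>2 j) z"
  unfolding cutoff_def[abs_def]
  by (intro D01_cont_at_mult D01_cont_at_clamp01 D01_cont_at_INF_Q D01_cont_at_norm)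

lemma cutoff_tendsto_1:
  assumes "0 < Q_inf z"
  shows "(\<lambda>j. cutoff \<tau>1 \<tau>2 j z) \<longlonglongrightarrow> 1"
proof (rule tendsto_eventually)
  let ?G = "Q_inf z"
  have "eventually (\<lambda>j. 2 / ?G \<le> real j) sequentially" "eventually (\<lambda>j. D01_norm z \<le> real j) sequentially"
    using filterlim_real_sequentially unfolding filterlim_at_top by auto
  then show "eventually (\<lambda>j. cutoff \<tau>1 \<tau>2 j z = 1) sequentially"
  proof eventually_elim
    case (elim j)
    then have "2 \<le> real j * ?G" using assms by (simp add: pos_divide_le_eq)
    then show ?case using elim(2) by (simp add: cutoff_def clamp01_def)
  qed
qed

lemma limit_ratio_measurable:
  assumes z: "z \<in> mspace D01"
  shows "(\<lambda>t. indicator T t * (Q_star t z / Q_fun t z)) \<in> borel_measurable borel"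
proof -
  have "(\<lambda>t. (t, z)) \<in> measurable borel (borel \<Otimes>\<^sub>M D01_ball_sigma)"
    using z by (intro measurable_Pair measurable_const) auto
  from measurable_compose[OF this Q_fun_D01_measurable] measurable_compose[OF this Q_fun_star_D01_measurable]
  have [measurable]: "(\<lambda>t. Q_fun t (clip z)) \<in> borel_measurable borel"
    "(\<lambda>t. Q_star t (clip z)) \<in> borel_measurable borel" by simp_all
  have "(\<lambda>t. indicator T t * (Q_star t (clip z) / Q_fun t (clip z))) \<in> borel_measurable borel"
    by measurable
  also have "(\<lambda>t. indicator T t * (Q_star t (clip z) / Q_fun t (clip z)))
     = (\<lambda>t. indicator T t * (Q_star t z / Q_fun t z))"
    using \<tau> by (auto simp: indicator_def Q_fun_clip Q_fun_star_clip)
  finally show ?thesis .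
qed

lemma D01_cont_at_ratio_functional:
  assumes \<Phi>: "ratio_continuous T \<Phi>" and z: "z \<in> mspace D01" and G: "0 < Q_inf z"
  shows "D01_cont_at (\<lambda>z. \<Phi> (\<lambda>t. Q_star t z) (\<lambda>t. Q_fun t z)) z" (is "D01_cont_at ?F z")
  unfolding D01_cont_at_def
proof (intro allI impI)
  fix e :: real assume e: "e > 0"
  define K where "K = D01_norm z + 1"
  have K: "1 \<le> K" using D01_norm_upper[OF z, of 0] by (simp add: K_def)
  define C where "C = 320 * edge_const ^ 3 * K\<^sup>2"
  have C: "C > 0" using K edge_const_ge_1 by (auto simp: C_def intro!: mult_pos_pos)
  define P where "P = 320 * edge_const ^ 3 * K ^ 3"
  have P: "P \<ge> 0" using K edge_const_ge_1 by (auto simp: P_def)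
  \<comment> \<open>The denominators of \<open>z\<close> are at least \<open>2 * l\<close>, so those
    of a neighbour stay above \<open>l\<close> when they move by at most \<open>l\<close>.\<close>
  define l where "l = Q_inf z / 2"
  have l: "l > 0" using G by (simp add: l_def)
  define L where "L = 1 / l + P / l\<^sup>2"
  have L: "L > 0" using l P by (auto simp: L_def intro!: add_pos_nonneg)
  \<comment> \<open>In turn: keep the norm below \<open>K\<close>, keep the denominators above
    \<open>l\<close>, and bring the final bound below \<open>e\<close>.\<close>
  let ?\<delta> = "min 1 (min (l / C) (e / (C * L)))"
  show "\<exists>\<delta>>0. \<forall>z'\<in>mspace D01. mdist D01 z z' < \<delta> \<longrightarrow>
      \<bar>?F z - ?F z'\<bar> < e"
  proof (intro exI[of _ ?\<delta>] conjI ballI impI)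
    fix z' assume z': "z' \<in> mspace D01" "mdist D01 z z' < ?\<delta>"
    let ?d = "mdist D01 z z'"
    have n: "D01_norm z \<le> K" "D01_norm z' \<le> K" using D01_norm_diff_le[OF z z'(1)] z'(2) by (auto simp: K_def)
    have de: "C * ?d \<le> l" "C * L * ?d < e" using z'(2) C L by (auto simp: pos_less_divide_eq mult.commute)
    have q: "2 * l \<le> Q_fun t z" if "t \<in> T" for t
      using INF_Q_lower[OF z that] by (simp add: l_def)
    have "\<bar>?F z - ?F z'\<bar>
      \<le> (C * ?d) * (1 / l + P / l\<^sup>2)"
    proof (rule ratio_continuousD[OF \<Phi> l])
      fix t assume t: "t \<in> T"
      show c: "\<bar>Q_fun t z - Q_fun t z'\<bar> \<le> C * ?d"
        unfolding C_def by (rule Q_fun_close(1)[OF z z'(1) n K t])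
      show "\<bar>Q_star t z - Q_star t z'\<bar> \<le> C * ?d"
        unfolding C_def by (rule Q_fun_close(2)[OF z z'(1) n K t])
      show "l \<le> Q_fun t z" using q[OF t] l by simp
      show "l \<le> Q_fun t z'" using q[OF t] c de by linarith
      show "\<bar>Q_star t z\<bar> \<le> P" unfolding P_def by (rule Q_fun_star_bound[OF z n(1) K t])
      show "\<bar>Q_star t z'\<bar> \<le> P" unfolding P_def by (rule Q_fun_star_bound[OF z'(1) n(2) K t])
    qed (use limit_ratio_measurable z z' in auto)
    also have "\<dots> < e" using de(2) unfolding L_def by (simp add: mult_ac)
    finally show "\<bar>?F z - ?F z'\<bar> < e" .
  qed (use C L l e in auto)
qed

lemma bdd_below_floor_step: "bdd_below ((\<lambda>t. g (floor_nat n t)) ` T)" for g :: "nat \<Rightarrow> real"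
proof -
  have "floor_nat n t \<le> n" if "t \<in> T" for t
  proof -
    have "real n * t \<le> real n * 1" using that \<tau> by (intro mult_left_mono) auto
    then have "\<lfloor>real n * t\<rfloor> \<le> int n" by (simp add: floor_le_iff)
    then show ?thesis by simp
  qed
  then have "(\<lambda>t. g (floor_nat n t)) ` T \<subseteq> g ` {..n}" by auto
  then show ?thesis by (meson bdd_below_mono finite_imageI finite_atMost bdd_below_finite)
qed

text \<open>The threshold for \<open>n\<close> is uniform in the sample \<open>x\<close> and the
  centring \<open>A\<close>, as the mapping theorem requires one threshold for all outcomes. This is
  possible because the estimate uses nothing but the bounds that a positive cutoff provides.\<close>

lemma statistic_close:
  fixes d e :: real
  assumes \<Phi>: "ratio_continuous T \<Phi>" "scale_invariant T \<Phi>" and e: "e > 0"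
  shows "eventually (\<lambda>n. \<forall>x A z. z = sample_path d n A x \<longrightarrow>
     z \<in> mspace D01 \<longrightarrow> cutoff \<tau>1 \<tau>2 j z > 0 \<longrightarrow>
     \<bar>\<Phi> (\<lambda>t. V_star x n (floor_nat n t)) (\<lambda>t. V_stat x (floor_nat n t))
      - \<Phi> (\<lambda>t. Q_star t z) (\<lambda>t. Q_fun t z)\<bar> < e) sequentially"
proof (cases "j \<ge> 1")
  case False
  then show ?thesis using cutoff_pos(1) by (auto intro!: always_eventually)
next
  case j: True
  define K where "K = real j + 1"
  \<comment> \<open>For \<open>n * t \<ge> 2\<close> rounding down loses at most half, so
    \<open>n / floor (n * t) \<le> 2 / t\<close>.\<close>
  define L where "L = 2 * edge_const"
  define C where "C = 240 * L ^ 5 * K ^ 3"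
  \<comment> \<open>Half of the lower bound \<open>1 / j\<close>; the other half absorbs the
    discretization error.\<close>
  define l where "l = 1 / (2 * real j)"
  \<comment> \<open>The added 1 makes room for the discretization error in the numerator, which is
    below 1 for the chosen \<open>n\<close>.\<close>
  define P where "P = 320 * edge_const ^ 3 * K ^ 3 + 1"
  have K: "1 \<le> K" by (simp add: K_def)
  have L: "1 \<le> L" using edge_const_ge_1 by (simp add: L_def)
  have C: "C > 0" using K L by (auto simp: C_def intro!: mult_pos_pos)
  have l: "l > 0" using j by (simp add: l_def)
  have P: "P \<ge> 0" using K edge_const_ge_1 by (auto simp: P_def)
  define R where "R = 1 / l + P / l\<^sup>2"
  have R: "R > 0" using l P by (auto simp: R_def intro!: add_pos_nonneg)
  have lim: "(\<lambda>n. C / real n) \<longlonglongrightarrow> 0" by (rule lim_const_over_n)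
  have "eventually (\<lambda>n. C / real n < min l (min 1 (e / R))) sequentially"
    using l e R by (intro order_tendstoD(2)[OF lim]) auto
  moreover have "eventually (\<lambda>n. 2 / \<tau>1 \<le> real n) sequentially"
    using filterlim_real_sequentially unfolding filterlim_at_top by auto
  moreover have "eventually (\<lambda>n. n \<ge> (1::nat)) sequentially" by (rule eventually_ge_at_top)
  ultimately show ?thesis
  proof eventually_elim
    case (elim n)
    have n: "n \<ge> 1" and n0: "real n > 0" using elim by auto
    show ?case
    proof (intro allI impI)
      fix x A z
      define s where "s = real n powr (- d - 1/2)"
      have s: "s > 0" using n0 by (simp add: s_def)
      assume "z = sample_path d n A x"
      then have zt: "z t = s * (S_sum x (floor_nat n t) - real (floor_nat n t) * A)" if "t \<in> {0..1}" for t
        using that by (simp add: s_def)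
      assume z: "z \<in> mspace D01" and cut: "cutoff \<tau>1 \<tau>2 j z > 0"
      have zK: "D01_norm z \<le> K" using cutoff_pos(3)[OF cut] by (simp add: K_def)
      \<comment> \<open>Each centred partial sum is the value of the path at time
        \<open>i / n\<close>, so the norm controls them all.\<close>
      have yK: "\<bar>s * (S_sum x i - real i * A)\<bar> \<le> K" if "i \<le> n" for i
      proof -
        have t: "real i / real n \<in> {0..1}" using that n0 by auto
        have "floor_nat n (real i / real n) = i" using n0 by simp
        then show ?thesis using D01_norm_upper[OF z t] zt[OF t] zK by simp
      qed
      define c where "c = real n * s\<^sup>2"
      have c: "c > 0" using n0 s by (simp add: c_def)
      define p where "p t = c * V_star x n (floor_nat n t)" for t
      define q where "q t = c * V_stat x (floor_nat n t)" for t
      have pq: "\<Phi> p q = \<Phi> (\<lambda>t. V_star x n (floor_nat n t)) (\<lambda>t. V_stat x (floor_nat n t))"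
        by (rule scale_invariantD[OF \<Phi>(2) c bdd_below_floor_step bdd_below_floor_step]) (simp_all add: p_def q_def)
      have close: "\<bar>p t - Q_star t z\<bar> \<le> C / real n" "\<bar>q t - Q_fun t z\<bar> \<le> C / real n"
        if t: "t \<in> T" for t
      proof -
        note E = edge_const[OF t]
        have t01: "t \<in> {0..1}" using E by auto
        have "2 \<le> real n * \<tau>1" using elim(2) \<tau> by (simp add: pos_divide_le_eq)
        also have "\<dots> \<le> real n * t" using t by (intro mult_left_mono) auto
        finally have nt: "2 \<le> real n * t" .
        then have k: "real n * t / 2 \<le> real (floor_nat n t)" using real_nat_floor_bounds(2)[of "real n * t"] by linarith
        then have k1: "floor_nat n t \<ge> 1" using nt by linarith
        have "real n / real (floor_nat n t) \<le> real n / (real n * t / 2)"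
          using k nt k1 n0 E by (intro divide_left_mono) (auto intro!: mult_pos_pos)
        also have "\<dots> = 2 * (1 / t)" using n0 by simp
        also have "\<dots> \<le> L" using E by (simp add: L_def)
        finally have kL: "real n / real (floor_nat n t) \<le> L" .
        have tL: "1 / t \<le> L" "1 / (1 - t) \<le> L" using E edge_const_ge_1 by (auto simp: L_def)
        have "Q_fun t z = Q_fun t (\<lambda>u. s * (S_sum x (floor_nat n u) - real (floor_nat n u) * A))"
          by (rule Q_fun_cong) (use E zt in auto)
        then show "\<bar>q t - Q_fun t z\<bar> \<le> C / real n"
          unfolding q_def c_def C_def using V_stat_close[OF n s E(3) _ k1 yK K L kL tL(1)] E by simp
        have "Q_star t z = Q_star t (\<lambda>u. s * (S_sum x (floor_nat n u) - real (floor_nat n u) * A))"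
          by (rule Q_fun_star_cong[OF t01 zt])
        then show "\<bar>p t - Q_star t z\<bar> \<le> C / real n"
          unfolding p_def c_def C_def using V_star_close[OF n s E(3,4) yK K L tL(2)] by simp
      qed
      have q2: "2 * l \<le> Q_fun t z" if "t \<in> T" for t
        using INF_Q_lower[OF z that] cutoff_pos(2)[OF cut] by (simp add: l_def)
      have Cn: "C / real n < l" "C / real n < 1" "C / real n < e / R" using elim(1) by auto
      have "\<bar>\<Phi> p q - \<Phi> (\<lambda>t. Q_star t z) (\<lambda>t. Q_fun t z)\<bar> \<le> C / real n * (1 / l + P / l\<^sup>2)"
      proof (rule ratio_continuousD[OF \<Phi>(1) l])
        fix t assume t: "t \<in> T"
        show "\<bar>p t - Q_star t z\<bar> \<le> C / real n" "\<bar>q t - Q_fun t z\<bar> \<le> C / real n"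
          using close[OF t] .
        show "l \<le> Q_fun t z" using q2[OF t] l by simp
        show "l \<le> q t" using q2[OF t] close(2)[OF t] Cn by linarith
        have "\<bar>Q_star t z\<bar> \<le> P - 1" unfolding P_def using Q_fun_star_bound[OF z zK K t] by simp
        then show "\<bar>Q_star t z\<bar> \<le> P" "\<bar>p t\<bar> \<le> P" using close(1)[OF t] Cn by linarith+
      next
        have [measurable]: "(\<lambda>t. p t / q t) \<in> borel_measurable borel"
          unfolding p_def q_def by (rule borel_measurable_floor_step)
        show "(\<lambda>t. indicator T t * (p t / q t)) \<in> borel_measurable borel" by measurable
      qed (rule limit_ratio_measurable[OF z])
      also have "\<dots> < e" using Cn(3) R unfolding R_def[symmetric] by (simp add: pos_less_divide_eq)
      finally show "\<bar>\<Phi> (\<lambda>t. V_star x n (floor_nat n t)) (\<lambda>t. V_stat x (floor_nat n t))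
        - \<Phi> (\<lambda>t. Q_star t z) (\<lambda>t. Q_fun t z)\<bar> < e" unfolding pq .
    qed
  qed
qed

lemma fbm_I_not_affine:
  assumes Z: "fbm_I N d Z"
  shows "AE w in N. \<not> (\<exists>a b. \<forall>\<tau>\<in>{0..<\<tau>1}. Z \<tau> w = a * \<tau> + b)"
  using Z unfolding fbm_I_def
proof (elim disjE conjE exE)
  assume "- 1/2 < d" "d < 1/2" "fbm_I_base N d Z"
  then show ?thesis by (intro fbm_I_base_not_affine \<tau>)
next
  fix Z' assume d: "1/2 < d" "d < 3/2" and Z': "fbm_I_base N (d - 1) Z'"
    and int: "AE w in N. \<forall>\<tau>\<ge>0. Z \<tau> w = (LINT u:{0..\<tau>}|lborel. Z' u w)"
  have "AE w in N. \<not> (\<exists>a b. \<forall>\<tau>\<in>{0..<\<tau>1}. Z' \<tau> w = a * \<tau> + b)"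
    by (rule fbm_I_base_not_affine[OF Z']) (use d \<tau> in auto)
  moreover have "AE w in N. cadlag_on {0..} (\<lambda>\<tau>. Z' \<tau> w)" using Z' unfolding fbm_I_base_def by blast
  ultimately show ?thesis using int
  proof eventually_elim
    case (elim w)
    show ?case
    proof
      assume "\<exists>a b. \<forall>\<tau>\<in>{0..<\<tau>1}. Z \<tau> w = a * \<tau> + b"
      then obtain a b where ab: "\<forall>\<tau>\<in>{0..<\<tau>1}. Z \<tau> w = a * \<tau> + b" by blast
      have c: "cadlag_on {0..1} (\<lambda>\<tau>. Z' \<tau> w)" by (rule cadlag_on_mono[OF elim(2)]) auto
      have "Z' x w = a" if "x \<in> {0..<\<tau>1}" for x
        by (rule affine_integral_imp_constant[OF c _ _ that, where c=b]) (use \<tau> ab elim(3) in auto)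
      \<comment> \<open>A constant is affine, and the parameter \<open>d - 1\<close> of
        \<open>Z'\<close> lies in the lower range, where affine paths are already excluded.\<close>
      then have "\<forall>\<tau>\<in>{0..<\<tau>1}. Z' \<tau> w = 0 * \<tau> + a" by simp
      then show False using elim(1) by blast
    qed
  qed
qed

lemma statistic_converges_in_law:
  assumes \<Phi>: "ratio_continuous T \<Phi>" "scale_invariant T \<Phi>"
    and Fm: "D01_measurable (\<lambda>z. \<Phi> (\<lambda>t. Q_star t z) (\<lambda>t. Q_fun t z))"
    and Wm: "\<And>n. (\<lambda>w. \<Phi> (\<lambda>t. V_star (\<lambda>j. X j w) n (floor_nat n t)) (\<lambda>t. V_stat (\<lambda>j. X j w) (floor_nat n t))) \<in> borel_measurable M"
    and M: "prob_space M" and \<kappa>: "\<kappa> > 0" and Z: "fbm_I N d Z"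
    and conv: "converges_weakly_D01
           M (\<lambda>n w. sample_path d n (A n) (\<lambda>j. X j w))
           N (\<lambda>w. restrict (\<lambda>\<tau>. \<kappa> * Z \<tau> w) {0..1})"
  shows "converges_in_law
     M (\<lambda>n w. \<Phi> (\<lambda>t. V_star (\<lambda>j. X j w) n (floor_nat n t)) (\<lambda>t. V_stat (\<lambda>j. X j w) (floor_nat n t)))
     N (\<lambda>w. \<Phi> (\<lambda>t. Q_star t (\<lambda>\<tau>. Z \<tau> w)) (\<lambda>t. Q_fun t (\<lambda>\<tau>. Z \<tau> w)))"
proof -
  let ?F = "\<lambda>z. \<Phi> (\<lambda>t. Q_star t z) (\<lambda>t. Q_fun t z)"
  let ?Z = "\<lambda>w. restrict (\<lambda>\<tau>. \<kappa> * Z \<tau> w) {0..1}"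
  have N: "prob_space N"
    using Z unfolding fbm_I_def fbm_I_base_def two_sided_brownian_motion_def by blast
  have Zin: "?Z w \<in> mspace D01" if "w \<in> space N" for w
    using conv measurable_space[OF _ that, of ?Z D01_ball_sigma] unfolding converges_weakly_D01_def by simp
  have Yin: "sample_path d n (A n) (\<lambda>j. X j w) \<in> mspace D01" if "w \<in> space M" for n w
  proof -
    have "(\<lambda>w. sample_path d n (A n) (\<lambda>j. X j w)) \<in> measurable M D01_ball_sigma"
      using conv unfolding converges_weakly_D01_def by (elim conjE) (erule spec)
    from measurable_space[OF this that] show ?thesis by (simp only: space_D01_ball_sigma)
  qed
  have "converges_in_law
     M (\<lambda>n w. \<Phi> (\<lambda>t. V_star (\<lambda>j. X j w) n (floor_nat n t)) (\<lambda>t. V_stat (\<lambda>j. X j w) (floor_nat n t)))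
     N (\<lambda>w. ?F (?Z w))"
  proof (rule converges_in_law_by_cutoff[OF M N conv Wm Fm cutoff_measurable cutoff_bounds D01_cont_at_cutoff])
    show "D01_cont_at ?F z" if "z \<in> mspace D01" "0 < cutoff \<tau>1 \<tau>2 j z" for j z
    proof (rule D01_cont_at_ratio_functional[OF \<Phi>(1) that(1)])
      have "0 < 1 / real j" using cutoff_pos(1)[OF that(2)] by simp
      then show "0 < Q_inf z" using cutoff_pos(2)[OF that(2)] by linarith
    qed
    show "AE w in N. (\<lambda>j. cutoff \<tau>1 \<tau>2 j (?Z w)) \<longlonglongrightarrow> 1"
      using fbm_I_not_affine[OF Z] AE_space
    proof eventually_elim
      case (elim w)
      have "0 < (INF t\<in>T. Q_fun t (?Z w))"
      proof (rule ccontr)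
        assume "\<not> 0 < (INF t\<in>T. Q_fun t (?Z w))"
        then obtain a b where ab: "\<forall>u\<in>{0..<\<tau>1}. ?Z w u = a * u + b"
          using INF_Q_eq_0_imp_affine[OF \<tau> Zin[OF elim(2)]] by (auto simp: not_less)
        have "Z u w = (a / \<kappa>) * u + b / \<kappa>" if "u \<in> {0..<\<tau>1}" for u
          using ab that \<tau> \<kappa> by (auto simp: field_simps)
        then show False using elim(1) by blast
      qed
      then show ?case by (rule cutoff_tendsto_1)
    qed
    fix j and e :: real assume "e > 0"
    from statistic_close[OF \<Phi> this, of d j]
    show "eventually (\<lambda>n. \<forall>w\<in>space M. 0 < cutoff \<tau>1 \<tau>2 j (sample_path d n (A n) (\<lambda>j. X j w)) \<longrightarrow>
       \<bar>\<Phi> (\<lambda>t. V_star (\<lambda>j. X j w) n (floor_nat n t)) (\<lambda>t. V_stat (\<lambda>j. X j w) (floor_nat n t))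
        - ?F (sample_path d n (A n) (\<lambda>j. X j w))\<bar> < e) sequentially"
      by eventually_elim (use Yin in blast)
  qed
  \<comment> \<open>\<open>Q_fun\<close> is quadratic in the path and at these times sees only
    \<open>[0,1]\<close>, so the restriction is harmless and \<open>\<kappa>^2\<close> cancels by
    scale invariance.\<close>
  moreover have "?F (?Z w) = ?F (\<lambda>\<tau>. Z \<tau> w)" if "w \<in> space N" for w
  proof (rule sym, rule scale_invariantD[OF \<Phi>(2), of "1 / \<kappa>\<^sup>2"])
    have nn: "0 \<le> Q_fun t (?Z w)" "0 \<le> Q_star t (?Z w)" if t: "t \<in> T" for t
      using Q_fun_D01_bounds[OF Zin[OF \<open>w \<in> space N\<close>]] edge_const[OF t] by auto
    show "bdd_below ((\<lambda>t. Q_star t (?Z w)) ` T)" "bdd_below ((\<lambda>t. Q_fun t (?Z w)) ` T)"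
      by (rule bdd_belowI2[where m=0], rule nn, assumption)+
    fix t assume t: "t \<in> T"
    have t01: "t \<in> {0..1}" using t \<tau> by auto
    have "Q_fun t (?Z w) = Q_fun t (\<lambda>\<tau>. \<kappa> * Z \<tau> w)" by (rule Q_fun_cong) (use t01 in auto)
    also have "\<dots> = \<kappa>\<^sup>2 * Q_fun t (\<lambda>\<tau>. Z \<tau> w)" by (rule Q_fun_cmult)
    finally show "Q_fun t (\<lambda>\<tau>. Z \<tau> w) = 1 / \<kappa>\<^sup>2 * Q_fun t (?Z w)" using \<kappa> by simp
    have "Q_star t (?Z w) = Q_star t (\<lambda>\<tau>. \<kappa> * Z \<tau> w)"
      by (rule Q_fun_star_cong[OF t01]) auto
    also have "\<dots> = \<kappa>\<^sup>2 * Q_star t (\<lambda>\<tau>. Z \<tau> w)" unfolding path_star_cmult by (rule Q_fun_cmult)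
    finally show "Q_star t (\<lambda>\<tau>. Z \<tau> w) = 1 / \<kappa>\<^sup>2 * Q_star t (?Z w)" using \<kappa> by simp
  qed (use \<kappa> in simp)
  ultimately show ?thesis
    unfolding converges_in_law_def
    by (simp cong: measurable_cong distr_cong)
qed

end

section \<open>Measurability of the statistics\<close>

lemma V_stat_measurable:
  assumes X: "\<And>j. j \<ge> 1 \<Longrightarrow> X j \<in> borel_measurable M"
  shows "(\<lambda>w. V_stat (\<lambda>j. X j w) k) \<in> borel_measurable M"
proof -
  have [measurable]: "(\<lambda>w. S_sum (\<lambda>j. X j w) k) \<in> borel_measurable M" for k
    unfolding S_sum_def by (rule borel_measurable_sum) (use X in auto)
  show ?thesis unfolding V_stat_def by measurable
qed

lemma V_star_measurable:
  assumes X: "\<And>j. j \<ge> 1 \<Longrightarrow> X j \<in> borel_measurable M"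
  shows "(\<lambda>w. V_star (\<lambda>j. X j w) n k) \<in> borel_measurable M"
proof -
  have [measurable]: "(\<lambda>w. S_star (\<lambda>j. X j w) n k) \<in> borel_measurable M" for k
    unfolding S_star_def by (rule borel_measurable_sum) (use X in auto)
  show ?thesis unfolding V_star_def by measurable
qed

text \<open>The family depends on \<open>t\<close> only through a natural number, so the supremum
  and the infimum are countable ones.\<close>

lemma SUP_floor_measurable:
  fixes g :: "nat \<Rightarrow> 'a \<Rightarrow> real"
  assumes "\<And>k. g k \<in> borel_measurable M" "T \<noteq> {}"
  shows "(\<lambda>w. SUP t\<in>T. g (floor_nat n t) w) \<in> borel_measurable M"
    and "(\<lambda>w. INF t\<in>T. g (floor_nat n t) w) \<in> borel_measurable M"
proof -
  have "(\<lambda>w. SUP k\<in>floor_nat n ` T. g k w) \<in> borel_measurable M"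
    using assms by (intro borel_measurable_SUP_real) auto
  then show "(\<lambda>w. SUP t\<in>T. g (floor_nat n t) w) \<in> borel_measurable M" by (simp add: image_image)
  have "(\<lambda>w. INF k\<in>floor_nat n ` T. g k w) \<in> borel_measurable M"
    using assms by (intro borel_measurable_INF_real) auto
  then show "(\<lambda>w. INF t\<in>T. g (floor_nat n t) w) \<in> borel_measurable M" by (simp add: image_image)
qed

text \<open>The integrand is glued from countably many random variables along the cells of constant
  index, hence jointly measurable in the outcome and the time.\<close>

lemma integral_floor_measurable:
  fixes g :: "nat \<Rightarrow> 'a \<Rightarrow> real"
  assumes "\<And>k. g k \<in> borel_measurable M"
  shows "(\<lambda>w. LINT t:{a..b}|lborel. g (floor_nat n t) w) \<in> borel_measurable M"
proof -
  have ind: "indicator {a..b} u = (if a \<le> u \<and> u \<le> b then 1 else 0 :: real)" for u :: real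
    by (auto simp: indicator_def)
  have fl: "(\<lambda>p. floor_nat n (snd p)) \<in> measurable (M \<Otimes>\<^sub>M lborel) (count_space UNIV)" by measurable
  have "(\<lambda>p. g k (fst p)) \<in> borel_measurable (M \<Otimes>\<^sub>M lborel)" for k
    by (rule measurable_compose[OF measurable_fst assms])
  then have [measurable]: "(\<lambda>p. g (floor_nat n (snd p)) (fst p)) \<in> borel_measurable (M \<Otimes>\<^sub>M lborel)"
    by (rule measurable_compose_countable[OF _ fl])
  have "(\<lambda>p. indicator {a..b} (snd p) * g (floor_nat n (snd p)) (fst p)) \<in> borel_measurable (M \<Otimes>\<^sub>M lborel)"
    unfolding ind by measurable
  then show ?thesis
    unfolding set_lebesgue_integral_def real_scaleR_def
    by (intro lborel.borel_measurable_lebesgue_integral) (simp add: split_beta')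
qed

theorem corollary3p1:
  fixes M :: "'a measure" and X :: "nat \<Rightarrow> 'a \<Rightarrow> real"
    and N :: "'b measure" and Z :: "real \<Rightarrow> 'b \<Rightarrow> real"
    and d \<kappa> \<tau>1 \<tau>2 :: real and A :: "nat \<Rightarrow> real"
  assumes "prob_space M"
    and "\<And>j. j \<ge> 1 \<Longrightarrow> X j \<in> borel_measurable M"
    and "0 < \<tau>1" and "\<tau>1 \<le> \<tau>2" and "\<tau>2 < 1"
    and "- 1/2 < d" and "d < 3/2" and "d \<noteq> 1/2" and "\<kappa> > 0"
    and "fbm_I N d Z"
    and "converges_weakly_D01
           M (\<lambda>n \<omega>. restrict (\<lambda>\<tau>. real n powr (- d - 1/2) *
                (S_sum (\<lambda>j. X j \<omega>) (floor_nat n \<tau>) - real (floor_nat n \<tau>) * A n)) {0..1})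
           N (\<lambda>\<omega>. restrict (\<lambda>\<tau>. \<kappa> * Z \<tau> \<omega>) {0..1})"
  shows "converges_in_law M (\<lambda>n \<omega>. W_stat {\<tau>1..\<tau>2} n (\<lambda>j. X j \<omega>))
                          N (\<lambda>\<omega>. W_fun {\<tau>1..\<tau>2} (\<lambda>\<tau>. Z \<tau> \<omega>))
       \<and> converges_in_law M (\<lambda>n \<omega>. I_stat {\<tau>1..\<tau>2} n (\<lambda>j. X j \<omega>))
                          N (\<lambda>\<omega>. I_fun {\<tau>1..\<tau>2} (\<lambda>\<tau>. Z \<tau> \<omega>))
       \<and> converges_in_law M (\<lambda>n \<omega>. R_stat {\<tau>1..\<tau>2} n (\<lambda>j. X j \<omega>))
                          N (\<lambda>\<omega>. R_fun {\<tau>1..\<tau>2} (\<lambda>\<tau>. Z \<tau> \<omega>))"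
proof -
  let ?T = "{\<tau>1..\<tau>2}"
    and ?L = "\<lambda>n \<omega> t. V_star (\<lambda>j. X j \<omega>) n (floor_nat n t) / V_stat (\<lambda>j. X j \<omega>) (floor_nat n t)"
    and ?Q = "\<lambda>\<omega> t. Q_star t (\<lambda>\<tau>. Z \<tau> \<omega>) / Q_fun t (\<lambda>\<tau>. Z \<tau> \<omega>)"
  have T: "?T \<noteq> {}" using assms(4) by simp
  note \<tau> = assms(3-5)
  note main = statistic_converges_in_law[OF \<tau> _ _ _ _ assms(1,9-11)]
  note Vm = V_star_measurable[OF assms(2)] V_stat_measurable[OF assms(2)]
  have Lm: "(\<lambda>\<omega>. V_star (\<lambda>j. X j \<omega>) n k / V_stat (\<lambda>j. X j \<omega>) k) \<in> borel_measurable M" for n k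
    by (intro borel_measurable_divide Vm) auto
  show ?thesis
    unfolding W_stat_def I_stat_def R_stat_def L_stat_def W_fun_def I_fun_def R_fun_def
  proof (intro conjI)
    show "converges_in_law M (\<lambda>n \<omega>. SUP t\<in>?T. ?L n \<omega> t) N (\<lambda>\<omega>. SUP t\<in>?T. ?Q \<omega> t)"
      by (rule main[where \<Phi>="\<lambda>p q. SUP t\<in>?T. p t / q t"], rule ratio_continuous_SUP[OF T], rule scale_invariant_SUP,
          rule W_fun_measurable[OF \<tau>, unfolded W_fun_def[abs_def]], rule SUP_floor_measurable(1)[OF Lm T])
    show "converges_in_law M (\<lambda>n \<omega>. LINT t:?T|lborel. ?L n \<omega> t) N (\<lambda>\<omega>. LINT t:?T|lborel. ?Q \<omega> t)"
      by (rule main[where \<Phi>="\<lambda>p q. LINT t:?T|lborel. p t / q t"], rule ratio_continuous_integral, use \<tau> in simp, use \<tau> in simp,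
          rule scale_invariant_integral, simp, rule I_fun_measurable[OF \<tau>, unfolded I_fun_def[abs_def]],
          rule integral_floor_measurable[OF Lm])
    show "converges_in_law M (\<lambda>n \<omega>. (INF t\<in>?T. V_star (\<lambda>j. X j \<omega>) n (floor_nat n t)) / (INF t\<in>?T. V_stat (\<lambda>j. X j \<omega>) (floor_nat n t)))
      N (\<lambda>\<omega>. (INF t\<in>?T. Q_star t (\<lambda>\<tau>. Z \<tau> \<omega>)) / (INF t\<in>?T. Q_fun t (\<lambda>\<tau>. Z \<tau> \<omega>)))"
      by (rule main[where \<Phi>="\<lambda>p q. (INF t\<in>?T. p t) / (INF t\<in>?T. q t)"], rule ratio_continuous_INF[OF T],
          rule scale_invariant_INF[OF T], rule R_fun_measurable[OF \<tau>, unfolded R_fun_def[abs_def]],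
          intro borel_measurable_divide SUP_floor_measurable(2)[OF Vm(1) T] SUP_floor_measurable(2)[OF Vm(2) T])
  qed
qed

end
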